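(* Let $(X,d,\mu)$ be a non-homogeneous metric measure space (geometrically doubling and upper doubling) with dominating function $\lambda$ and geometric dimension $n=\log_2 N_0$. Let $0<\alpha<n$, $1<p<n/\alpha$ and $1/q=1/p-\alpha/n$. Let $K_\alpha$ be a fractional kernel of order $\alpha$ and regularity $\epsilon$ for some $0<\epsilon\le1$, and let $I_\alpha f(x)=\int_X K_\alpha(x,y)f(y)\,d\mu(y)$. Suppose $b\in RBMO(\mu)$ and let $$[b,I_\alpha](f)(x)=b(x)I_\alpha(f)(x)-I_\alpha(bf)(x).$$ Then there exists a constant $C>0$, independent of $b$ and $f$, such that for all $f\in L^p(\mu)$, $$\|[b,I_\alpha](f)\|_{L^q(\mu)}\le C\|b\|_*\|f\|_{L^p(\mu)}.$$
   Context: **Balls.** For a metric space $(X,d)$, $B(x,r)=\{y\in X: d(x,y)<r\}$; a ball $B$ comes with a center $x_B$ and radius $r_B$, and $cB=B(x_B,cr_B)$ for $c>0$. **Geometrically doubling.** A metric space $(X,d)$ is geometrically doubling if there is $N_0\in\mathbb N$ such that every ball $B(x,r)\subset X$ has a finite covering by balls $B(x_i,r/2)$ of cardinality at most $N_0$. Fix such an $N_0$ and set $n=\log_2 N_0$ (the geometric dimension). **Upper doubling.** $(X,d,\mu)$ is upper doubling if $\mu$ is a Borel measure on $X$ and there are a dominating function $\lambda:X\times(0,+\infty)\to(0,+\infty)$ and a constant $C_\lambda>0$ such that for each $x\in X$ the map $r\mapsto\lambda(x,r)$ is non-decreasing, and for all $x\in X$, $r>0$, $$\mu(B(x,r))\le\lambda(x,r)\le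 C_\lambda\lambda(x,r/2).$$ Standing assumption: there is a constant $\widetilde C$ such that $\lambda(x,r)\le\widetilde C\lambda(y,r)$ for all $x,y\in X$ with $d(x,y)\le r$. **Non-homogeneous metric measure space.** A metric measure space that is both geometrically doubling and upper doubling. **Fractional kernel of order $\alpha$ and regularity $\epsilon$** ($0<\alpha<n$, $0<\epsilon\le1$). A function $K_\alpha\in L^1_{loc}(X\times X\setminus\{(x,y):x=y\})$ for which there are positive constants $C,C'$ such that (i) for all $x\ne y$, $\displaystyle |K_\alpha(x,y)|\le\frac{C}{[\lambda(x,d(x,y))]^{1-\alpha/n}}$; (ii) whenever $x\neq y$, $x'\neq y$ and $C'd(x,x')\le d(x,y)$, $$|K_\alpha(x,y)-K_\alpha(x',y)|+|K_\alpha(y,x)-K_\alpha(y,x')|\le\frac{C\,d(x,x')^\epsilon}{d(x,y)^\epsilon[\lambda(x,d(x,y))]^{1-\alpha/n}}.$$ Since $K_\alpha$ is defined only off the diagonal, the integral defining $I_\alpha f(x)$ is over $y\ne x$. **Doubling balls.** Fix a number $\beta_0>\max\{C_\lambda^{3\log_2 6},6^n\}$. A ball $B$ is called doubling if $\mu(6B)\le\beta_0\mu(B)$. For a ball $B$, $\widetilde B$ is the smallest doubling ball of the form $6^kB$ with $k\in\mathbb N\cup\{0\}$. For a ball $B$, $m_B(b)=\frac1{\mu(B)}\int_B b\,d\mu$. **Coefficients $K_{B,Q}$.** For balls $B\subset Q$ let $N_{B,Q}$ be the smallest integer with $6^{N_{B,Q}}r_B\ge r_Q$, and $$K_{B,Q}=1+\sum_{k=1}^{N_{B,Q}}\frac{\mu(6^kB)}{\lambda(x_B,6^kr_B)}.$$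 **$RBMO(\mu)$.** Fix $\rho>1$. A function $b\in L^1_{loc}(\mu)$ belongs to $RBMO(\mu)$ if there is a constant $C>0$ such that for every ball $B$, $$\frac1{\mu(\rho B)}\int_B|b(x)-m_{\widetilde B}(b)|\,d\mu(x)\le C,$$ and for any two doubling balls $B\subset Q$, $|m_B(b)-m_Q(b)|\le CK_{B,Q}$. The minimal such $C$ is denoted $\|b\|_*$. *)

theory Defs
  imports "HOL-Analysis.Analysis"
begin

text \<open>
  The space \<open>X\<close> is the carrier type \<open>'a :: metric_space\<close>.  A ball is handled through its centre
  \<open>x\<close> and radius \<open>r > 0\<close>, since neither is determined by the underlying set; so \<open>c B\<close> is
  \<open>ball x (c * r)\<close>.
\<close>

definition geometrically_doubling :: "'a::metric_space itself \<Rightarrow> nat \<Rightarrow> bool" where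
  "geometrically_doubling _ N0 \<longleftrightarrow>
     (\<forall>(x::'a) r. 0 < r \<longrightarrow>
        (\<exists>S. finite S \<and> card S \<le> N0 \<and> ball x r \<subseteq> (\<Union>y\<in>S. ball y (r / 2))))"

definition geometric_dim :: "nat \<Rightarrow> real" where
  "geometric_dim N0 = log 2 (real N0)"

definition upper_doubling ::
    "'a::metric_space measure \<Rightarrow> ('a \<Rightarrow> real \<Rightarrow> real) \<Rightarrow> real \<Rightarrow> bool" where
  "upper_doubling \<mu> lam C_lam \<longleftrightarrow>
     sets \<mu> = sets borel \<and> 0 < C_lam \<and>
     (\<forall>x r. 0 < r \<longrightarrow> 0 < lam x r) \<and>
     (\<forall>x r s. 0 < r \<longrightarrow> r \<le> s \<longrightarrow> lam x r \<le> lam x s) \<and>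
     (\<forall>x r. 0 < r \<longrightarrow> emeasure \<mu> (ball x r) \<le> ennreal (lam x r)) \<and>
     (\<forall>x r. 0 < r \<longrightarrow> lam x r \<le> C_lam * lam x (r / 2))"

definition L1_loc_on ::
    "'b::topological_space measure \<Rightarrow> 'b set \<Rightarrow> ('b \<Rightarrow> complex) \<Rightarrow> bool" where
  "L1_loc_on M U f \<longleftrightarrow>
     f \<in> borel_measurable (restrict_space M U) \<and>
     (\<forall>z\<in>U. \<exists>V. open V \<and> z \<in> V \<and> V \<subseteq> U \<and> set_integrable M V f)"

definition fractional_kernel ::
    "'a::metric_space measure \<Rightarrow> ('a \<Rightarrow> real \<Rightarrow> real) \<Rightarrow> real \<Rightarrow> real \<Rightarrow> real
      \<Rightarrow> ('a \<Rightarrow> 'a \<Rightarrow> complex) \<Rightarrow> bool" where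
  "fractional_kernel \<mu> lam n \<alpha> \<epsilon> K \<longleftrightarrow>
     L1_loc_on (\<mu> \<Otimes>\<^sub>M \<mu>) {(x, y). x \<noteq> y} (\<lambda>(x, y). K x y) \<and>
     (\<exists>C C'. 0 < C \<and> 0 < C' \<and>
        (\<forall>x y. x \<noteq> y \<longrightarrow> norm (K x y) \<le> C / lam x (dist x y) powr (1 - \<alpha> / n)) \<and>
        (\<forall>x x' y. x \<noteq> y \<longrightarrow> x' \<noteq> y \<longrightarrow> C' * dist x x' \<le> dist x y \<longrightarrow>
           norm (K x y - K x' y) + norm (K y x - K y x')
             \<le> C * dist x x' powr \<epsilon>
                 / (dist x y powr \<epsilon> * lam x (dist x y) powr (1 - \<alpha> / n))))"

definition frac_integral ::
    "'a measure \<Rightarrow> ('a \<Rightarrow> 'a \<Rightarrow> complex) \<Rightarrow> ('a \<Rightarrow> complex) \<Rightarrow> 'a \<Rightarrow> complex" where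
  "frac_integral \<mu> K f x = set_lebesgue_integral \<mu> (- {x}) (\<lambda>y. K x y * f y)"

text \<open>
  The Bochner integral is \<open>0\<close> for non-integrable integrands; the following predicate says that the
  integral defining \<open>frac_integral \<mu> K f x\<close> converges absolutely.
\<close>
definition frac_integral_converges ::
    "'a measure \<Rightarrow> ('a \<Rightarrow> 'a \<Rightarrow> complex) \<Rightarrow> ('a \<Rightarrow> complex) \<Rightarrow> 'a \<Rightarrow> bool" where
  "frac_integral_converges \<mu> K f x \<longleftrightarrow> set_integrable \<mu> (- {x}) (\<lambda>y. K x y * f y)"

definition commutator ::
    "'a measure \<Rightarrow> ('a \<Rightarrow> complex) \<Rightarrow> ('a \<Rightarrow> 'a \<Rightarrow> complex) \<Rightarrow> ('a \<Rightarrow> complex)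
      \<Rightarrow> 'a \<Rightarrow> complex" where
  "commutator \<mu> b K f x =
     b x * frac_integral \<mu> K f x - frac_integral \<mu> K (\<lambda>y. b y * f y) x"

definition in_Lp :: "real \<Rightarrow> 'a measure \<Rightarrow> ('a \<Rightarrow> complex) \<Rightarrow> bool" where
  "in_Lp p \<mu> f \<longleftrightarrow> f \<in> borel_measurable \<mu> \<and> integrable \<mu> (\<lambda>x. norm (f x) powr p)"

definition Lp_norm :: "real \<Rightarrow> 'a measure \<Rightarrow> ('a \<Rightarrow> complex) \<Rightarrow> real" where
  "Lp_norm p \<mu> f = (\<integral>x. norm (f x) powr p \<partial>\<mu>) powr (1 / p)"

definition doubling_ball ::
    "'a::metric_space measure \<Rightarrow> real \<Rightarrow> 'a \<Rightarrow> real \<Rightarrow> bool" where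
  "doubling_ball \<mu> \<beta> x r \<longleftrightarrow> measure \<mu> (ball x (6 * r)) \<le> \<beta> * measure \<mu> (ball x r)"

definition tilde_radius ::
    "'a::metric_space measure \<Rightarrow> real \<Rightarrow> 'a \<Rightarrow> real \<Rightarrow> real" where
  "tilde_radius \<mu> \<beta> x r = 6 ^ (LEAST k::nat. doubling_ball \<mu> \<beta> x (6 ^ k * r)) * r"

definition ball_mean ::
    "'a::metric_space measure \<Rightarrow> ('a \<Rightarrow> complex) \<Rightarrow> 'a \<Rightarrow> real \<Rightarrow> complex" where
  "ball_mean \<mu> b x r =
     set_lebesgue_integral \<mu> (ball x r) b / of_real (measure \<mu> (ball x r))"

definition N_coeff :: "real \<Rightarrow> real \<Rightarrow> int" where
  "N_coeff rB rQ = (LEAST N::int. rQ \<le> 6 powi N * rB)"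

text \<open>
  \<open>B \<subseteq> Q\<close> as sets does not force \<open>rB \<le> rQ\<close>; when \<open>N_coeff rB rQ \<le> 0\<close> the sum is empty.
\<close>
definition K_coeff ::
    "'a::metric_space measure \<Rightarrow> ('a \<Rightarrow> real \<Rightarrow> real) \<Rightarrow> 'a \<Rightarrow> real \<Rightarrow> real \<Rightarrow> real" where
  "K_coeff \<mu> lam xB rB rQ =
     1 + (\<Sum>k = 1..N_coeff rB rQ.
            measure \<mu> (ball xB (6 powi k * rB)) / lam xB (6 powi k * rB))"

text \<open>
  The mean over a ball of measure zero is undefined, so the second condition only concerns balls
  \<open>B \<subseteq> Q\<close> of positive measure (it suffices to ask this of \<open>B\<close>).  The first condition needs no such
  proviso: if \<open>\<mu>(B) = 0\<close> its left-hand side is \<open>0\<close>, and otherwise the enlarged doubling ball has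
  positive measure.
\<close>
definition RBMO_const ::
    "'a::metric_space measure \<Rightarrow> ('a \<Rightarrow> real \<Rightarrow> real) \<Rightarrow> real \<Rightarrow> real \<Rightarrow> ('a \<Rightarrow> complex)
      \<Rightarrow> real \<Rightarrow> bool" where
  "RBMO_const \<mu> lam \<beta> \<rho> b C \<longleftrightarrow>
     (\<forall>x r. 0 < r \<longrightarrow>
        1 / measure \<mu> (ball x (\<rho> * r)) *
          set_lebesgue_integral \<mu> (ball x r)
            (\<lambda>y. norm (b y - ball_mean \<mu> b x (tilde_radius \<mu> \<beta> x r))) \<le> C) \<and>
     (\<forall>x r y s. 0 < r \<longrightarrow> 0 < s \<longrightarrow> doubling_ball \<mu> \<beta> x r \<longrightarrow> doubling_ball \<mu> \<beta> y s \<longrightarrow>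
        ball x r \<subseteq> ball y s \<longrightarrow> 0 < measure \<mu> (ball x r) \<longrightarrow>
        norm (ball_mean \<mu> b x r - ball_mean \<mu> b y s) \<le> C * K_coeff \<mu> lam x r s)"

text \<open>
  Here \<open>L\<^sup>1\<^sub>l\<^sub>o\<^sub>c(\<mu>)\<close> means integrable over every ball: \<open>X\<close> need not be locally compact, and all
  the means \<open>m\<^sub>B(b)\<close> have to make sense.
\<close>
definition RBMO ::
    "'a::metric_space measure \<Rightarrow> ('a \<Rightarrow> real \<Rightarrow> real) \<Rightarrow> real \<Rightarrow> real \<Rightarrow> ('a \<Rightarrow> complex) set" where
  "RBMO \<mu> lam \<beta> \<rho> =
     {b. (\<forall>x r. set_integrable \<mu> (ball x r) b) \<and> (\<exists>C>0. RBMO_const \<mu> lam \<beta> \<rho> b C)}"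

definition RBMO_norm ::
    "'a::metric_space measure \<Rightarrow> ('a \<Rightarrow> real \<Rightarrow> real) \<Rightarrow> real \<Rightarrow> real \<Rightarrow> ('a \<Rightarrow> complex) \<Rightarrow> real" where
  "RBMO_norm \<mu> lam \<beta> \<rho> b = Inf {C. 0 < C \<and> RBMO_const \<mu> lam \<beta> \<rho> b C}"

end

theory Submission
  imports Defs
begin

text \<open>
  Write \<open>\<theta> = \<alpha>/n\<close>.  Neither the regularity of the kernel nor cancellation is needed: the positive operator
  with kernel \<open>|b x - b y| \<lambda>(x, d(x,y))\<^sup>\<theta>\<^sup>-\<^sup>1\<close> is already bounded from \<open>L\<^sup>p\<close> to \<open>L\<^sup>q\<close>.  First \<open>\<lambda>\<close> is replaced by the
  smaller function \<open>L k x = sup\<^sub>i \<mu>(B(x, 6\<^sup>k\<^sup>+\<^sup>i)) / \<beta>\<^sup>i\<close>.  To every dyadic ball one attaches the mean \<open>c k x\<close> of \<open>b\<close> over the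
  next doubling ball; these constants vary by \<open>O(\<parallel>b\<parallel>)\<close> between comparable balls, and a stopping time argument
  based on a Vitali covering and differentiation along doubling balls gives the John--Nirenberg
  inequality for \<open>b - c k x\<close>.  Splitting
  \<open>|b x - b y| \<le> |b y - c k x| + |c k x - c k y| + |b x - c k y|\<close> with \<open>6\<^sup>k \<approx> d(x,y)\<close> reduces the claim to an
  operator and its transpose.  The operator is bounded pointwise by Hedberg's argument: group the
  scales by the dyadic size of \<open>L k x\<close>, apply Hoelder and John--Nirenberg on each group, and compare with
  a maximal function.  On a group consisting of many scales \<open>\<mu>(B(x, 6\<^sup>k)) = L k x\<close>, so all the constants
  \<open>c k x\<close> of the group are comparable.  Duality then handles the transpose.
\<close>

section \<open>Dyadic radii and upper doubling\<close>

text \<open>The obstacle is the absence of reverse doubling: \<mu>(B(x, \<open>6\<^sup>k\<close>))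
  may stay constant over arbitrarily many scales. Then estimates made scale by scale need not sum
  up, and a priori the constants \<open>c k x\<close> drift by a multiple of the norm of
  \<open>b\<close> at each scale. This forces the grouping by the size of \<open>L\<close>. The two
  lower bounds on \<beta> do different jobs. \<beta> > \<open>Cl ^ 3\<close> beats the growth of
  \<open>lam\<close> per scale: it makes the supremum in \<open>L\<close> a maximum, provides
  doubling balls above every scale and bounds the coefficient sums up to the next doubling ball.
  \<beta> > 6^n beats the growth of covering numbers: it provides arbitrarily small doubling balls
  almost everywhere, without which differentiation along doubling balls would say nothing. Duality
  costs no second argument because \<theta> is kept: the conjugate exponents satisfy 1/p' = 1/q' -
  \<theta>, so the transpose falls under the same estimate. All bounds are linear in an arbitrary
  admissible constant \<open>D\<close> of \<open>b\<close>; the infimum over \<open>D\<close> is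
  taken last.\<close>

lemma geometrically_doubling_iterate:
  assumes "geometrically_doubling TYPE('a::metric_space) N0" "0 < r"
  shows "\<exists>S. finite S \<and> card S \<le> N0 ^ t \<and> ball (x::'a) r \<subseteq> (\<Union>y\<in>S. ball y (r / 2 ^ t))"
proof (induction t)
  case 0
  show ?case by (rule exI[of _ "{x}"]) auto
next
  case (Suc t)
  then obtain S where S: "finite S" "card S \<le> N0 ^ t" "ball x r \<subseteq> (\<Union>y\<in>S. ball y (r / 2 ^ t))"
    by blast
  have "\<forall>y::'a. \<exists>T. finite T \<and> card T \<le> N0 \<and> ball y (r / 2 ^ t) \<subseteq> (\<Union>z\<in>T. ball z (r / 2 ^ t / 2))"
  proof
    fix y :: 'a
    show "\<exists>T. finite T \<and> card T \<le> N0 \<and> ball y (r / 2 ^ t) \<subseteq> (\<Union>z\<in>T. ball z (r / 2 ^ t / 2))"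
      using assms(1)[unfolded geometrically_doubling_def, rule_format, of "r / 2 ^ t" y] assms(2) by simp
  qed
  then obtain T :: "'a \<Rightarrow> 'a set" where T: "\<And>y. finite (T y)" "\<And>y. card (T y) \<le> N0"
    "\<And>y. ball y (r / 2 ^ t) \<subseteq> (\<Union>z\<in>T y. ball z (r / 2 ^ t / 2))"
    by metis
  have "card (\<Union>y\<in>S. T y) \<le> (\<Sum>y\<in>S. card (T y))"
    using S(1) by (rule card_UN_le)
  also have "\<dots> \<le> (\<Sum>y\<in>S. N0)" by (intro sum_mono T)
  also have "\<dots> \<le> N0 ^ Suc t" using S(2) by simp
  finally have "card (\<Union>y\<in>S. T y) \<le> N0 ^ Suc t" .
  moreover have "ball x r \<subseteq> (\<Union>y\<in>(\<Union>y\<in>S. T y). ball y (r / 2 ^ Suc t))"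
  proof
    fix z assume "z \<in> ball x r"
    then have "z \<in> (\<Union>y\<in>S. ball y (r / 2 ^ t))" by (rule subsetD[OF S(3)])
    then obtain y where y: "y \<in> S" "z \<in> ball y (r / 2 ^ t)" by (rule UN_E)
    have "z \<in> (\<Union>w\<in>T y. ball w (r / 2 ^ t / 2))" using y(2) by (rule subsetD[OF T(3)])
    then obtain w where w: "w \<in> T y" "z \<in> ball w (r / 2 ^ t / 2)" by (rule UN_E)
    have "r / 2 ^ t / 2 = r / 2 ^ Suc t" by simp
    then show "z \<in> (\<Union>y\<in>(\<Union>y\<in>S. T y). ball y (r / 2 ^ Suc t))" using y(1) w by (intro UN_I) (simp_all add: mult.commute)
  qed
  moreover have "finite (\<Union>y\<in>S. T y)" by (intro finite_UN_I S(1) T(1))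
  ultimately show ?case by (intro exI[of _ "\<Union>y\<in>S. T y"] conjI)
qed

text \<open>Separability stands in for second countability: it makes the distance measurable for the
  product \<sigma>-algebra and disjoint families of balls countable.\<close>

lemma geometrically_doubling_separable:
  assumes "geometrically_doubling TYPE('a::metric_space) N0"
  shows "\<exists>Z::'a set. countable Z \<and> (\<forall>x. \<forall>e>0. \<exists>z\<in>Z. dist x z < e)"
proof -
  fix o' :: 'a
  have "\<forall>m t. \<exists>S. finite S \<and> ball o' (real (Suc m)) \<subseteq> (\<Union>y\<in>S. ball y (real (Suc m) / 2 ^ t))"
    using geometrically_doubling_iterate[OF assms] by (metis of_nat_0_less_iff zero_less_Suc)
  then obtain S where S: "\<And>m t. finite (S m t)"
    "\<And>m t. ball o' (real (Suc m)) \<subseteq> (\<Union>y\<in>S m t. ball y (real (Suc m) / 2 ^ t))"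
    by metis
  let ?Z = "\<Union>m. \<Union>t. S m t"
  have "countable ?Z" by (rule countable_UN[OF countableI_type countable_UN[OF countableI_type countable_finite[OF S(1)]]])
  moreover have "\<exists>z\<in>?Z. dist x z < e" if e: "e > 0" for x e
  proof -
    obtain m where m: "dist o' x < real m" using reals_Archimedean2 by blast
    obtain t where t: "real (Suc m) / e < 2 ^ t"
      using real_arch_pow[of 2] by auto
    have "x \<in> ball o' (real (Suc m))" using m by simp
    then obtain y where y: "y \<in> S m t" "dist y x < real (Suc m) / 2 ^ t" using S(2) by fastforce
    have "real (Suc m) / 2 ^ t < e" using t e by (simp add: field_simps)
    then show ?thesis using y by (metis UN_I UNIV_I dist_commute less_trans)
  qed
  ultimately show ?thesis by blast
qed

section \<open>Radii that are powers of 6, and the standing setup\<close>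

abbreviation pow6 :: "int \<Rightarrow> real" where "pow6 k \<equiv> 6 powi k"

lemma pow6_pos [simp]: "0 < pow6 k" "0 \<le> pow6 k" "pow6 k \<noteq> 0"
  by auto

lemma pow6_mono: "k \<le> m \<Longrightarrow> pow6 k \<le> pow6 m"
  by (rule power_int_increasing) auto

lemma pow6_strict_mono: "k < m \<Longrightarrow> pow6 k < pow6 m"
  by (rule power_int_strict_increasing) auto

lemma pow6_add: "pow6 (k + int i) = pow6 k * 6 ^ i"
  by (simp add: power_int_add)

lemma pow6_Suc: "pow6 (k + 1) = 6 * pow6 k"
  by (simp add: power_int_add)

lemma pow6_large: "\<exists>k. a < pow6 k"
proof -
  obtain n where "a < 6 ^ n" using real_arch_pow[of 6 a] by auto
  then have "a < pow6 (int n)" by simp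
  then show ?thesis ..
qed

lemma pow6_small: assumes "0 < e" shows "\<exists>k. pow6 k < e"
proof -
  obtain k where "1 / e < pow6 k" using pow6_large by blast
  then have "pow6 (- k) < e" using assms by (simp add: power_int_minus field_simps)
  then show ?thesis ..
qed

lemma ball_subset_dist:
  assumes "dist x y + r \<le> s" shows "ball x r \<subseteq> ball (y::'a::metric_space) s"
proof
  fix z assume "z \<in> ball x r"
  then have "dist x z < r" by simp
  moreover have "dist y z \<le> dist x y + dist x z" by (metis dist_commute dist_triangle)
  ultimately show "z \<in> ball y s" using assms by simp
qed

definition lev :: "'a::metric_space \<Rightarrow> 'a \<Rightarrow> int" where
  "lev x y = \<lfloor>log 6 (dist x y)\<rfloor>"

lemma lev_iff: assumes "x \<noteq> y" shows "lev x y = k \<longleftrightarrow> pow6 k \<le> dist x y \<and> dist x y < pow6 (k + 1)"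
proof -
  have d: "dist x y > 0" using assms by simp
  have *: "6 powr of_int k = pow6 k" for k :: int by (rule powr_real_of_int') auto
  have "lev x y = k \<longleftrightarrow> of_int k \<le> log 6 (dist x y) \<and> log 6 (dist x y) < of_int (k + 1)"
    unfolding lev_def by (simp add: floor_eq_iff)
  also have "\<dots> \<longleftrightarrow> 6 powr of_int k \<le> dist x y \<and> dist x y < 6 powr of_int (k + 1)"
    using d by (simp add: le_log_iff log_less_iff)
  finally show ?thesis unfolding * .
qed

lemma lev_commute: "lev x y = lev y x"
  by (simp add: lev_def dist_commute)

text \<open>\<open>2 \<le> N0\<close> says that the geometric dimension is at least 1. It is the
  form in which n > 0 is used, and it yields \<open>6 < \<beta>\<close>.\<close>

locale udspace =
  fixes \<mu> :: "'a::metric_space measure"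
    and lam :: "'a \<Rightarrow> real \<Rightarrow> real" and Cl \<beta> :: real and N0 :: nat
  assumes gd: "geometrically_doubling TYPE('a) N0"
    and ud: "upper_doubling \<mu> lam Cl"
    and beta: "max (Cl powr (3 * log 2 6)) (6 powr geometric_dim N0) < \<beta>"
    and N0: "2 \<le> N0"
begin

lemma sets_mu [measurable_cong, simp]: "sets \<mu> = sets borel"
  using ud by (simp add: upper_doubling_def)

lemma space_mu [simp]: "space \<mu> = UNIV"
  using sets_eq_imp_space_eq[OF sets_mu] by simp

lemma lam_pos: "0 < r \<Longrightarrow> 0 < lam x r"
  and lam_mono: "0 < r \<Longrightarrow> r \<le> s \<Longrightarrow> lam x r \<le> lam x s"
  and emeasure_ball_le: "0 < r \<Longrightarrow> emeasure \<mu> (ball x r) \<le> ennreal (lam x r)"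
  and lam_half: "0 < r \<Longrightarrow> lam x r \<le> Cl * lam x (r / 2)"
  using ud by (auto simp: upper_doubling_def)

lemma Cl_ge_1: "1 \<le> Cl"
proof -
  fix x
  have "lam x 1 \<le> Cl * lam x (1/2)" using lam_half[of 1 x] by simp
  also have "\<dots> \<le> Cl * lam x 1"
    using ud by (intro mult_left_mono lam_mono) (auto simp: upper_doubling_def)
  finally show ?thesis using lam_pos[of 1 x] by simp
qed

text \<open>Passing from \<open>r\<close> to \<open>6 * r\<close> costs three halvings because 6
  \<le> 8, so \<open>Cl ^ 3\<close> bounds the growth of \<open>lam\<close> per scale
  (\<open>lam_6\<close>). As log 2 6 \<ge> 1, the exponent in the choice of \<beta> covers
  it.\<close>

lemma beta_gt_Cl: "Cl ^ 3 < \<beta>"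
proof -
  have "Cl ^ 3 = Cl powr 3" using Cl_ge_1 by (simp add: powr_numeral)
  also have "\<dots> \<le> Cl powr (3 * log 2 6)" using Cl_ge_1
    by (intro powr_mono) (auto simp: le_log_iff)
  finally show ?thesis using beta by simp
qed

lemma geometric_dim_ge_1: "1 \<le> geometric_dim N0"
  using N0 by (simp add: geometric_dim_def le_log_iff)

lemma beta_gt_6: "6 < \<beta>"
proof -
  have "6 = 6 powr (1::real)" by simp
  also have "\<dots> \<le> 6 powr geometric_dim N0" using geometric_dim_ge_1 by (intro powr_mono) auto
  finally show ?thesis using beta by simp
qed

lemma beta_pos [simp]: "0 < \<beta>" "0 \<le> \<beta>" "1 \<le> \<beta>" "1 < \<beta>" "\<beta> \<noteq> 0"
  using beta_gt_6 by auto

lemma emeasure_ball_finite [simp]: "emeasure \<mu> (ball x r) \<noteq> top"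
proof (cases "0 < r")
  case True
  then show ?thesis using emeasure_ball_le[OF True, of x] by (auto simp: top_unique)
qed (simp add: ball_empty)

lemma emeasure_ball_less_top [simp]: "emeasure \<mu> (ball x r) < top"
  by (rule top.not_eq_extremum[THEN iffD1, OF emeasure_ball_finite])

lemma fmeasurable_ball [simp]: "ball x r \<in> fmeasurable \<mu>"
  by (rule fmeasurableI) simp_all

definition V :: "int \<Rightarrow> 'a \<Rightarrow> real" where "V k x = measure \<mu> (ball x (pow6 k))"

lemma emeasure_V: "emeasure \<mu> (ball x (pow6 k)) = ennreal (V k x)"
  unfolding V_def by (rule emeasure_eq_ennreal_measure) simp

lemma V_nonneg [simp]: "0 \<le> V k x" by (simp add: V_def)

lemma V_mono_ball: "ball x (pow6 k) \<subseteq> ball y (pow6 m) \<Longrightarrow> V k x \<le> V m y"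
  unfolding V_def by (rule measure_mono_fmeasurable) auto

lemma V_mono: "k \<le> m \<Longrightarrow> V k x \<le> V m x"
  by (intro V_mono_ball subset_ball pow6_mono)

lemma ball_pow6_shift:
  assumes "dist x y < pow6 (k + 1)" "k \<le> m"
  shows "ball x (pow6 m) \<subseteq> ball y (pow6 (m + 2))"
proof (rule ball_subset_dist)
  \<comment> \<open>The required radius is below 7 * \<open>pow6 m\<close>; one scale up may be too
    small, two suffice.\<close>
  have "pow6 (k + 1) \<le> 6 * pow6 m" using pow6_mono[of "k+1" "m+1"] assms by (simp add: pow6_Suc[of m])
  moreover have "pow6 (m + 2) = 36 * pow6 m" by (simp add: power_int_add)
  ultimately show "dist x y + pow6 m \<le> pow6 (m + 2)" using assms(1) pow6_pos(1)[of m] by linarith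
qed

lemma V_shift: "dist x y < pow6 (k + 1) \<Longrightarrow> k \<le> m \<Longrightarrow> V m x \<le> V (m + 2) y"
  by (intro V_mono_ball ball_pow6_shift)

lemma V_le_lam: "V k x \<le> lam x (pow6 k)"
  using emeasure_ball_le[of "pow6 k" x] lam_pos[of "pow6 k" x] by (simp add: emeasure_V)

lemma lam_6: assumes "0 < r" shows "lam x (6 * r) \<le> Cl ^ 3 * lam x r"
proof -
  have C: "0 \<le> Cl" using Cl_ge_1 by simp
  have "lam x (6 * r) \<le> lam x (8 * r)" using assms by (intro lam_mono) auto
  also have "\<dots> \<le> Cl * lam x (4 * r)" using lam_half[of "8 * r" x] assms by simp
  also have "\<dots> \<le> Cl * (Cl * lam x (2 * r))"
    using lam_half[of "4 * r" x] assms C by (intro mult_left_mono) auto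
  also have "\<dots> \<le> Cl * (Cl * (Cl * lam x r))"
    using lam_half[of "2 * r" x] assms C by (intro mult_left_mono) auto
  finally show ?thesis by (simp add: power3_eq_cube mult.assoc)
qed

lemma lam_pow6: "lam x (pow6 (k + int i)) \<le> (Cl ^ 3) ^ i * lam x (pow6 k)"
proof (induction i)
  case (Suc i)
  have "lam x (pow6 (k + int (Suc i))) = lam x (6 * pow6 (k + int i))"
    by (simp add: power_int_add mult_ac)
  also have "\<dots> \<le> Cl ^ 3 * lam x (pow6 (k + int i))" by (rule lam_6) simp
  also have "\<dots> \<le> Cl ^ 3 * ((Cl ^ 3) ^ i * lam x (pow6 k))"
    using Suc Cl_ge_1 by (intro mult_left_mono) auto
  finally show ?case by (simp add: mult_ac)
qed simp

end

section \<open>The minimal dominating function\<close>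

lemma sum_power_int_interval_le:
  fixes \<gamma> :: real
  assumes "0 \<le> \<gamma>" "\<gamma> < 1"
  shows "(\<Sum>m=k..T. \<gamma> ^ nat (T - m)) \<le> 1 / (1 - \<gamma>)"
proof -
  have "(\<Sum>m=k..T. \<gamma> ^ nat (T - m)) = (\<Sum>i<nat (T - k + 1). \<gamma> ^ i)"
    by (rule sum.reindex_bij_witness[of _ "\<lambda>i. T - int i" "\<lambda>m. nat (T - m)"]) auto
  also have "\<dots> \<le> (\<Sum>i. \<gamma> ^ i)"
    using assms by (intro sum_le_suminf) auto
  also have "\<dots> = 1 / (1 - \<gamma>)" using assms by (simp add: suminf_geometric)
  finally show ?thesis .
qed

text \<open>A nonzero measure makes every \<open>L k x\<close> positive. The zero measure is treated
  separately in the theorem.\<close>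

locale nhspace = udspace +
  assumes nz: "emeasure \<mu> UNIV \<noteq> 0"
begin

lemma UNIV_eq_UN_ball: "UNIV = (\<Union>n. ball x (pow6 (int n)))"
proof -
  have "y \<in> (\<Union>n. ball x (pow6 (int n)))" for y
  proof -
    obtain n where "dist x y < 6 ^ n" using real_arch_pow[of 6] by auto
    then show ?thesis by auto
  qed
  then show ?thesis by auto
qed

lemma ex_V_pos: "\<exists>i. 0 < V (k + int i) x"
proof (rule ccontr)
  assume *: "\<not> ?thesis"
  have "V (int n) x = 0" for n
  proof -
    have "V (int n) x \<le> V (k + int (nat (int n - k))) x" by (intro V_mono) auto
    then show ?thesis using * V_nonneg[of "int n" x] by (metis less_le_not_le order.trans antisym_conv2)
  qed
  then have "emeasure \<mu> (\<Union>n. ball x (pow6 (int n))) = 0"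
    by (intro emeasure_UN_eq_0) (auto simp: emeasure_V simp del: power_int_of_nat)
  then show False using nz UNIV_eq_UN_ball[of x] by simp
qed

text \<open>\<open>lam\<close> grows by at most \<open>Cl ^ 3 < \<beta>\<close> per scale, so
  dividing by \<open>\<beta> ^ i\<close> beats the growth of the measures. This decay makes the
  supremum \<open>L\<close> finite and attained.\<close>

lemma V_decay: "V (k + int i) x / \<beta> ^ i \<le> (Cl ^ 3 / \<beta>) ^ i * lam x (pow6 k)"
proof -
  have "V (k + int i) x \<le> (Cl ^ 3) ^ i * lam x (pow6 k)"
    using V_le_lam[of "k + int i" x] lam_pow6[of x k i] by simp
  then show ?thesis by (simp add: power_divide divide_right_mono)
qed

text \<open>Up to constants \<open>L k x\<close> is the smallest dominating function, at radius \<open>6\<^sup>k\<close>, whose growth per scale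
  is at most \<open>\<beta>\<close>.  Unlike \<open>lam\<close> it can only stay constant over several scales if it coincides there
  with the measure of the ball.\<close>
definition L :: "int \<Rightarrow> 'a \<Rightarrow> real" where
  "L k x = (SUP i. V (k + int i) x / \<beta> ^ i)"

lemma ex_V_max: "\<exists>i. \<forall>j. V (k + int j) x / \<beta> ^ j \<le> V (k + int i) x / \<beta> ^ i"
proof -
  define a where "a j = V (k + int j) x / \<beta> ^ j" for j
  \<comment> \<open>A single positive term exceeds the whole tail, so only finitely many indices
    compete for the maximum.\<close>
  obtain i0 where "0 < V (k + int i0) x" using ex_V_pos[of k x] by blast
  then have i0: "0 < a i0" by (simp add: a_def)
  have \<gamma>: "0 \<le> Cl ^ 3 / \<beta>" "Cl ^ 3 / \<beta> < 1"
    using beta_gt_Cl Cl_ge_1 by auto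
  have "(\<lambda>i. (Cl ^ 3 / \<beta>) ^ i * lam x (pow6 k)) \<longlonglongrightarrow> 0 * lam x (pow6 k)"
    using \<gamma> by (intro tendsto_mult LIMSEQ_realpow_zero) auto
  then have "a \<longlonglongrightarrow> 0"
    by (intro tendsto_sandwich[of "\<lambda>_. 0" a sequentially "\<lambda>i. (Cl ^ 3 / \<beta>) ^ i * lam x (pow6 k)"])
       (auto simp: a_def V_decay)
  then have "\<forall>\<^sub>F i in sequentially. a i < a i0" using i0 by (rule order_tendstoD)
  then obtain N where N: "\<And>i. i \<ge> N \<Longrightarrow> a i < a i0" by (auto simp: eventually_sequentially)
  let ?S = "a ` {..max N i0}"
  have fin: "finite ?S" "?S \<noteq> {}" by auto
  then obtain i where i: "i \<le> max N i0" "a i = Max ?S" using Max_in by (metis (no_types, lifting) atMost_iff imageE)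
  have "a j \<le> a i" for j
  proof (cases "j \<le> max N i0")
    case True then show ?thesis using i fin by auto
  next
    case False
    then have "a j < a i0" using N by simp
    also have "a i0 \<le> Max ?S" using fin by (intro Max_ge) auto
    finally show ?thesis using i by simp
  qed
  then show ?thesis by (auto simp: a_def)
qed

lemma L_attained: obtains i where "L k x = V (k + int i) x / \<beta> ^ i"
  and "\<And>j. V (k + int j) x / \<beta> ^ j \<le> L k x"
proof -
  obtain i where i: "\<And>j. V (k + int j) x / \<beta> ^ j \<le> V (k + int i) x / \<beta> ^ i"
    using ex_V_max by blast
  have "L k x = V (k + int i) x / \<beta> ^ i" unfolding L_def
    by (rule cSup_eq_maximum) (use i in auto)
  then show thesis using i that by metis
qed

lemma L_ge: "V (k + int j) x / \<beta> ^ j \<le> L k x"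
  using L_attained by metis

lemma V_le_L: "V k x \<le> L k x"
  using L_ge[of k 0] by simp

lemma L_le: "(\<And>j. V (k + int j) x / \<beta> ^ j \<le> C) \<Longrightarrow> L k x \<le> C"
  using L_attained by metis

lemma L_pos [simp]: "0 < L k x"
proof -
  obtain i where "0 < V (k + int i) x" using ex_V_pos by blast
  then have "0 < V (k + int i) x / \<beta> ^ i" by simp
  then show ?thesis using L_ge[of k i x] by linarith
qed

lemma L_nonneg [simp]: "0 \<le> L k x" "L k x \<noteq> 0"
  using less_imp_le[OF L_pos[of k x]] less_imp_neq[OF L_pos[of k x]] by simp_all

lemma L_le_lam: "L k x \<le> lam x (pow6 k)"
proof (rule L_le)
  fix j
  have "(Cl ^ 3 / \<beta>) ^ j \<le> 1" using beta_gt_Cl Cl_ge_1 by (intro power_le_one) auto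
  then have "(Cl ^ 3 / \<beta>) ^ j * lam x (pow6 k) \<le> 1 * lam x (pow6 k)"
    using lam_pos[of "pow6 k" x] by (intro mult_right_mono) auto
  then show "V (k + int j) x / \<beta> ^ j \<le> lam x (pow6 k)" using V_decay[of k j x] by simp
qed

lemma L_Suc_le: "L (k + 1) x \<le> \<beta> * L k x"
proof (rule L_le)
  fix j
  have "V (k + 1 + int j) x / \<beta> ^ j = \<beta> * (V (k + int (Suc j)) x / \<beta> ^ Suc j)"
    by (simp add: add_ac)
  also have "\<dots> \<le> \<beta> * L k x" by (intro mult_left_mono L_ge) auto
  finally show "V (k + 1 + int j) x / \<beta> ^ j \<le> \<beta> * L k x" .
qed

text \<open>Split off the term i = 0 of the supremum; the others form the supremum one scale up,
  divided by \<beta>. Hence a scale is doubling, or \<open>L\<close> grows there by exactly the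
  factor \<beta>.\<close>

lemma L_step: "L k x = max (V k x) (L (k + 1) x / \<beta>)"
proof (rule antisym)
  show "L k x \<le> max (V k x) (L (k + 1) x / \<beta>)"
  proof (rule L_le)
    fix j show "V (k + int j) x / \<beta> ^ j \<le> max (V k x) (L (k + 1) x / \<beta>)"
    proof (cases j)
      case (Suc i)
      have "V (k + 1 + int i) x / \<beta> ^ i / \<beta> \<le> L (k + 1) x / \<beta>"
        by (intro divide_right_mono L_ge) auto
      then show ?thesis using Suc by (simp add: add_ac mult_ac le_max_iff_disj)
    qed simp
  qed
  show "max (V k x) (L (k + 1) x / \<beta>) \<le> L k x"
    using V_le_L L_Suc_le[of k x] by (simp add: field_simps)
qed

lemma L_le_Suc: "L k x \<le> L (k + 1) x"
proof (rule L_le)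
  fix j
  have "V (k + int j) x / \<beta> ^ j \<le> V (k + 1 + int j) x / \<beta> ^ j"
    by (intro divide_right_mono V_mono) auto
  also have "\<dots> \<le> L (k + 1) x" by (rule L_ge)
  finally show "V (k + int j) x / \<beta> ^ j \<le> L (k + 1) x" .
qed

lemma L_mono: assumes "k \<le> m" shows "L k x \<le> L m x"
  using assms
proof (induction m rule: int_ge_induct)
  case (step i) then show ?case using L_le_Suc[of i x] by simp
qed simp

lemma L_add_le: "L (k + int i) x \<le> \<beta> ^ i * L k x"
proof (induction i)
  case (Suc i)
  have "L (k + int (Suc i)) x \<le> \<beta> * L (k + int i) x"
    using L_Suc_le[of "k + int i" x] by (simp add: add_ac)
  also have "\<dots> \<le> \<beta> * (\<beta> ^ i * L k x)" using Suc by (intro mult_left_mono) auto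
  finally show ?case by simp
qed simp

text \<open>Moving the centre by about the radius costs two scales (\<open>V_shift\<close>), each
  worth a factor \<beta>.\<close>

lemma L_shift: assumes "dist x y < pow6 (k + 1)" shows "L k x \<le> \<beta> ^ 2 * L k y"
proof (rule L_le)
  fix j
  have "V (k + int j) x \<le> V (k + int j + 2) y"
    using assms by (intro V_shift) auto
  also have "\<dots> = \<beta> ^ (j + 2) * (V (k + int (j + 2)) y / \<beta> ^ (j + 2))" by (simp add: add_ac)
  also have "\<dots> \<le> \<beta> ^ (j + 2) * L k y" by (intro mult_left_mono L_ge) auto
  finally show "V (k + int j) x / \<beta> ^ j \<le> \<beta> ^ 2 * L k y"
    by (simp add: power_add power2_eq_square pos_divide_le_eq mult_ac)
qed

text \<open>This is stronger than \<open>(6, \<beta>)\<close>-doubling: it bounds the measures of all concentric larger balls.\<close>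
definition dbl :: "int \<Rightarrow> 'a \<Rightarrow> bool" where "dbl k x \<longleftrightarrow> V k x = L k x"

text \<open>An index attaining the supremum is a doubling scale: the measure of its ball is
  \<open>\<beta> ^ i * L k x\<close>, which bounds \<open>L\<close> at that scale.\<close>

lemma ex_dbl: "\<exists>i. dbl (k + int i) x"
proof -
  obtain i where i: "L k x = V (k + int i) x / \<beta> ^ i" using L_attained by metis
  have "L (k + int i) x \<le> V (k + int i) x"
    using L_add_le[of k i x] i by simp
  then show ?thesis using V_le_L[of "k + int i" x] by (auto simp: dbl_def intro!: exI[of _ i])
qed

definition next_dbl :: "int \<Rightarrow> 'a \<Rightarrow> int" where
  "next_dbl k x = k + int (LEAST i. dbl (k + int i) x)"

lemma dbl_next_dbl: "dbl (next_dbl k x) x"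
  unfolding next_dbl_def using ex_dbl by (rule LeastI_ex)

lemma next_dbl_ge: "k \<le> next_dbl k x"
  by (simp add: next_dbl_def)

lemma next_dbl_le: assumes "k \<le> m" "dbl m x" shows "next_dbl k x \<le> m"
proof -
  have "(LEAST i. dbl (k + int i) x) \<le> nat (m - k)" using assms by (intro Least_le) auto
  then show ?thesis using assms by (simp add: next_dbl_def)
qed

lemma next_dbl_eqI: "k \<le> m \<Longrightarrow> dbl m x \<Longrightarrow> (\<And>i. k \<le> i \<Longrightarrow> i < m \<Longrightarrow> \<not> dbl i x) \<Longrightarrow> next_dbl k x = m"
  using next_dbl_le[of k m x] next_dbl_ge[of k x] dbl_next_dbl[of k x] by force

lemma not_dbl_below_next_dbl: "k \<le> m \<Longrightarrow> m < next_dbl k x \<Longrightarrow> \<not> dbl m x"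
  using next_dbl_le[of k m x] by force

lemma next_dbl_dbl: "dbl k x \<Longrightarrow> next_dbl k x = k"
  by (rule next_dbl_eqI) auto

lemma next_dbl_not_dbl: assumes "\<not> dbl k x" shows "next_dbl k x = next_dbl (k + 1) x"
proof (rule next_dbl_eqI)
  show "k \<le> next_dbl (k + 1) x" using next_dbl_ge[of "k+1" x] by simp
  show "\<not> dbl i x" if "k \<le> i" "i < next_dbl (k + 1) x" for i
    using that assms not_dbl_below_next_dbl[of "k+1" i x] by (cases "i = k") auto
qed (rule dbl_next_dbl)

lemma L_not_dbl: "\<not> dbl k x \<Longrightarrow> L (k + 1) x = \<beta> * L k x"
  using L_step[of k x] by (auto simp: dbl_def max_def split: if_splits)

lemma L_below_next_dbl_aux: "(\<And>i. i < j \<Longrightarrow> \<not> dbl (k + int i) x) \<Longrightarrow> L (k + int j) x = \<beta> ^ j * L k x"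
proof (induction j)
  case (Suc j)
  then have "L (k + int j + 1) x = \<beta> * L (k + int j) x" by (intro L_not_dbl) auto
  also have "k + int j + 1 = k + int (Suc j)" by simp
  finally show ?case using Suc by simp
qed simp

lemma L_below_next_dbl:
  assumes "k \<le> m" "m \<le> next_dbl k x"
  shows "L (next_dbl k x) x = \<beta> ^ nat (next_dbl k x - m) * L m x"
  using L_below_next_dbl_aux[of "nat (next_dbl k x - m)" m x] not_dbl_below_next_dbl[of k _ x] assms by auto

text \<open>\<open>\<beta> ^ 3\<close> pays for moving a ball to the other centre (three scales),
  \<open>(Cl ^ 3) ^ 3\<close> for moving back, and the last factor sums the geometric series of
  ratio \<open>Cl ^ 3 / \<beta>\<close>.\<close>

definition ratio_sum :: real where "ratio_sum = \<beta> ^ 3 * (Cl ^ 3) ^ 3 / (1 - Cl ^ 3 / \<beta>)"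

lemma ratio_sum_nonneg [simp]: "0 \<le> ratio_sum"
  unfolding ratio_sum_def using beta_gt_Cl Cl_ge_1 by simp

text \<open>Below the next doubling ball around \<open>y\<close> the function \<open>L\<close> gains a factor \<open>\<beta>\<close> at every step,
  whereas \<open>lam\<close> gains at most \<open>Cl\<^sup>3 < \<beta>\<close>; hence the ratios decay geometrically.\<close>
lemma sum_ratio_le:
  assumes "dist x y < pow6 (k + 2)"
  shows "(\<Sum>m=k..next_dbl k y. V m x / lam x (pow6 m)) \<le> ratio_sum"
proof -
  define T where "T = next_dbl k y"
  define \<gamma> where "\<gamma> = Cl ^ 3 / \<beta>"
  have \<gamma>: "0 \<le> \<gamma>" "\<gamma> < 1" using beta_gt_Cl Cl_ge_1 by (auto simp: \<gamma>_def)
  have C: "0 < Cl ^ 3" using Cl_ge_1 by simp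
  have bound: "V m x / lam x (pow6 m) \<le> \<beta> ^ 3 * (Cl ^ 3) ^ 3 * \<gamma> ^ nat (T - m)"
    if m: "k \<le> m" "m \<le> T" for m
  proof -
    define i where "i = nat (T - m)"
    have T: "T = m + int i" using m by (simp add: i_def)
    have pk: "pow6 (k + 2) \<le> 36 * pow6 m" using pow6_mono[of "k+2" "m+2"] m by (simp add: power_int_add)
    have p3: "pow6 (m + 3) = 216 * pow6 m" "pow6 (T + 3) = 216 * pow6 T" by (simp_all add: power_int_add)
    have "V m x \<le> V (m + 3) y"
      by (intro V_mono_ball ball_subset_dist) (use pk p3 assms pow6_pos(1)[of m] in linarith)
    also have "V (m + 3) y \<le> L (m + int 3) y" using V_le_L by simp
    also have "\<dots> \<le> \<beta> ^ 3 * L m y" by (rule L_add_le)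
    finally have 1: "V m x \<le> \<beta> ^ 3 * L m y" .
    \<comment> \<open>At the doubling scale \<open>T\<close> the value \<open>L T y\<close> is the
      mass of an actual ball, hence dominated by \<open>lam\<close> at x; this bounds
      \<open>lam x (pow6 m)\<close> from below.\<close>
    have LT: "L T y = \<beta> ^ i * L m y" using L_below_next_dbl[of k m y] m by (simp add: T_def i_def)
    have LV: "L T y = V T y" using dbl_next_dbl[of k y] by (simp add: T_def dbl_def)
    have "pow6 m \<le> pow6 T" using m by (intro pow6_mono) simp
    then have "V T y \<le> V (T + 3) x"
      by (intro V_mono_ball ball_subset_dist) (use pk p3 assms pow6_pos(1)[of T] dist_commute[of y x] in linarith)
    also have "\<dots> \<le> lam x (pow6 (T + 3))" by (rule V_le_lam)
    also have "T + 3 = m + int (i + 3)" by (simp add: T)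
    also have "lam x (pow6 \<dots>) \<le> (Cl ^ 3) ^ (i + 3) * lam x (pow6 m)" by (rule lam_pow6)
    finally have 2: "\<beta> ^ i * L m y \<le> (Cl ^ 3) ^ (i + 3) * lam x (pow6 m)" using LT LV by simp
    have "\<beta> ^ i * V m x \<le> \<beta> ^ 3 * (\<beta> ^ i * L m y)"
      using mult_left_mono[OF 1, of "\<beta> ^ i"] by (simp add: mult_ac)
    also have "\<dots> \<le> \<beta> ^ 3 * ((Cl ^ 3) ^ (i + 3) * lam x (pow6 m))"
      using 2 by (intro mult_left_mono) auto
    finally have "\<beta> ^ i * V m x \<le> \<beta> ^ 3 * ((Cl ^ 3) ^ (i + 3) * lam x (pow6 m))" .
    then show ?thesis using lam_pos[of "pow6 m" x] unfolding i_def[symmetric] \<gamma>_def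
      by (simp add: field_simps power_add)
  qed
  have "(\<Sum>m=k..T. V m x / lam x (pow6 m)) \<le> (\<Sum>m=k..T. \<beta> ^ 3 * (Cl ^ 3) ^ 3 * \<gamma> ^ nat (T - m))"
    by (intro sum_mono bound) auto
  also have "\<dots> = \<beta> ^ 3 * (Cl ^ 3) ^ 3 * (\<Sum>m=k..T. \<gamma> ^ nat (T - m))"
    by (simp add: sum_distrib_left)
  also have "\<dots> \<le> \<beta> ^ 3 * (Cl ^ 3) ^ 3 * (1 / (1 - \<gamma>))"
    using C \<gamma> by (intro mult_left_mono sum_power_int_interval_le) auto
  finally show ?thesis by (simp add: ratio_sum_def T_def \<gamma>_def)
qed

end

section \<open>Covering\<close>

abbreviation bl :: "'a::metric_space \<times> int \<Rightarrow> 'a set" where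
  "bl p \<equiv> ball (fst p) (pow6 (snd p))"

text \<open>Radius 3 * \<open>pow6 (snd q)\<close> would do; the next admissible radius is six times
  as large.\<close>

lemma bl_meet_subset:
  assumes "bl p \<inter> bl q \<noteq> {}" "snd p \<le> snd q"
  shows "bl p \<subseteq> ball (fst q) (pow6 (snd q + 1))"
proof (rule ball_subset_dist)
  obtain z where "dist (fst p) z < pow6 (snd p)" "dist (fst q) z < pow6 (snd q)"
    using assms(1) by auto
  then have "dist (fst p) (fst q) < pow6 (snd p) + pow6 (snd q)"
    by (metis add_strict_mono dist_triangle2 le_less_trans)
  then show "dist (fst p) (fst q) + pow6 (snd p) \<le> pow6 (snd q + 1)"
    using pow6_mono[OF assms(2)] pow6_pos(1)[of "snd q"] unfolding pow6_Suc by linarith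
qed

text \<open>The radii are bounded above and discrete, so among any nonempty set of candidate balls there is
  a largest one; this makes a single application of Zorn's lemma sufficient.\<close>
lemma vitali_pow6:
  fixes F :: "('a::metric_space \<times> int) set"
  assumes bdd: "\<And>p. p \<in> F \<Longrightarrow> snd p \<le> k0"
  shows "\<exists>S\<subseteq>F. (\<forall>p\<in>S. \<forall>q\<in>S. p \<noteq> q \<longrightarrow> bl p \<inter> bl q = {}) \<and>
           (\<forall>p\<in>F. \<exists>q\<in>S. bl p \<subseteq> ball (fst q) (pow6 (snd q + 1)))"
proof -
  \<comment> \<open>The last conjunct keeps the selection greedy: a candidate that meets the family
    meets a member at least as large as itself. It survives unions of chains, and for a maximal
    family it yields the covering.\<close>
  define \<A> where "\<A> = {S. S \<subseteq> F \<and> (\<forall>p\<in>S. \<forall>q\<in>S. p \<noteq> q \<longrightarrow> bl p \<inter> bl q = {}) \<and>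
     (\<forall>p\<in>F. (\<exists>q\<in>S. bl p \<inter> bl q \<noteq> {}) \<longrightarrow> (\<exists>q\<in>S. bl p \<inter> bl q \<noteq> {} \<and> snd p \<le> snd q))}"
  have "\<exists>M\<in>\<A>. \<forall>X\<in>\<A>. M \<subseteq> X \<longrightarrow> X = M"
  proof (rule subset_Zorn')
    fix C assume C: "subset.chain \<A> C"
    have sub: "S \<in> \<A>" if "S \<in> C" for S using C that by (auto simp: subset.chain_def)
    have lin: "S \<subseteq> T \<or> T \<subseteq> S" if "S \<in> C" "T \<in> C" for S T
      using C that by (auto simp: subset.chain_def)
    have "bl p \<inter> bl q = {}" if pq: "p \<in> \<Union>C" "q \<in> \<Union>C" "p \<noteq> q" for p q
    proof -
      obtain S T where "p \<in> S" "S \<in> C" "q \<in> T" "T \<in> C" using pq by auto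
      then obtain R where "R \<in> C" "p \<in> R" "q \<in> R" using lin[of S T] by blast
      then show ?thesis using sub[of R] pq(3) unfolding \<A>_def by blast
    qed
    moreover have "\<exists>q\<in>\<Union>C. bl p \<inter> bl q \<noteq> {} \<and> snd p \<le> snd q"
      if p: "p \<in> F" "q \<in> \<Union>C" "bl p \<inter> bl q \<noteq> {}" for p q
    proof -
      obtain S where S: "S \<in> C" "q \<in> S" using p by auto
      then show ?thesis using sub[OF S(1)] p unfolding \<A>_def by blast
    qed
    moreover have "\<Union>C \<subseteq> F" using sub unfolding \<A>_def by blast
    ultimately show "\<Union>C \<in> \<A>" unfolding \<A>_def by blast
  qed
  then obtain M where M: "M \<in> \<A>" and max: "\<And>X. X \<in> \<A> \<Longrightarrow> M \<subseteq> X \<Longrightarrow> X = M" by blast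
  have meets: "\<exists>q\<in>M. bl p \<inter> bl q \<noteq> {}" if "p \<in> F" for p
  proof (rule ccontr)
    assume no: "\<not> ?thesis"
    define R where "R = {p \<in> F. \<forall>q\<in>M. bl p \<inter> bl q = {}}"
    have pR: "p \<in> R" using no that by (auto simp: R_def)
    have RF: "R \<subseteq> F" by (auto simp: R_def)
    \<comment> \<open>A largest candidate among those meeting no chosen ball, found as a least
      natural number because radii are bounded through \<open>k0\<close>. Adding it keeps the
      selection greedy and contradicts maximality.\<close>
    have "\<exists>r. r \<in> R \<and> (\<forall>y. y \<in> R \<longrightarrow> nat (k0 - snd r) \<le> nat (k0 - snd y))"
      by (rule ex_has_least_nat[of "\<lambda>r. r \<in> R"]) (rule pR)
    then obtain r where r: "r \<in> R" "\<And>y. y \<in> R \<Longrightarrow> nat (k0 - snd r) \<le> nat (k0 - snd y)" by blast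
    have rmax: "snd y \<le> snd r" if "y \<in> R" for y
      using r(2)[OF that] bdd[of y] bdd[of r] that r(1) RF by auto
    have "insert r M \<in> \<A>"
    proof -
      have "insert r M \<subseteq> F" using M r RF by (auto simp: \<A>_def)
      moreover have "bl p \<inter> bl q = {}" if "p \<in> insert r M" "q \<in> insert r M" "p \<noteq> q" for p q
        using that M r(1) unfolding \<A>_def R_def by blast
      moreover have "\<exists>q\<in>insert r M. bl p \<inter> bl q \<noteq> {} \<and> snd p \<le> snd q"
        if p: "p \<in> F" "q \<in> insert r M" "bl p \<inter> bl q \<noteq> {}" for p q
      proof (cases "\<exists>q\<in>M. bl p \<inter> bl q \<noteq> {}")
        case True
        then show ?thesis using M p(1) unfolding \<A>_def by blast
      next
        case False
        then have "p \<in> R" using p(1) by (auto simp: R_def)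
        then have "snd p \<le> snd r" by (rule rmax)
        moreover have "q = r" using p False by blast
        ultimately show ?thesis using p by blast
      qed
      ultimately show ?thesis unfolding \<A>_def by blast
    qed
    then have "r \<in> M" using max[of "insert r M"] by blast
    then have "bl r \<inter> bl r = {}" using r(1) unfolding R_def by blast
    moreover have "fst r \<in> bl r" by simp
    ultimately show False by blast
  qed
  have "\<exists>q\<in>M. bl p \<subseteq> ball (fst q) (pow6 (snd q + 1))" if "p \<in> F" for p
  proof -
    have "\<exists>q\<in>M. bl p \<inter> bl q \<noteq> {} \<and> snd p \<le> snd q"
      using M meets[OF that] that unfolding \<A>_def by blast
    then obtain q where "q \<in> M" "bl p \<inter> bl q \<noteq> {}" "snd p \<le> snd q" by blast
    then show ?thesis using bl_meet_subset[of p q] by blast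
  qed
  note Mcov = this
  note MA = M[unfolded \<A>_def mem_Collect_eq]
  show ?thesis
    by (intro exI[of _ M] conjI ballI MA[THEN conjunct1] MA[THEN conjunct2, THEN conjunct1] Mcov)
qed

text \<open>Each ball catches its own point of the countable dense set.\<close>

lemma countable_disjoint_bl:
  fixes Z :: "'a::metric_space set" and S :: "('a \<times> int) set"
  assumes "countable Z" and dense: "\<And>x e. 0 < e \<Longrightarrow> \<exists>z\<in>Z. dist x z < e"
    and disj: "\<And>p q. p \<in> S \<Longrightarrow> q \<in> S \<Longrightarrow> p \<noteq> q \<Longrightarrow> bl p \<inter> bl q = {}"
  shows "countable S"
proof -
  have "\<forall>p\<in>S. \<exists>z\<in>Z. z \<in> bl p" using dense by auto
  then obtain f where f: "\<And>p. p \<in> S \<Longrightarrow> f p \<in> Z \<and> f p \<in> bl p" by metis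
  have "inj_on f S"
  proof (rule inj_onI, rule ccontr)
    fix p q assume "p \<in> S" "q \<in> S" "f p = f q" "p \<noteq> q"
    then show False using disj[of p q] f[of p] f[of q] by auto
  qed
  moreover have "countable (f ` S)" using assms(1) by (rule countable_subset[rotated]) (use f in auto)
  ultimately show ?thesis by (rule countable_image_inj_on[rotated])
qed

text \<open>Stated for an arbitrary set \<open>E\<close>, so that the exceptional sets of the
  differentiation argument need not be shown measurable.\<close>

lemma null_outer:
  assumes "\<And>e::real. 0 < e \<Longrightarrow> \<exists>U\<in>sets M. E \<subseteq> U \<and> emeasure M U \<le> ennreal e"
  shows "\<exists>N\<in>null_sets M. E \<subseteq> N"
proof -
  have "\<forall>n. \<exists>U\<in>sets M. E \<subseteq> U \<and> emeasure M U \<le> ennreal (1 / real (Suc n))"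
    using assms by simp
  then obtain U where U: "\<And>n. U n \<in> sets M" "\<And>n. E \<subseteq> U n"
    "\<And>n. emeasure M (U n) \<le> ennreal (1 / real (Suc n))" by metis
  let ?N = "\<Inter>n. U n"
  have N: "?N \<in> sets M" by (rule sets.countable_INT) (use U(1) in \<open>simp_all add: image_subset_iff\<close>)
  have "emeasure M ?N \<le> ennreal (1 / real (Suc n))" for n
  proof -
    have "emeasure M ?N \<le> emeasure M (U n)" by (rule emeasure_mono) (auto simp: U(1))
    then show ?thesis using U(3)[of n] by simp
  qed
  moreover have "(\<lambda>n. ennreal (1 / real (Suc n))) \<longlonglongrightarrow> ennreal 0"
    using LIMSEQ_inverse_real_of_nat by (intro tendsto_ennrealI) (simp add: inverse_eq_divide)
  ultimately have "emeasure M ?N \<le> ennreal 0"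
    by (intro LIMSEQ_le_const[of "\<lambda>n. ennreal (1 / real (Suc n))"]) auto
  then show ?thesis using N U(2) by (intro bexI[of _ ?N]) (auto simp: null_sets_def)
qed

section \<open>Measurability of the distance and the covering estimate\<close>

context udspace
begin

lemma dense_countable: obtains Z :: "'a set"
  where "countable Z" "\<And>x e. 0 < e \<Longrightarrow> \<exists>z\<in>Z. dist x z < e"
  using geometrically_doubling_separable[OF gd] by blast

text \<open>Rectangles generate the product \<sigma>-algebra, so the strip around the diagonal is
  written as a countable union of them: z runs through a dense set and q through the rationals,
  splitting r as q + (r - q).\<close>

lemma sets_dist_less: "{p. dist (fst p) (snd p) < r} \<in> sets (\<mu> \<Otimes>\<^sub>M \<mu>)"
proof -
  obtain Z :: "'a set" where Z: "countable Z" "\<And>x e. 0 < e \<Longrightarrow> \<exists>z\<in>Z. dist x z < e"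
    using dense_countable by blast
  have "{p. dist (fst p) (snd p) < r} = (\<Union>z\<in>Z. \<Union>q\<in>\<rat>. ball z q \<times> ball z (r - q))" (is "?A = ?B")
  proof (intro set_eqI iffI)
    fix p assume "p \<in> ?A"
    then have d: "0 < (r - dist (fst p) (snd p)) / 2" by simp
    obtain q where q: "q \<in> \<rat>" "0 < q" "q < (r - dist (fst p) (snd p)) / 2"
      using Rats_dense_in_real[OF d] by auto
    obtain z where z: "z \<in> Z" "dist (fst p) z < q" using Z(2)[OF q(2)] by blast
    have "dist z (snd p) \<le> dist (fst p) z + dist (fst p) (snd p)" by (metis dist_commute dist_triangle)
    then have "dist z (snd p) < r - q" using z(2) q(3) by (simp add: field_simps)
    then have "p \<in> ball z q \<times> ball z (r - q)" using z by (auto simp: mem_Times_iff dist_commute)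
    then show "p \<in> ?B" using z q by blast
  next
    fix p assume "p \<in> ?B"
    then obtain z q where "dist z (fst p) < q" "dist z (snd p) < r - q" by auto
    moreover have "dist (fst p) (snd p) \<le> dist z (fst p) + dist z (snd p)" by (rule dist_triangle3)
    ultimately show "p \<in> ?A" by simp
  qed
  moreover have "?B \<in> sets (\<mu> \<Otimes>\<^sub>M \<mu>)"
    using Z(1) countable_rat by (intro sets.countable_UN' pair_measureI) auto
  ultimately show ?thesis by simp
qed

lemma measurable_dist [measurable]: "(\<lambda>p. dist (fst p) (snd p)) \<in> borel_measurable (\<mu> \<Otimes>\<^sub>M \<mu>)"
  unfolding borel_measurable_iff_less using sets_dist_less by (auto simp: space_pair_measure)

lemma measurable_lev [measurable]: "(\<lambda>p. lev (fst p) (snd p)) \<in> measurable (\<mu> \<Otimes>\<^sub>M \<mu>) (count_space UNIV)"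
  unfolding lev_def by measurable

lemma sigma_finite: "sigma_finite_measure \<mu>"
proof
  fix o' :: 'a
  show "\<exists>A. countable A \<and> A \<subseteq> sets \<mu> \<and> \<Union>A = space \<mu> \<and> (\<forall>a\<in>A. emeasure \<mu> a \<noteq> \<infinity>)"
  proof (intro exI[of _ "range (\<lambda>n. ball o' (real n))"] conjI)
    show "\<Union> (range (\<lambda>n. ball o' (real n))) = space \<mu>"
      using reals_Archimedean2 by auto
  qed auto
qed

sublocale sf: sigma_finite_measure \<mu> by (rule sigma_finite)
sublocale pf: pair_sigma_finite \<mu> \<mu> ..

lemma measurable_V [measurable]: "V k \<in> borel_measurable \<mu>"
proof -
  have m: "(\<lambda>x. emeasure \<mu> (Pair x -` {p. dist (fst p) (snd p) < pow6 k})) \<in> borel_measurable \<mu>"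
    by (intro sf.measurable_emeasure_Pair sets_dist_less)
  have eq: "Pair x -` {p. dist (fst p) (snd p) < pow6 k} = ball x (pow6 k)" for x :: 'a
    by auto
  have "(\<lambda>x. enn2real (emeasure \<mu> (ball x (pow6 k)))) \<in> borel_measurable \<mu>"
    by (rule borel_measurable_enn2real[OF m[unfolded eq]])
  then show ?thesis unfolding V_def[abs_def] measure_def .
qed

text \<open>The sets \<open>T p\<close> need not be enlarged balls. With six-fold balls this is the
  weak-type covering estimate; in the John-Nirenberg induction \<open>T p\<close> is a superlevel
  set controlled by the induction hypothesis.\<close>

lemma cover_sum:
  assumes bdd: "\<And>p. p \<in> F \<Longrightarrow> snd p \<le> k0"
    and T: "\<And>p. p \<in> F \<Longrightarrow> T p \<in> sets \<mu>"
    and le: "\<And>p. p \<in> F \<Longrightarrow> emeasure \<mu> (T p) \<le> (\<integral>\<^sup>+y\<in>bl p. h y \<partial>\<mu>)"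
    and h [measurable]: "h \<in> borel_measurable \<mu>"
    and W: "\<And>p. p \<in> F \<Longrightarrow> bl p \<subseteq> W" "W \<in> sets \<mu>"
  shows "\<exists>S\<subseteq>F. (\<forall>p\<in>F. \<exists>q\<in>S. bl p \<subseteq> ball (fst q) (pow6 (snd q + 1))) \<and>
    (\<Union>p\<in>S. T p) \<in> sets \<mu> \<and> emeasure \<mu> (\<Union>p\<in>S. T p) \<le> (\<integral>\<^sup>+y\<in>W. h y \<partial>\<mu>)"
proof -
  have "\<exists>S\<subseteq>F. (\<forall>p\<in>S. \<forall>q\<in>S. p \<noteq> q \<longrightarrow> bl p \<inter> bl q = {}) \<and>
           (\<forall>p\<in>F. \<exists>q\<in>S. bl p \<subseteq> ball (fst q) (pow6 (snd q + 1)))"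
    by (rule vitali_pow6) (rule bdd)
  then obtain S where S1: "S \<subseteq> F" and S2: "\<forall>p\<in>S. \<forall>q\<in>S. p \<noteq> q \<longrightarrow> bl p \<inter> bl q = {}"
    and S3: "\<forall>p\<in>F. \<exists>q\<in>S. bl p \<subseteq> ball (fst q) (pow6 (snd q + 1))"
    by (elim exE conjE)
  note S = S1 S2[rule_format]
  obtain Z :: "'a set" where Z: "countable Z" "\<And>x e. 0 < e \<Longrightarrow> \<exists>z\<in>Z. dist x z < e"
    using dense_countable by blast
  have cS: "countable S" using countable_disjoint_bl[OF Z S(2)] .
  define I where "I = to_nat_on S ` S"
  define A where "A n = (if n \<in> I then bl (from_nat_into S n) else {})" for n
  define A' where "A' n = (if n \<in> I then T (from_nat_into S n) else {})" for n
  have inS: "from_nat_into S n \<in> S" if "n \<in> I" for n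
    using that by (auto simp: I_def intro!: from_nat_into)
  have to_nat: "to_nat_on S (from_nat_into S n) = n" if "n \<in> I" for n
    using that cS by (auto simp: I_def)
  have disj: "disjoint_family A"
    unfolding disjoint_family_on_def
  proof (intro ballI impI)
    fix m n :: nat assume "m \<noteq> n"
    show "A m \<inter> A n = {}"
    proof (cases "m \<in> I \<and> n \<in> I")
      case True
      then have "from_nat_into S m \<noteq> from_nat_into S n" using to_nat \<open>m \<noteq> n\<close> by metis
      then show ?thesis using S(2)[OF inS inS] True by (simp add: A_def)
    qed (auto simp: A_def)
  qed
  have "T (from_nat_into S n) \<in> sets \<mu>" if "n \<in> I" for n
    using T[OF subsetD[OF S(1) inS[OF that]]] .
  then have mA: "A n \<in> sets \<mu>" "A' n \<in> sets \<mu>" for n by (simp_all add: A_def A'_def)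
  have "emeasure \<mu> (\<Union>n. A' n) \<le> (\<Sum>n. emeasure \<mu> (A' n))"
    using mA by (intro emeasure_subadditive_countably) auto
  \<comment> \<open>The integrals over the disjoint balls are values of the measure with density
    \<open>h\<close>, whose countable additivity sums them.\<close>
  also have "\<dots> \<le> (\<Sum>n. emeasure (density \<mu> h) (A n))"
  proof (intro suminf_le allI)
    fix n show "emeasure \<mu> (A' n) \<le> emeasure (density \<mu> h) (A n)"
    proof (cases "n \<in> I")
      case True
      have "from_nat_into S n \<in> F" using inS[OF True] S(1) by auto
      from le[OF this] show ?thesis using True
        by (simp add: A_def A'_def emeasure_density)
    qed (simp add: A'_def)
  qed auto
  also have "\<dots> = emeasure (density \<mu> h) (\<Union>n. A n)"
    using mA disj by (intro suminf_emeasure) auto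
  also have "\<dots> \<le> emeasure (density \<mu> h) W"
  proof (rule emeasure_mono)
    have "A n \<subseteq> W" for n
    proof (cases "n \<in> I")
      case True
      then show ?thesis using W(1)[of "from_nat_into S n"] inS[OF True] S(1) by (auto simp: A_def)
    qed (simp add: A_def)
    then show "(\<Union>n. A n) \<subseteq> W" by blast
  qed (use W in simp)
  also have "\<dots> = (\<integral>\<^sup>+y\<in>W. h y \<partial>\<mu>)" using W by (simp add: emeasure_density)
  finally have le: "emeasure \<mu> (\<Union>n. A' n) \<le> (\<integral>\<^sup>+y\<in>W. h y \<partial>\<mu>)" .
  have eq: "(\<Union>n. A' n) = (\<Union>p\<in>S. T p)"
  proof (intro equalityI UN_least)
    show "A' n \<subseteq> (\<Union>p\<in>S. T p)" for n using inS[of n] by (auto simp: A'_def)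
    fix p assume p: "p \<in> S"
    then have "to_nat_on S p \<in> I" "from_nat_into S (to_nat_on S p) = p"
      using cS by (auto simp: I_def)
    then have "A' (to_nat_on S p) = T p" by (simp add: A'_def)
    then show "T p \<subseteq> (\<Union>n. A' n)" by blast
  qed
  have "(\<Union>n. A' n) \<in> sets \<mu>" using mA by auto
  with le show ?thesis unfolding eq by (intro exI[of _ S] conjI S(1) S3)
qed

lemma weak_cover:
  assumes bdd: "\<And>p. p \<in> F \<Longrightarrow> snd p \<le> k0"
    and le: "\<And>p. p \<in> F \<Longrightarrow> ennreal (V (snd p + 1) (fst p)) \<le> (\<integral>\<^sup>+y\<in>bl p. h y \<partial>\<mu>)"
    and h: "h \<in> borel_measurable \<mu>"
    and W: "\<And>p. p \<in> F \<Longrightarrow> bl p \<subseteq> W" "W \<in> sets \<mu>"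
  shows "\<exists>U\<in>sets \<mu>. (\<Union>p\<in>F. bl p) \<subseteq> U \<and> emeasure \<mu> U \<le> (\<integral>\<^sup>+y\<in>W. h y \<partial>\<mu>)"
proof -
  let ?T = "\<lambda>p. ball (fst p) (pow6 (snd p + 1))"
  have "\<exists>S\<subseteq>F. (\<forall>p\<in>F. \<exists>q\<in>S. bl p \<subseteq> ?T q) \<and>
    (\<Union>p\<in>S. ?T p) \<in> sets \<mu> \<and> emeasure \<mu> (\<Union>p\<in>S. ?T p) \<le> (\<integral>\<^sup>+y\<in>W. h y \<partial>\<mu>)"
    using assms by (intro cover_sum) (auto simp: emeasure_V)
  then obtain S where S: "\<forall>p\<in>F. \<exists>q\<in>S. bl p \<subseteq> ?T q" "(\<Union>p\<in>S. ?T p) \<in> sets \<mu>"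
    "emeasure \<mu> (\<Union>p\<in>S. ?T p) \<le> (\<integral>\<^sup>+y\<in>W. h y \<partial>\<mu>)" by (elim exE conjE)
  have "(\<Union>p\<in>F. bl p) \<subseteq> (\<Union>p\<in>S. ?T p)" using S(1) by blast
  then show ?thesis using S(2,3) by blast
qed

end

section \<open>Existence of arbitrarily small doubling scales\<close>

context nhspace
begin

lemma measurable_L [measurable]: "L k \<in> borel_measurable \<mu>"
proof -
  have "bdd_above (range (\<lambda>i. V (k + int i) x / \<beta> ^ i))" for x
    using L_ge[of k _ x] by (auto intro!: bdd_aboveI2)
  then show ?thesis unfolding L_def[abs_def] by (intro borel_measurable_cSUP) auto
qed

lemma measurable_next_dbl [measurable]: "next_dbl k \<in> measurable \<mu> (count_space UNIV)"
  unfolding next_dbl_def[abs_def] dbl_def by measurable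

text \<open>If no scale \<open>\<le> K\<close> is doubling at \<open>y\<close>, the balls around \<open>y\<close> have measure \<open>O(\<beta>\<^sup>-\<^sup>j)\<close> at scale
  \<open>K - j\<close>, while \<open>O(6\<^sup>n\<^sup>j)\<close> of them cover a fixed ball; this is where \<open>6\<^sup>n < \<beta>\<close> is used.\<close>
lemma not_dbl_null: "\<exists>N\<in>null_sets \<mu>. {y \<in> ball x (pow6 K). \<forall>m\<le>K. \<not> dbl m y} \<subseteq> N" (is "\<exists>N\<in>_. ?E \<subseteq> N")
proof (rule null_outer)
  fix e :: real assume e: "0 < e"
  define n where "n = geometric_dim N0"
  define \<gamma> where "\<gamma> = 6 powr n / \<beta>"
  have \<gamma>: "0 \<le> \<gamma>" "\<gamma> < 1" using beta by (auto simp: \<gamma>_def n_def)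
  define c where "c = 4 powr n * \<beta> ^ 2 * L K x"
  have c: "0 < c" by (simp add: c_def)
  have "(\<lambda>j. c * \<gamma> ^ j) \<longlonglongrightarrow> c * 0" using \<gamma> by (intro tendsto_mult tendsto_const LIMSEQ_realpow_zero)
  then have "\<forall>\<^sub>F j in sequentially. c * \<gamma> ^ j < e" using e by (intro order_tendstoD) auto
  then obtain j where j: "c * \<gamma> ^ j < e" by (auto simp: eventually_sequentially)
  \<comment> \<open>The least t with 2 * 6^j \<le> 2^t. Then twice the covering radius is at most
    \<open>pow6 (K - int j)\<close>, while 2^t \<le> 4 * 6^j keeps the number of balls, at most
    (2^t)^n, below 4^n * 6^(n j).\<close>
  define t where "t = nat \<lceil>log 2 (2 * 6 ^ j)\<rceil>"
  have lpos: "0 \<le> log 2 (2 * 6 ^ j)"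
  proof -
    have "1 \<le> (6::real) ^ j" by simp
    then have "1 \<le> 2 * (6::real) ^ j" by linarith
    then show ?thesis by simp
  qed
  have t1: "2 * 6 ^ j \<le> (2::real) ^ t"
  proof -
    have "log 2 (2 * 6 ^ j) \<le> real t" unfolding t_def by linarith
    then show ?thesis by (simp add: log_le_iff powr_realpow)
  qed
  have t2: "(2::real) ^ t \<le> 4 * 6 ^ j"
  proof -
    have "real t \<le> log 2 (2 * 6 ^ j) + 1" unfolding t_def using lpos by linarith
    also have "\<dots> = log 2 (4 * 6 ^ j)" using log_mult[of 2 "2 * 6 ^ j" 2] by simp
    finally have "2 powr real t \<le> 4 * 6 ^ j" by (simp add: le_log_iff)
    then show ?thesis by (simp add: powr_realpow)
  qed
  have N0t: "real (N0 ^ t) \<le> 4 powr n * (6 powr n) ^ j"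
  proof -
    have N0n: "real N0 = 2 powr n" using N0 by (simp add: n_def geometric_dim_def)
    have "real (N0 ^ t) = (2 powr n) ^ t" by (simp add: N0n)
    also have "\<dots> = (2 ^ t) powr n" by (simp add: powr_power powr_realpow[symmetric] powr_powr mult.commute)
    also have "\<dots> \<le> (4 * 6 ^ j) powr n"
      using t2 geometric_dim_ge_1 by (intro powr_mono2) (auto simp: n_def)
    also have "\<dots> = 4 powr n * (6 powr n) ^ j"
      by (simp add: powr_mult powr_power powr_realpow[symmetric] powr_powr mult.commute)
    finally show ?thesis .
  qed
  obtain S where S: "finite S" "card S \<le> N0 ^ t" "ball x (pow6 K) \<subseteq> (\<Union>s\<in>S. ball s (pow6 K / 2 ^ t))"
    using geometrically_doubling_iterate[OF gd, of "pow6 K" t x] by auto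
  \<comment> \<open>Only covering balls that meet the exceptional set matter; each is recentred at a
    point of that set, where the measure bound is available.\<close>
  define S' where "S' = {s \<in> S. ball s (pow6 K / 2 ^ t) \<inter> ?E \<noteq> {}}"
  have "\<forall>s\<in>S'. \<exists>y. y \<in> ball s (pow6 K / 2 ^ t) \<inter> ?E" unfolding S'_def by blast
  from bchoice[OF this] obtain w where
    w': "\<forall>s\<in>S'. w s \<in> ball s (pow6 K / 2 ^ t) \<inter> ?E" ..
  note w = w'[rule_format]
  have Kj: "pow6 K = pow6 (K - int j) * 6 ^ j" using pow6_add[of "K - int j" j] by simp
  have rad: "2 * (pow6 K / 2 ^ t) \<le> pow6 (K - int j)"
    using t1 mult_left_mono[OF t1, of "pow6 (K - int j)"] unfolding Kj by (simp add: field_simps)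
  define U where "U = (\<Union>s\<in>S'. ball (w s) (pow6 (K - int j)))"
  have "?E \<subseteq> U"
  proof
    fix y assume y: "y \<in> ?E"
    then obtain s where s: "s \<in> S" "y \<in> ball s (pow6 K / 2 ^ t)" using S(3) by blast
    then have s': "s \<in> S'" using y by (auto simp: S'_def)
    have "dist (w s) y < pow6 (K - int j)"
      using w[OF s'] s(2) rad dist_triangle3[of "w s" y s] by simp
    then show "y \<in> U" using s' by (auto simp: U_def)
  qed
  moreover have "emeasure \<mu> U \<le> ennreal e"
  proof -
    have fin: "finite S'" using S(1) by (simp add: S'_def)
    have Vw: "V (K - int j) (w s) \<le> \<beta> ^ 2 * L K x / \<beta> ^ j" if "s \<in> S'" for s
    proof -
      have ws: "w s \<in> ball x (pow6 K)" "\<And>m. m \<le> K \<Longrightarrow> \<not> dbl m (w s)" using w[OF that] by auto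
      have "L K (w s) = \<beta> ^ j * L (K - int j) (w s)"
        using L_below_next_dbl_aux[of j "K - int j" "w s"] ws(2) by auto
      moreover have "L K (w s) \<le> \<beta> ^ 2 * L K x"
        using ws(1) pow6_strict_mono[of K "K+1"] by (intro L_shift) (simp add: dist_commute)
      ultimately have "L (K - int j) (w s) \<le> \<beta> ^ 2 * L K x / \<beta> ^ j" by (simp add: field_simps)
      then show ?thesis using V_le_L[of "K - int j" "w s"] by linarith
    qed
    have "emeasure \<mu> U \<le> (\<Sum>s\<in>S'. emeasure \<mu> (ball (w s) (pow6 (K - int j))))"
      unfolding U_def using fin by (intro emeasure_subadditive_finite) auto
    also have "\<dots> = ennreal (\<Sum>s\<in>S'. V (K - int j) (w s))"
      by (simp add: emeasure_V sum_ennreal)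
    also have "\<dots> \<le> ennreal e"
    proof (rule ennreal_leI)
      have "(\<Sum>s\<in>S'. V (K - int j) (w s)) \<le> (\<Sum>s\<in>S'. \<beta> ^ 2 * L K x / \<beta> ^ j)"
        by (intro sum_mono Vw)
      also have "\<dots> = real (card S') * (\<beta> ^ 2 * L K x / \<beta> ^ j)" by simp
      also have "\<dots> \<le> (4 powr n * (6 powr n) ^ j) * (\<beta> ^ 2 * L K x / \<beta> ^ j)"
      proof (intro mult_right_mono)
        have "card S' \<le> card S" using S(1) by (intro card_mono) (auto simp: S'_def)
        then have "real (card S') \<le> real (N0 ^ t)" using S(2) by linarith
        then show "real (card S') \<le> 4 powr n * (6 powr n) ^ j" using N0t by linarith
      qed simp
      also have "\<dots> = c * \<gamma> ^ j" by (simp add: c_def \<gamma>_def power_divide)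
      finally show "(\<Sum>s\<in>S'. V (K - int j) (w s)) \<le> e" using j by simp
    qed
    finally show ?thesis .
  qed
  moreover have "U \<in> sets \<mu>" using S(1) by (auto simp: U_def S'_def)
  ultimately show "\<exists>U\<in>sets \<mu>. ?E \<subseteq> U \<and> emeasure \<mu> U \<le> ennreal e" by blast
qed

lemma AE_dbl: "AE y in \<mu>. \<forall>k. \<exists>m\<le>k. dbl m y"
proof -
  obtain Z :: "'a set" where Z: "countable Z" "\<And>x e. 0 < e \<Longrightarrow> \<exists>z\<in>Z. dist x z < e"
    using dense_countable by blast
  have "AE y in \<mu>. y \<in> ball z (pow6 K) \<longrightarrow> (\<exists>m\<le>K. dbl m y)" for z K
  proof -
    obtain N where "N \<in> null_sets \<mu>" "{y \<in> ball z (pow6 K). \<forall>m\<le>K. \<not> dbl m y} \<subseteq> N"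
      using not_dbl_null by blast
    then show ?thesis by (intro AE_I'[of N]) auto
  qed
  then have "AE y in \<mu>. \<forall>K. \<forall>z\<in>Z. y \<in> ball z (pow6 K) \<longrightarrow> (\<exists>m\<le>K. dbl m y)"
    unfolding AE_all_countable AE_ball_countable[OF Z(1)] by simp
  then show ?thesis
  proof eventually_elim
    case (elim y)
    show ?case
    proof
      fix K
      obtain z where "z \<in> Z" "dist y z < pow6 K" using Z(2)[OF pow6_pos(1)] by blast
      then have "y \<in> ball z (pow6 K)" by (simp add: dist_commute)
      then show "\<exists>m\<le>K. dbl m y" using elim \<open>z \<in> Z\<close> by blast
    qed
  qed
qed

end

section \<open>Differentiation along doubling balls\<close>

context udspace
begin

lemma sets_ball [measurable]: "ball x r \<in> sets borel"
  by simp

text \<open>Polymorphic in the range, to serve \<open>b\<close> and its complex approximants as well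
  as real majorants.\<close>

definition loc :: "('a \<Rightarrow> 'b::{banach, second_countable_topology}) \<Rightarrow> bool" where
  "loc g \<longleftrightarrow> (\<forall>x r. set_integrable \<mu> (ball x r) g)"

lemma locD: "loc g \<Longrightarrow> set_integrable \<mu> (ball x r) g"
  by (simp add: loc_def)

lemma loc_measurable: assumes "loc g" shows "g \<in> borel_measurable \<mu>"
proof (rule borel_measurable_LIMSEQ_metric)
  fix o' :: 'a
  show "(\<lambda>x. indicator (ball o' (real i)) x *\<^sub>R g x) \<in> borel_measurable \<mu>" for i
    using locD[OF assms] unfolding set_integrable_def by (rule borel_measurable_integrable)
  show "(\<lambda>i. indicator (ball o' (real i)) x *\<^sub>R g x) \<longlonglongrightarrow> g x" for x
  proof (rule tendsto_eventually)
    obtain n where n: "dist o' x < real n" using reals_Archimedean2 by blast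
    show "\<forall>\<^sub>F i in sequentially. indicator (ball o' (real i)) x *\<^sub>R g x = g x"
      using eventually_ge_at_top[of n] by eventually_elim (use n in auto)
  qed
qed

lemma loc_bounded_by:
  assumes "loc (h :: 'a \<Rightarrow> real)" "g \<in> borel_measurable \<mu>" "\<And>x. norm (g x) \<le> h x"
  shows "loc g"
  unfolding loc_def
proof (intro allI)
  fix x r
  show "set_integrable \<mu> (ball x r) g"
  proof (rule set_integrable_bound[OF locD[OF assms(1)]])
    show "set_borel_measurable \<mu> (ball x r) g"
      using assms(2) unfolding set_borel_measurable_def
      by (intro borel_measurable_scaleR borel_measurable_indicator) auto
    have "norm (g y) \<le> norm (h y)" for y using assms(3)[of y] by (simp add: order.trans[OF _ abs_ge_self])
    then show "AE y in \<mu>. y \<in> ball x r \<longrightarrow> norm (g y) \<le> norm (h y)" by simp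
  qed
qed

lemma loc_const: "loc (\<lambda>_. c)"
  unfolding loc_def set_integrable_def
  by (intro allI integrable_scaleR_left integrable_real_indicator) auto

lemma loc_diff: "loc f \<Longrightarrow> loc g \<Longrightarrow> loc (\<lambda>x. f x - g x)"
  unfolding loc_def by (intro allI set_integral_diff) auto

lemma loc_add: "loc f \<Longrightarrow> loc g \<Longrightarrow> loc (\<lambda>x. f x + g x)"
  unfolding loc_def by (intro allI set_integral_add) auto

lemma loc_norm: "loc f \<Longrightarrow> loc (\<lambda>x. norm (f x))"
  unfolding loc_def by (intro allI set_integrable_norm) auto

lemma nn_loc_finite: assumes "loc f" shows "(\<integral>\<^sup>+y\<in>ball x r. ennreal (norm (f y)) \<partial>\<mu>) < \<infinity>"
proof -
  have "integrable \<mu> (\<lambda>y. indicator (ball x r) y *\<^sub>R f y)"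
    using locD[OF assms] unfolding set_integrable_def .
  then have "(\<integral>\<^sup>+y. ennreal (norm (indicator (ball x r) y *\<^sub>R f y)) \<partial>\<mu>) < \<infinity>"
    by (simp add: integrable_iff_bounded)
  also have "(\<lambda>y. ennreal (norm (indicator (ball x r) y *\<^sub>R f y))) =
      (\<lambda>y. ennreal (norm (f y)) * indicator (ball x r) y)"
    by (auto simp: indicator_def)
  finally show ?thesis .
qed

text \<open>The form in which means enter the covering arguments: a mean far from a constant forces
  a large integral.\<close>

lemma ball_mean_deviation:
  assumes g: "loc g" and pos: "0 < measure \<mu> (ball x r)"
  shows "ennreal (norm (ball_mean \<mu> g x r - c) * measure \<mu> (ball x r))
           \<le> (\<integral>\<^sup>+y\<in>ball x r. ennreal (norm (g y - c)) \<partial>\<mu>)"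
proof -
  let ?m = "measure \<mu> (ball x r)"
  have int: "integrable \<mu> (\<lambda>y. indicator (ball x r) y *\<^sub>R (g y - c))"
    using locD[OF loc_diff[OF g loc_const]] unfolding set_integrable_def .
  have "(LINT y:ball x r|\<mu>. g y - c) = (LINT y:ball x r|\<mu>. g y) - (LINT y:ball x r|\<mu>. c)"
    by (intro set_integral_diff locD g loc_const)
  also have "(LINT y:ball x r|\<mu>. c) = of_real ?m * c"
    by (simp add: set_lebesgue_integral_def scaleR_conv_of_real)
  also have "(LINT y:ball x r|\<mu>. g y) = of_real ?m * ball_mean \<mu> g x r"
    using pos by (simp add: ball_mean_def)
  finally have "(LINT y:ball x r|\<mu>. g y - c) = of_real ?m * (ball_mean \<mu> g x r - c)"
    by (simp add: algebra_simps)
  then have "norm (ball_mean \<mu> g x r - c) * ?m = norm (LINT y:ball x r|\<mu>. g y - c)"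
    by (simp add: norm_mult)
  also have "ennreal \<dots> \<le> (\<integral>\<^sup>+y. ennreal (norm (indicator (ball x r) y *\<^sub>R (g y - c))) \<partial>\<mu>)"
    unfolding set_lebesgue_integral_def using int by (rule integral_norm_bound_ennreal)
  also have "\<dots> = (\<integral>\<^sup>+y\<in>ball x r. ennreal (norm (g y - c)) \<partial>\<mu>)"
    by (intro nn_integral_cong) (auto simp: indicator_def)
  finally show ?thesis .
qed

lemma ball_mean_diff:
  assumes "loc f" "loc g"
  shows "ball_mean \<mu> (\<lambda>x. f x - g x) x r = ball_mean \<mu> f x r - ball_mean \<mu> g x r"
  unfolding ball_mean_def by (simp add: set_integral_diff(2)[OF locD[OF assms(1)] locD[OF assms(2)]] diff_divide_distrib)

end

context nhspace
begin

text \<open>Convergence is asked only along doubling scales, where \<open>weak_cover\<close>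
  controls averages; \<open>AE_dbl\<close> ensures that this is not vacuous almost
  everywhere.\<close>

definition ldt :: "('a \<Rightarrow> complex) \<Rightarrow> bool" where
  "ldt g \<longleftrightarrow> (AE x in \<mu>. \<forall>e>0. \<exists>k0. \<forall>k\<le>k0. dbl k x \<longrightarrow> norm (ball_mean \<mu> g x (pow6 k) - g x) \<le> e)"

lemma V_pos_dbl: "dbl k x \<Longrightarrow> 0 < V k x"
  by (simp add: dbl_def)

lemma ball_mean_deviation_V:
  "loc g \<Longrightarrow> 0 < V k x \<Longrightarrow> ennreal (norm (ball_mean \<mu> g x (pow6 k) - c) * V k x)
           \<le> (\<integral>\<^sup>+y\<in>ball x (pow6 k). ennreal (norm (g y - c)) \<partial>\<mu>)"
  unfolding V_def by (rule ball_mean_deviation)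

lemma ldt_diff: assumes "loc f" "loc g" "ldt f" "ldt g" shows "ldt (\<lambda>x. f x - g x)"
  using assms(3,4) unfolding ldt_def
proof eventually_elim
  case (elim x)
  show ?case
  proof (intro allI impI)
    fix e :: real assume "0 < e"
    then have e2: "0 < e / 2" by simp
    obtain k1 where k1: "\<And>k. k \<le> k1 \<Longrightarrow> dbl k x \<Longrightarrow> norm (ball_mean \<mu> f x (pow6 k) - f x) \<le> e / 2"
      using elim(1) e2 by blast
    obtain k2 where k2: "\<And>k. k \<le> k2 \<Longrightarrow> dbl k x \<Longrightarrow> norm (ball_mean \<mu> g x (pow6 k) - g x) \<le> e / 2"
      using elim(2) e2 by blast
    have "norm (ball_mean \<mu> (\<lambda>x. f x - g x) x (pow6 k) - (f x - g x)) \<le> e"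
      if k: "k \<le> min k1 k2" "dbl k x" for k
    proof -
      have eq: "ball_mean \<mu> (\<lambda>x. f x - g x) x (pow6 k) - (f x - g x) =
        (ball_mean \<mu> f x (pow6 k) - f x) - (ball_mean \<mu> g x (pow6 k) - g x)"
        by (simp add: ball_mean_diff[OF assms(1,2)])
      have "k \<le> k1" "k \<le> k2" using k by auto
      then show ?thesis unfolding eq
        using norm_triangle_ineq4[of "ball_mean \<mu> f x (pow6 k) - f x" "ball_mean \<mu> g x (pow6 k) - g x"]
          k1[of k] k2[of k] k(2) by linarith
    qed
    then show "\<exists>k0. \<forall>k\<le>k0. dbl k x \<longrightarrow> norm (ball_mean \<mu> (\<lambda>x. f x - g x) x (pow6 k) - (f x - g x)) \<le> e"
      by blast
  qed
qed

lemma ldt_continuous: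
  assumes g: "loc g" and cont: "continuous_on UNIV g"
  shows "ldt g"
  unfolding ldt_def
proof (intro AE_I2 allI impI)
  fix x and e :: real assume e: "0 < e"
  obtain d where d: "0 < d" "\<And>y. dist y x < d \<Longrightarrow> dist (g y) (g x) < e"
    using cont e unfolding continuous_on_iff by blast
  obtain k0 where k0: "pow6 k0 < d" using pow6_small[OF d(1)] by blast
  have "norm (ball_mean \<mu> g x (pow6 k) - g x) \<le> e" if k: "k \<le> k0" "dbl k x" for k
  proof -
    have V: "0 < V k x" using k(2) by (rule V_pos_dbl)
    have "ennreal (norm (ball_mean \<mu> g x (pow6 k) - g x) * V k x)
           \<le> (\<integral>\<^sup>+y\<in>ball x (pow6 k). ennreal (norm (g y - g x)) \<partial>\<mu>)"
      using g V by (rule ball_mean_deviation_V)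
    also have "\<dots> \<le> (\<integral>\<^sup>+y. ennreal e * indicator (ball x (pow6 k)) y \<partial>\<mu>)"
    proof (rule nn_integral_mono)
      fix y
      have "norm (g y - g x) \<le> e" if "y \<in> ball x (pow6 k)"
        using that d(2)[of y] k0 pow6_mono[OF k(1)] by (simp add: dist_commute[of y] dist_norm)
      then show "ennreal (norm (g y - g x)) * indicator (ball x (pow6 k)) y \<le> ennreal e * indicator (ball x (pow6 k)) y"
        by (auto simp: indicator_def ennreal_leI)
    qed
    also have "\<dots> = ennreal (e * V k x)" using e by (simp add: nn_integral_cmult emeasure_V ennreal_mult)
    finally show ?thesis using V e by simp
  qed
  then show "\<exists>k0. \<forall>k\<le>k0. dbl k x \<longrightarrow> norm (ball_mean \<mu> g x (pow6 k) - g x) \<le> e" by blast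
qed

text \<open>Take \<open>g i\<close> close to \<open>f\<close> in L^1 near the ball. The error has
  three parts, each at most \<open>e\<close> off a small set: averages of |f - g i| (covering
  estimate, set \<open>U1\<close>), the differentiation error of \<open>g i\<close> (null set
  \<open>N\<close>), and |f - g i| itself (Markov, set \<open>U2\<close>).\<close>

lemma ldt_lim_aux:
  fixes g :: "nat \<Rightarrow> 'a \<Rightarrow> complex"
  assumes ldt: "\<And>i. ldt (g i)" and loc: "\<And>i. loc (g i)" "loc f" "loc (h :: 'a \<Rightarrow> real)"
    and lim: "\<And>x. (\<lambda>i. g i x) \<longlonglongrightarrow> f x" and bound: "\<And>i x. norm (g i x) \<le> h x"
    and e: "0 < (e::real)"
  shows "\<exists>N\<in>null_sets \<mu>. {x \<in> ball z (pow6 R).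
    \<not> (\<exists>k0. \<forall>k\<le>k0. dbl k x \<longrightarrow> norm (ball_mean \<mu> f x (pow6 k) - f x) \<le> 3 * e)} \<subseteq> N" (is "\<exists>N\<in>_. ?E \<subseteq> N")
proof (rule null_outer)
  fix \<eta> :: real assume \<eta>: "0 < \<eta>"
  have m [measurable]: "g i \<in> borel_measurable \<mu>" "f \<in> borel_measurable \<mu>" "h \<in> borel_measurable \<mu>" for i
    using loc by (auto intro: loc_measurable)
  \<comment> \<open>Two extra scales leave room for every ball of radius at most
    \<open>pow6 R\<close> centred in the given ball.\<close>
  define W where "W = ball z (pow6 (R + 2))"
  have W [measurable]: "W \<in> sets \<mu>" by (simp add: W_def)
  define d where "d i = (\<integral>\<^sup>+y\<in>W. ennreal (norm (f y - g i y)) \<partial>\<mu>)" for i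
  have "d \<longlonglongrightarrow> 0"
  proof -
    have "(\<lambda>i. \<integral>\<^sup>+x. ennreal (norm (indicator W x *\<^sub>R f x - indicator W x *\<^sub>R g i x)) \<partial>\<mu>) \<longlonglongrightarrow> 0"
    proof (rule nn_integral_dominated_convergence_norm)
      show "AE x in \<mu>. norm (indicator W x *\<^sub>R g j x) \<le> indicator W x * h x" for j
        using bound by (auto simp: indicator_def)
      have "ennreal (indicator W x * h x) = ennreal (norm (h x)) * indicator W x" for x
        using order.trans[OF norm_ge_zero bound[of 0 x]] by (auto simp: indicator_def)
      then show "(\<integral>\<^sup>+x. ennreal (indicator W x * h x) \<partial>\<mu>) < \<infinity>"
        using nn_loc_finite[OF loc(3), of z "pow6 (R+2)"] by (simp add: W_def)
      show "AE x in \<mu>. (\<lambda>i. indicator W x *\<^sub>R g i x) \<longlonglongrightarrow> indicator W x *\<^sub>R f x"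
        by (intro AE_I2 tendsto_intros lim)
    qed (auto intro!: borel_measurable_scaleR borel_measurable_times m W borel_measurable_indicator)
    moreover have "(\<integral>\<^sup>+x. ennreal (norm (indicator W x *\<^sub>R f x - indicator W x *\<^sub>R g i x)) \<partial>\<mu>) = d i" for i
      unfolding d_def by (intro nn_integral_cong) (auto simp: indicator_def)
    ultimately show ?thesis by (simp add: fun_eq_iff)
  qed
  \<comment> \<open>The sum of the two weak-type constants, \<beta> / e for \<open>U1\<close> and 1
    / e for \<open>U2\<close>.\<close>
  define c where "c = \<beta> / e + 1 / e"
  have c: "0 < c" using e by (simp add: c_def add_pos_pos)
  have "0 < ennreal (\<eta> / c)" using \<eta> c by simp
  then have "\<forall>\<^sub>F i in sequentially. d i < ennreal (\<eta> / c)" using \<open>d \<longlonglongrightarrow> 0\<close> by (intro order_tendstoD) auto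
  then obtain i where i: "d i < ennreal (\<eta> / c)" by (auto simp: eventually_sequentially)
  define u where "u y = norm (f y - g i y)" for y
  have u_meas [measurable]: "u \<in> borel_measurable \<mu>" unfolding u_def[abs_def] by measurable
  have u_nonneg: "0 \<le> u y" for y by (simp add: u_def)
  have d_u: "d i = (\<integral>\<^sup>+y\<in>W. ennreal (u y) \<partial>\<mu>)" by (simp add: d_def u_def)
  have sub: "ball z (pow6 R) \<subseteq> W" unfolding W_def by (intro subset_ball pow6_mono) simp
  define F where "F = {p. fst p \<in> ball z (pow6 R) \<and> snd p \<le> R \<and> dbl (snd p) (fst p) \<and>
     ennreal (e * V (snd p) (fst p)) < (\<integral>\<^sup>+y\<in>bl p. ennreal (u y) \<partial>\<mu>)}"
  have "\<exists>U\<in>sets \<mu>. (\<Union>p\<in>F. bl p) \<subseteq> U \<and> emeasure \<mu> U \<le> (\<integral>\<^sup>+y\<in>W. (ennreal (\<beta> / e) * ennreal (u y)) \<partial>\<mu>)"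
  proof (rule weak_cover[of F R])
    fix p assume p: "p \<in> F"
    show "snd p \<le> R" using p by (simp add: F_def)
    show "bl p \<subseteq> W"
    proof -
      have "dist (fst p) z < pow6 (R + 1)"
        using p pow6_mono[of R "R+1"] by (auto simp: F_def dist_commute)
      then have "ball (fst p) (pow6 R) \<subseteq> W" unfolding W_def by (rule ball_pow6_shift) simp
      moreover have "bl p \<subseteq> ball (fst p) (pow6 R)" using p by (intro subset_ball pow6_mono) (simp add: F_def)
      ultimately show ?thesis by (rule order.trans[rotated])
    qed
    have dp: "dbl (snd p) (fst p)" using p by (simp add: F_def)
    have "V (snd p + 1) (fst p) \<le> L (snd p + 1) (fst p)" by (rule V_le_L)
    also have "\<dots> \<le> \<beta> * L (snd p) (fst p)" by (rule L_Suc_le)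
    also have "\<dots> = \<beta> / e * (e * V (snd p) (fst p))" using dp e by (simp add: dbl_def)
    finally have "ennreal (V (snd p + 1) (fst p)) \<le> ennreal (\<beta> / e * (e * V (snd p) (fst p)))"
      by (rule ennreal_leI)
    also have "\<dots> = ennreal (\<beta> / e) * ennreal (e * V (snd p) (fst p))" using e by (intro ennreal_mult) auto
    also have "\<dots> \<le> ennreal (\<beta> / e) * (\<integral>\<^sup>+y\<in>bl p. ennreal (u y) \<partial>\<mu>)"
      using p by (intro mult_left_mono) (auto simp: F_def)
    also have "\<dots> = (\<integral>\<^sup>+y\<in>bl p. (ennreal (\<beta> / e) * ennreal (u y)) \<partial>\<mu>)"
      by (subst nn_integral_cmult[symmetric]) (auto simp: mult.assoc)
    finally show "ennreal (V (snd p + 1) (fst p)) \<le> (\<integral>\<^sup>+y\<in>bl p. (ennreal (\<beta> / e) * ennreal (u y)) \<partial>\<mu>)" .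
  qed (auto simp: W_def)
  then obtain U1 where U1: "U1 \<in> sets \<mu>" "(\<Union>p\<in>F. bl p) \<subseteq> U1"
    "emeasure \<mu> U1 \<le> (\<integral>\<^sup>+y\<in>W. (ennreal (\<beta> / e) * ennreal (u y)) \<partial>\<mu>)" by blast
  have U1': "emeasure \<mu> U1 \<le> ennreal (\<beta> / e) * d i"
    using U1(3) unfolding d_u by (simp add: nn_integral_cmult[symmetric] mult.assoc)
  define U2 where "U2 = {y \<in> W. 1 \<le> ennreal (1 / e) * ennreal (u y)}"
  have U2: "U2 \<in> sets \<mu>" "emeasure \<mu> U2 \<le> ennreal (1 / e) * d i"
  proof -
    have "{y \<in> space \<mu>. y \<in> W \<and> 1 \<le> ennreal (1 / e) * ennreal (u y)} \<in> sets \<mu>" by measurable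
    then show "U2 \<in> sets \<mu>" by (simp add: U2_def)
    show "emeasure \<mu> U2 \<le> ennreal (1 / e) * d i"
      unfolding U2_def d_u by (rule nn_integral_Markov_inequality) measurable
  qed
  define Q where "Q x \<longleftrightarrow> (\<forall>e>0. \<exists>k0. \<forall>k\<le>k0. dbl k x \<longrightarrow> norm (ball_mean \<mu> (g i) x (pow6 k) - g i x) \<le> e)" for x
  have "AE x in \<mu>. Q x" using ldt[of i] unfolding ldt_def Q_def .
  then obtain N where good: "\<And>x. x \<in> space \<mu> - N \<Longrightarrow> Q x" and N: "N \<in> null_sets \<mu>"
    by (rule AE_E3) blast
  have "?E \<subseteq> N \<union> U1 \<union> U2"
  proof (rule subsetI, rule ccontr)
    fix x assume x: "x \<in> ?E" and no: "x \<notin> N \<union> U1 \<union> U2"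
    have xb: "x \<in> ball z (pow6 R)" using x by simp
    then have xW: "x \<in> W" using sub by blast
    have "x \<notin> U2" using no by simp
    then have "\<not> 1 \<le> ennreal (u x / e)"
      using xW e by (simp add: U2_def ennreal_mult[symmetric] u_nonneg)
    then have ux: "u x < e" using e u_nonneg[of x] by (simp add: field_simps)
    have "x \<in> space \<mu> - N" using no by simp
    then have "\<exists>k0. \<forall>k\<le>k0. dbl k x \<longrightarrow> norm (ball_mean \<mu> (g i) x (pow6 k) - g i x) \<le> e"
      using good[of x] e unfolding Q_def by blast
    then obtain k0 where k0: "\<And>k. k \<le> k0 \<Longrightarrow> dbl k x \<Longrightarrow> norm (ball_mean \<mu> (g i) x (pow6 k) - g i x) \<le> e"
      by blast
    have "norm (ball_mean \<mu> f x (pow6 k) - f x) \<le> 3 * e" if k: "k \<le> min k0 R" "dbl k x" for k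
    proof -
      have V: "0 < V k x" using k(2) by (rule V_pos_dbl)
      have "(x, k) \<notin> F"
      proof
        assume "(x, k) \<in> F"
        then have "bl (x, k) \<subseteq> U1" using U1(2) by blast
        moreover have "x \<in> bl (x, k)" by simp
        ultimately show False using no by blast
      qed
      then have "(\<integral>\<^sup>+y\<in>ball x (pow6 k). ennreal (u y) \<partial>\<mu>) \<le> ennreal (e * V k x)"
        using xb k by (simp add: F_def not_less)
      moreover have "ennreal (norm (ball_mean \<mu> (\<lambda>y. f y - g i y) x (pow6 k) - 0) * V k x)
         \<le> (\<integral>\<^sup>+y\<in>ball x (pow6 k). ennreal (norm (f y - g i y - 0)) \<partial>\<mu>)"
        using loc_diff[OF loc(2) loc(1)] V by (rule ball_mean_deviation_V)
      ultimately have "ennreal (norm (ball_mean \<mu> (\<lambda>y. f y - g i y) x (pow6 k)) * V k x) \<le> ennreal (e * V k x)"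
        by (simp add: u_def)
      then have 1: "norm (ball_mean \<mu> f x (pow6 k) - ball_mean \<mu> (g i) x (pow6 k)) \<le> e"
        using V e by (simp add: ball_mean_diff[OF loc(2) loc(1)])
      have 2: "norm (ball_mean \<mu> (g i) x (pow6 k) - g i x) \<le> e" using k0[of k] k by simp
      have 3: "norm (g i x - f x) \<le> e" using ux by (simp add: u_def norm_minus_commute)
      show ?thesis
        using 1 2 3 norm_triangle_ineq[of "ball_mean \<mu> f x (pow6 k) - ball_mean \<mu> (g i) x (pow6 k)" "ball_mean \<mu> (g i) x (pow6 k) - f x"]
          norm_triangle_ineq[of "ball_mean \<mu> (g i) x (pow6 k) - g i x" "g i x - f x"] by simp
    qed
    then show False using x by blast
  qed
  moreover have "emeasure \<mu> (N \<union> U1 \<union> U2) \<le> ennreal \<eta>"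
  proof -
    have "emeasure \<mu> (N \<union> U1 \<union> U2) \<le> emeasure \<mu> (N \<union> U1) + emeasure \<mu> U2"
      using N U1 U2 by (intro emeasure_subadditive) auto
    also have "\<dots> \<le> (emeasure \<mu> N + emeasure \<mu> U1) + emeasure \<mu> U2"
      using N U1 U2 by (intro add_right_mono emeasure_subadditive) auto
    also have "\<dots> = emeasure \<mu> U1 + emeasure \<mu> U2" using N by auto
    also have "\<dots> \<le> ennreal (\<beta> / e) * d i + ennreal (1 / e) * d i"
      by (intro add_mono U1' U2)
    also have "\<dots> = ennreal c * d i"
      using e by (simp add: c_def distrib_right)
    also have "\<dots> \<le> ennreal c * ennreal (\<eta> / c)" using i by (intro mult_left_mono) auto
    also have "\<dots> = ennreal \<eta>" using c \<eta> by (simp add: ennreal_mult[symmetric])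
    finally show ?thesis .
  qed
  moreover have "N \<union> U1 \<union> U2 \<in> sets \<mu>" using N U1 U2 by auto
  ultimately show "\<exists>U\<in>sets \<mu>. ?E \<subseteq> U \<and> emeasure \<mu> U \<le> ennreal \<eta>" by blast
qed

text \<open>Closure under dominated pointwise limits. It carries differentiation from continuous
  functions to indicators of open sets, then of Borel sets, and finally to all locally integrable
  functions.\<close>

lemma ldt_lim:
  fixes g :: "nat \<Rightarrow> 'a \<Rightarrow> complex"
  assumes ldt: "\<And>i. ldt (g i)" and loc: "\<And>i. loc (g i)" "loc f" "loc (h :: 'a \<Rightarrow> real)"
    and lim: "\<And>x. (\<lambda>i. g i x) \<longlonglongrightarrow> f x" and bound: "\<And>i x. norm (g i x) \<le> h x"
  shows "ldt f"
proof -
  fix z :: 'a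
  let ?P = "\<lambda>x e. \<exists>k0. \<forall>k\<le>k0. dbl k x \<longrightarrow> norm (ball_mean \<mu> f x (pow6 k) - f x) \<le> e"
  have "AE x in \<mu>. x \<in> ball z (pow6 (int R)) \<longrightarrow> ?P x (3 * (1 / real (Suc n)))" for R n
  proof -
    obtain N where "N \<in> null_sets \<mu>" "{x \<in> ball z (pow6 (int R)). \<not> ?P x (3 * (1 / real (Suc n)))} \<subseteq> N"
      using ldt_lim_aux[OF assms, of "1 / real (Suc n)" z "int R"] by auto
    then show ?thesis by (intro AE_I'[of N]) auto
  qed
  then have "AE x in \<mu>. \<forall>R n. x \<in> ball z (pow6 (int R)) \<longrightarrow> ?P x (3 * (1 / real (Suc n)))"
    unfolding AE_all_countable by simp
  then show ?thesis unfolding ldt_def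
  proof eventually_elim
    case (elim x)
    have "x \<in> (\<Union>R. ball z (pow6 (int R)))" using UNIV_eq_UN_ball[of z] by blast
    then obtain R where R: "x \<in> ball z (pow6 (int R))" by (rule UN_E)
    show ?case
    proof (intro allI impI)
      fix e :: real assume "0 < e"
      then have "0 < e / 3" by simp
      then obtain n where n: "1 / real (Suc n) < e / 3" by (rule nat_approx_posE)
      have "?P x (3 * (1 / real (Suc n)))" using elim R by blast
      then obtain k0 where k0: "\<And>k. k \<le> k0 \<Longrightarrow> dbl k x \<Longrightarrow> norm (ball_mean \<mu> f x (pow6 k) - f x) \<le> 3 * (1 / real (Suc n))"
        by blast
      have "3 * (1 / real (Suc n)) \<le> e" using n by simp
      then show "?P x e" using k0 by (intro exI[of _ k0]) (meson order.trans)
    qed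
  qed
qed

lemma loc_indicator: "A \<in> sets \<mu> \<Longrightarrow> loc (\<lambda>x. of_real (indicator A x) :: complex)"
  by (rule loc_bounded_by[OF loc_const[of "1::real"]]) (auto simp: indicator_def)

lemma ldt_const: "ldt (\<lambda>_. c)"
  by (intro ldt_continuous loc_const) auto

lemma ldt_cmult: assumes "loc f" "ldt f" shows "ldt (\<lambda>x. c * f x)"
  using assms(2) unfolding ldt_def
proof eventually_elim
  case (elim x)
  have mean: "ball_mean \<mu> (\<lambda>x. c * f x) x r = c * ball_mean \<mu> f x r" for r
    unfolding ball_mean_def by (simp add: set_integral_mult_right)
  show ?case
  proof (intro allI impI)
    fix e :: real assume e: "0 < e"
    define e' where "e' = e / (norm c + 1)"
    have "0 < e'" using e by (simp add: e'_def add_nonneg_pos)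
    then obtain k0 where k0: "\<And>k. k \<le> k0 \<Longrightarrow> dbl k x \<Longrightarrow> norm (ball_mean \<mu> f x (pow6 k) - f x) \<le> e'"
      using elim by blast
    have "norm (ball_mean \<mu> (\<lambda>x. c * f x) x (pow6 k) - c * f x) \<le> e" if "k \<le> k0" "dbl k x" for k
    proof -
      have "norm (ball_mean \<mu> (\<lambda>x. c * f x) x (pow6 k) - c * f x) = norm c * norm (ball_mean \<mu> f x (pow6 k) - f x)"
        by (simp add: mean norm_mult[symmetric] right_diff_distrib)
      also have "\<dots> \<le> (norm c + 1) * e'" using k0[OF that] \<open>0 < e'\<close> by (intro mult_mono) auto
      also have "\<dots> = e" using norm_ge_zero[of c] by (simp add: e'_def add_nonneg_pos less_imp_neq[THEN not_sym])
      finally show ?thesis .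
    qed
    then show "\<exists>k0. \<forall>k\<le>k0. dbl k x \<longrightarrow> norm (ball_mean \<mu> (\<lambda>x. c * f x) x (pow6 k) - c * f x) \<le> e" by blast
  qed
qed

lemma ldt_add: assumes "loc f" "loc g" "ldt f" "ldt g" shows "ldt (\<lambda>x. f x + g x)"
proof -
  have l: "loc (\<lambda>x. 0 - g x)" by (intro loc_diff loc_const assms)
  have "ldt (\<lambda>x. f x - (0 - g x))" by (intro ldt_diff l loc_const ldt_const assms)
  then show ?thesis by simp
qed

lemma ldt_loc_sum:
  assumes "finite I" "\<And>i. i \<in> I \<Longrightarrow> loc (f i)" "\<And>i. i \<in> I \<Longrightarrow> ldt (f i)"
  shows "loc (\<lambda>x. \<Sum>i\<in>I. f i x) \<and> ldt (\<lambda>x. \<Sum>i\<in>I. f i x)"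
  using assms
proof (induction I rule: finite_induct)
  case empty
  show ?case using loc_const ldt_const by simp
next
  case (insert i I)
  have IH: "loc (\<lambda>x. \<Sum>i\<in>I. f i x)" "ldt (\<lambda>x. \<Sum>i\<in>I. f i x)"
    using insert.IH insert.prems by auto
  show ?case using insert IH loc_add[of "f i"] ldt_add[of "f i"] by simp
qed

lemma ldt_indicator_open: assumes "open U" shows "ldt (\<lambda>x. of_real (indicator U x))"
\<comment> \<open>\<open>infdist\<close> to the empty set is 0, so for the whole space the
  approximants below would vanish.\<close>
proof (cases "U = UNIV")
  case True
  then show ?thesis using ldt_const by simp
next
  case False
  define g where "g i x = complex_of_real (min 1 (real i * infdist x (- U)))" for i x
  have cont: "continuous_on UNIV (g i)" for i
    unfolding g_def[abs_def] by (intro continuous_intros)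
  have nb: "norm (g i x) \<le> 1" for i x by (simp add: g_def infdist_nonneg)
  have lg: "loc (g i)" for i
  proof (rule loc_bounded_by[OF loc_const[of "1::real"] _ nb])
    show "g i \<in> borel_measurable \<mu>" using borel_measurable_continuous_onI[OF cont[of i]]
      by (simp add: measurable_cong_sets[OF sets_mu refl])
  qed
  show ?thesis
  proof (rule ldt_lim[OF ldt_continuous[OF lg cont] lg _ loc_const[of "1::real"] _ nb])
    show "loc (\<lambda>x. complex_of_real (indicator U x))" using assms by (intro loc_indicator) simp
    show "(\<lambda>i. g i x) \<longlonglongrightarrow> complex_of_real (indicator U x)" for x
    proof (cases "x \<in> U")
      case True
      have "closed (- U)" "- U \<noteq> {}" using assms False by auto
      then have pos: "0 < infdist x (- U)" using True
        by (metis ComplD infdist_nonneg in_closed_iff_infdist_zero less_eq_real_def)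
      obtain n where n: "1 / infdist x (- U) < real n" using reals_Archimedean2 by blast
      show ?thesis
      proof (rule tendsto_eventually)
        show "\<forall>\<^sub>F i in sequentially. g i x = complex_of_real (indicator U x)"
          using eventually_ge_at_top[of n]
        proof eventually_elim
          case (elim i)
          have "1 / infdist x (- U) < real i" using n elim by linarith
          then have "1 \<le> real i * infdist x (- U)" using pos by (simp add: field_simps)
          then show ?case using True by (simp add: g_def)
        qed
      qed
    next
      case False
      then show ?thesis by (simp add: g_def)
    qed
  qed
qed

lemma ldt_indicator: assumes "A \<in> sets \<mu>" shows "ldt (\<lambda>x. of_real (indicator A x))"
proof -
  have "Int_stable {S :: 'a set. open S}" by (auto simp: Int_stable_def)
  moreover have "{S :: 'a set. open S} \<subseteq> Pow UNIV" by simp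
  moreover have "A \<in> sigma_sets UNIV {S. open S}" using assms by (simp add: sets_borel)
  ultimately show ?thesis
  proof (induction rule: sigma_sets_induct_disjoint)
    case (basic A)
    then show ?case by (intro ldt_indicator_open) simp
  next
    case empty
    show ?case using ldt_const[of 0] by simp
  next
    case (compl A)
    then have "A \<in> sets \<mu>" by (simp add: sets_borel)
    then have "ldt (\<lambda>x. 1 - of_real (indicator A x))"
      by (intro ldt_diff loc_const ldt_const loc_indicator compl)
    also have "(\<lambda>x. 1 - complex_of_real (indicator A x)) = (\<lambda>x. of_real (indicator (UNIV - A) x))"
      by (auto simp: indicator_def)
    finally show ?case .
  next
    case (union A)
    have A: "A i \<in> sets \<mu>" for i using union(2) by (auto simp: sets_borel)
    define g where "g n x = (\<Sum>i<n. complex_of_real (indicator (A i) x))" for n x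
    have gl: "loc (g n) \<and> ldt (g n)" for n unfolding g_def[abs_def]
      by (rule ldt_loc_sum) (auto intro: loc_indicator A union(3))
    have geq: "g n x = complex_of_real (indicator (\<Union>i<n. A i) x)" for n x
    proof -
      have "disjoint_family_on A {..<n}" using union(1) by (rule disjoint_family_on_mono[rotated]) simp
      then have "indicator (\<Union>i<n. A i) x = (\<Sum>i<n. indicator (A i) x :: real)"
        by (intro indicator_UN_disjoint) simp
      then show ?thesis by (simp add: g_def)
    qed
    show ?case
    proof (rule ldt_lim[OF conjunct2[OF gl] conjunct1[OF gl] _ loc_const[of "1::real"]])
      show "loc (\<lambda>x. complex_of_real (indicator (\<Union>i. A i) x))" using A by (intro loc_indicator) auto
      show "norm (g i x) \<le> 1" for i x by (simp add: geq indicator_def)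
      show "(\<lambda>i. g i x) \<longlonglongrightarrow> complex_of_real (indicator (\<Union>i. A i) x)" for x
        unfolding geq by (intro tendsto_of_real LIMSEQ_indicator_UN)
    qed
  qed
qed

lemma ldt_loc: assumes f: "loc f" shows "ldt f"
proof -
  have m [measurable]: "f \<in> borel_measurable \<mu>" using f by (rule loc_measurable)
  obtain s where s: "\<And>i. simple_function \<mu> (s i)" "\<And>x. (\<lambda>i. s i x) \<longlonglongrightarrow> f x"
    "\<And>i x. dist (s i x) 0 \<le> 2 * dist (f x) 0"
    using borel_measurable_implies_sequence_metric[OF m, of 0] by auto
  have nf: "loc (\<lambda>x. 2 * norm (f x))" using loc_add[OF loc_norm[OF f] loc_norm[OF f]] by simp
  have b: "norm (s i x) \<le> 2 * norm (f x)" for i x using s(3)[of i x] by simp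
  have ls: "loc (s i)" for i
    by (rule loc_bounded_by[OF nf borel_measurable_simple_function[OF s(1)] b])
  have "ldt (s i)" for i
  proof -
    have fin: "finite (range (s i))" using simple_functionD(1)[OF s(1)[of i]] by simp
    have vi: "s i -` {v} \<in> sets \<mu>" for v using simple_functionD(2)[OF s(1)[of i], of "{v}"] by simp
    have "ldt (\<lambda>x. \<Sum>v\<in>range (s i). v * of_real (indicator (s i -` {v}) x))"
    proof (rule conjunct2[OF ldt_loc_sum[OF fin]])
      fix v
      have "(\<lambda>x. v * complex_of_real (indicator (s i -` {v}) x)) \<in> borel_measurable \<mu>"
        using loc_measurable[OF loc_indicator[OF vi]] by (intro borel_measurable_times) auto
      then show "loc (\<lambda>x. v * complex_of_real (indicator (s i -` {v}) x))"
        by (rule loc_bounded_by[OF loc_const[of "norm v"]]) (auto simp: indicator_def)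
      show "ldt (\<lambda>x. v * complex_of_real (indicator (s i -` {v}) x))"
        by (intro ldt_cmult ldt_indicator loc_indicator vi)
    qed
    also have "(\<lambda>x. \<Sum>v\<in>range (s i). v * complex_of_real (indicator (s i -` {v}) x)) = s i"
    proof
      fix x
      have "(\<Sum>v\<in>range (s i). v * complex_of_real (indicator (s i -` {v}) x)) =
            (\<Sum>v\<in>range (s i). if v = s i x then v else 0)"
        by (intro sum.cong) (auto simp: indicator_def)
      also have "\<dots> = s i x" using fin by simp
      finally show "(\<Sum>v\<in>range (s i). v * complex_of_real (indicator (s i -` {v}) x)) = s i x" .
    qed
    finally show ?thesis .
  qed
  then show ?thesis by (rule ldt_lim[OF _ ls f nf s(2) b])
qed

end

section \<open>The John--Nirenberg inequality\<close>

text \<open>Serves \<open>c_near_aux\<close>: \<open>sum_ratio_le\<close> applies up to scale N and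
  again from N + 2 on, which leaves the single scale N + 1 to be bounded by hand.\<close>

lemma sum_int_split_le:
  fixes f :: "int \<Rightarrow> real"
  assumes "\<And>i. 0 \<le> f i" "k \<le> K"
  shows "(\<Sum>i=K+1..M. f i) \<le> (\<Sum>i=k..N. f i) + f (N + 1) + (\<Sum>i=N+2..M. f i)"
proof -
  have "(\<Sum>i=K+1..M. f i) \<le> (\<Sum>i\<in>{k..N} \<union> ({N+1} \<union> {N+2..M}). f i)"
    using assms by (intro sum_mono2) auto
  also have "\<dots> = (\<Sum>i=k..N. f i) + (f (N + 1) + (\<Sum>i=N+2..M. f i))"
    by (subst sum.union_disjoint; (subst sum.union_disjoint)?) auto
  finally show ?thesis by (simp add: add_ac)
qed

lemma ennreal_mult_plus:
  "0 \<le> x \<Longrightarrow> 0 \<le> p \<Longrightarrow> 0 \<le> q \<Longrightarrow> ennreal x * (ennreal p + ennreal q) = ennreal (x * (p + q))"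
  by (simp add: ennreal_mult)

lemma exists_greatest_int:
  fixes k :: int
  assumes "P k" "k \<le> k0"
  obtains m where "k \<le> m" "m \<le> k0" "P m" "\<And>i. m < i \<Longrightarrow> i \<le> k0 \<Longrightarrow> \<not> P i"
proof -
  let ?S = "{m \<in> {k..k0}. P m}"
  have fin: "finite ?S" by (rule finite_subset[of _ "{k..k0}"]) auto
  have ne: "?S \<noteq> {}" using assms by auto
  have in_S: "Max ?S \<in> ?S" by (rule Max_in[OF fin ne])
  show thesis
  proof (rule that[of "Max ?S"])
    fix i assume i: "Max ?S < i" "i \<le> k0"
    show "\<not> P i"
    proof
      assume "P i"
      then have "i \<in> ?S" using i in_S by auto
      then have "i \<le> Max ?S" by (rule Max_ge[OF fin])
      then show False using i by simp
    qed
  qed (use in_S in auto)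
qed

lemma powr_geometric_bound:
  assumes "0 < s"
  shows "\<exists>K>0. \<forall>m::nat. (real m + 1) powr s * (1/2) ^ m \<le> K * (3/4) ^ m"
proof -
  \<comment> \<open>With this choice ln u \<le> u - 1 at u = \<delta> (m + 1) bounds (m + 1)^s by a
    multiple of (3/2)^m, and (3/2) * (1/2) = 3/4.\<close>
  define \<delta> where "\<delta> = ln (3/2 :: real) / s"
  have \<delta>: "0 < \<delta>" using assms by (simp add: \<delta>_def)
  define K where "K = 3/2 * exp (- s * (1 + ln \<delta>))"
  have "(real m + 1) powr s * (1/2) ^ m \<le> K * (3/4) ^ m" for m :: nat
  proof -
    let ?x = "real m + 1"
    have "ln (\<delta> * ?x) \<le> \<delta> * ?x - 1" using \<delta> by (intro ln_le_minus_one) (simp add: add_pos_nonneg)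
    then have "ln ?x \<le> \<delta> * ?x - 1 - ln \<delta>" using \<delta> by (simp add: ln_mult)
    then have "s * ln ?x \<le> s * (\<delta> * ?x - 1 - ln \<delta>)" using assms by (intro mult_left_mono) auto
    also have "\<dots> = ln (3/2) * ?x + (- s * (1 + ln \<delta>))" using assms by (simp add: \<delta>_def field_simps)
    finally have "?x powr s \<le> exp (ln (3/2) * ?x + (- s * (1 + ln \<delta>)))" by (simp add: powr_def)
    also have "\<dots> = (3/2) powr ?x * exp (- s * (1 + ln \<delta>))" by (simp only: exp_add) (simp add: powr_def mult.commute)
    also have "(3/2::real) powr ?x = (3/2) ^ m * (3/2)" by (simp add: powr_add powr_realpow)
    finally have "?x powr s \<le> K * (3/2) ^ m" by (simp add: K_def mult_ac)
    then have "?x powr s * (1/2) ^ m \<le> K * (3/2) ^ m * (1/2) ^ m" by (intro mult_right_mono) auto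
    also have "\<dots> = K * (3/4) ^ m" by (simp add: power_mult_distrib[symmetric])
    finally show ?thesis .
  qed
  moreover have "0 < K" by (simp add: K_def)
  ultimately show ?thesis by blast
qed

context nhspace
begin

text \<open>The sum of the two comparison bounds \<open>2 + 2 * ratio_sum\<close> and
  \<open>2 + ratio_sum\<close> in \<open>c_near_aux\<close>.\<close>

definition near_const :: real where "near_const = 4 + 3 * ratio_sum"

text \<open>Chosen so that \<open>\<beta> ^ (a + 2) * (near_const + 2 + ratio_sum) / jn_level
  a\<close> equals 1/2, the factor gained in each step of the John-Nirenberg induction.\<close>

definition jn_level :: "nat \<Rightarrow> real" where "jn_level a = 2 * \<beta> ^ (a + 2) * (near_const + 2 + ratio_sum)"

lemma near_const_ge: "4 \<le> near_const" "1 + ratio_sum \<le> near_const"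
  using ratio_sum_nonneg unfolding near_const_def by linarith+

lemma jn_level_ge_near_const: "near_const \<le> jn_level a"
proof -
  have "1 \<le> \<beta> ^ (a + 2)" by (rule one_le_power) simp
  then have "1 * (near_const + 2 + ratio_sum) \<le> 2 * \<beta> ^ (a + 2) * (near_const + 2 + ratio_sum)"
    using near_const_ge ratio_sum_nonneg by (intro mult_right_mono) (linarith, auto)
  then have "near_const + 2 + ratio_sum \<le> jn_level a" by (simp only: jn_level_def mult_1)
  then show ?thesis using ratio_sum_nonneg by linarith
qed

lemma jn_level_pos: "0 < jn_level a" using jn_level_ge_near_const[of a] near_const_ge by linarith

lemma ratio_nonneg: "0 \<le> V m x / lam x (pow6 m)"
  using lam_pos[of "pow6 m" x] by simp

lemma ratio_le_1: "V m x / lam x (pow6 m) \<le> 1"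
  using lam_pos[of "pow6 m" x] V_le_lam[of m x] by simp

lemma sum_ratio_Suc_le:
  assumes "dist x y < pow6 (k + 2)" "k \<le> K"
  shows "(\<Sum>m=K+1..next_dbl k y. V m x / lam x (pow6 m)) \<le> ratio_sum"
proof -
  have "(\<Sum>m=K+1..next_dbl k y. V m x / lam x (pow6 m)) \<le> (\<Sum>m=k..next_dbl k y. V m x / lam x (pow6 m))"
    using assms(2) ratio_nonneg by (intro sum_mono2) auto
  then show ?thesis using sum_ratio_le[OF assms(1)] by linarith
qed

lemma doubling_ball_pow6: "doubling_ball \<mu> \<beta> x (pow6 k) \<longleftrightarrow> V (k + 1) x \<le> \<beta> * V k x"
  by (simp add: doubling_ball_def V_def pow6_Suc)

lemma dbl_doubling: assumes "dbl k x" shows "V (k + 1) x \<le> \<beta> * V k x"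
  using V_le_L[of "k+1" x] L_Suc_le[of k x] assms by (simp add: dbl_def)

lemma N_coeff_pow6: "N_coeff (pow6 K) (pow6 M) = M - K"
  unfolding N_coeff_def
proof (rule Least_equality)
  show "pow6 M \<le> pow6 (M - K) * pow6 K" by (simp add: power_int_add[symmetric])
  fix N assume "pow6 M \<le> pow6 N * pow6 K"
  then have "pow6 M \<le> pow6 (N + K)" by (simp add: power_int_add)
  then show "M - K \<le> N" using pow6_strict_mono[of "N + K" M] by force
qed

lemma K_coeff_pow6:
  "K_coeff \<mu> lam x (pow6 K) (pow6 M) = 1 + (\<Sum>m=K+1..M. V m x / lam x (pow6 m))"
proof -
  have "(\<Sum>k=1..M-K. measure \<mu> (ball x (pow6 k * pow6 K)) / lam x (pow6 k * pow6 K)) =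
        (\<Sum>m=K+1..M. V m x / lam x (pow6 m))"
    by (rule sum.reindex_bij_witness[of _ "\<lambda>m. m - K" "\<lambda>k. k + K"])
       (auto simp: V_def power_int_add)
  then show ?thesis unfolding K_coeff_def N_coeff_pow6 by simp
qed

end

text \<open>\<open>D\<close> is any admissible constant rather than the norm, since the infimum is
  taken only at the end; \<open>a\<close> turns the dilation \<rho> into a number of scales.\<close>

locale rbmo = nhspace +
  fixes b :: "'a \<Rightarrow> complex" and \<rho> D :: real and a :: nat
  assumes rho: "1 < \<rho>" "\<rho> \<le> 6 ^ a"
    and locb: "loc b" and D_pos: "0 < D"
    and const: "RBMO_const \<mu> lam \<beta> \<rho> b D"
begin

lemma D_nonneg: "0 \<le> D" using D_pos by simp

lemma b_measurable [measurable]: "b \<in> borel_measurable \<mu>"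
  by (rule loc_measurable[OF locb])

definition c :: "int \<Rightarrow> 'a \<Rightarrow> complex" where "c k x = ball_mean \<mu> b x (pow6 (next_dbl k x))"

text \<open>The smaller ball is only asked to be (6, \<beta>)-doubling, not \<open>dbl\<close>,
  because \<open>osc_c\<close> applies this to the smallest doubling ball of the definition of
  RBMO.\<close>

lemma mean_doubling_diff:
  assumes "V (K + 1) x \<le> \<beta> * V K x" "dbl M y" "ball x (pow6 K) \<subseteq> ball y (pow6 M)" "0 < V K x"
  shows "norm (ball_mean \<mu> b x (pow6 K) - ball_mean \<mu> b y (pow6 M))
           \<le> D * (1 + (\<Sum>m=K+1..M. V m x / lam x (pow6 m)))"
  using const[unfolded RBMO_const_def, THEN conjunct2, rule_format, of "pow6 K" "pow6 M" x y]
    assms dbl_doubling[OF assms(2)]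
  by (simp add: doubling_ball_pow6 K_coeff_pow6 V_def)

lemma c_near_aux:
  assumes d: "dist x y < pow6 (k + 1)" and le: "next_dbl k x \<le> next_dbl k y"
  shows "norm (c k x - c k y) \<le> near_const * D"
proof -
  define K where "K = next_dbl k x"
  define N where "N = next_dbl k y"
  \<comment> \<open>Neither of the two balls need contain the other, so both means are compared with
    the mean over a third doubling ball. Two scales above \<open>N\<close> it is large enough to
    contain both.\<close>
  define M where "M = next_dbl (N + 2) y"
  have k: "k \<le> K" "k \<le> N" "K \<le> N" "N + 2 \<le> M"
    using next_dbl_ge le by (auto simp: K_def N_def M_def)
  have dK: "dbl K x" "dbl N y" "dbl M y" by (simp_all add: K_def N_def M_def dbl_next_dbl)
  have "norm (ball_mean \<mu> b x (pow6 K) - ball_mean \<mu> b y (pow6 M))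
           \<le> D * (1 + (\<Sum>m=K+1..M. V m x / lam x (pow6 m)))"
  proof (rule mean_doubling_diff[OF dbl_doubling[OF dK(1)] dK(3) _ V_pos_dbl[OF dK(1)]])
    have "ball x (pow6 K) \<subseteq> ball y (pow6 (K + 2))" using d k by (intro ball_pow6_shift) auto
    also have "\<dots> \<subseteq> ball y (pow6 M)" using k by (intro subset_ball pow6_mono) auto
    finally show "ball x (pow6 K) \<subseteq> ball y (pow6 M)" .
  qed
  also have "\<dots> \<le> D * (2 + 2 * ratio_sum)"
  proof (rule mult_left_mono[OF _ D_nonneg])
    have "(\<Sum>m=K+1..M. V m x / lam x (pow6 m)) \<le> (\<Sum>m=k..N. V m x / lam x (pow6 m))
       + V (N + 1) x / lam x (pow6 (N + 1)) + (\<Sum>m=N+2..M. V m x / lam x (pow6 m))"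
      using k by (intro sum_int_split_le ratio_nonneg)
    moreover have "(\<Sum>m=k..N. V m x / lam x (pow6 m)) \<le> ratio_sum"
      unfolding N_def using d pow6_mono[of "k+1" "k+2"] by (intro sum_ratio_le) simp
    moreover have "(\<Sum>m=N+2..M. V m x / lam x (pow6 m)) \<le> ratio_sum"
      unfolding M_def using d pow6_mono[of "k+1" "N+2+2"] k by (intro sum_ratio_le) simp
    ultimately show "1 + (\<Sum>m=K+1..M. V m x / lam x (pow6 m)) \<le> 2 + 2 * ratio_sum"
      using ratio_le_1[of "N+1" x] by linarith
  qed
  finally have 1: "norm (ball_mean \<mu> b x (pow6 K) - ball_mean \<mu> b y (pow6 M)) \<le> D * (2 + 2 * ratio_sum)" .
  have "norm (ball_mean \<mu> b y (pow6 N) - ball_mean \<mu> b y (pow6 M))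
           \<le> D * (1 + (\<Sum>m=N+1..M. V m y / lam y (pow6 m)))"
    using k by (intro mean_doubling_diff[OF dbl_doubling[OF dK(2)] dK(3) _ V_pos_dbl[OF dK(2)]]
      subset_ball pow6_mono) auto
  also have "\<dots> \<le> D * (2 + ratio_sum)"
  proof (rule mult_left_mono[OF _ D_nonneg])
    have "(\<Sum>m=N+1..M. V m y / lam y (pow6 m)) \<le> (\<Sum>m\<in>{N+1} \<union> {N+2..M}. V m y / lam y (pow6 m))"
      using ratio_nonneg by (intro sum_mono2) auto
    also have "\<dots> = V (N + 1) y / lam y (pow6 (N + 1)) + (\<Sum>m=N+2..M. V m y / lam y (pow6 m))"
      by (subst sum.union_disjoint) auto
    finally have "(\<Sum>m=N+1..M. V m y / lam y (pow6 m)) \<le>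
      V (N + 1) y / lam y (pow6 (N + 1)) + (\<Sum>m=N+2..M. V m y / lam y (pow6 m))" .
    moreover have "(\<Sum>m=N+2..M. V m y / lam y (pow6 m)) \<le> ratio_sum"
      unfolding M_def by (intro sum_ratio_le) simp
    ultimately show "1 + (\<Sum>m=N+1..M. V m y / lam y (pow6 m)) \<le> 2 + ratio_sum"
      using ratio_le_1[of "N+1" y] by linarith
  qed
  finally have 2: "norm (ball_mean \<mu> b y (pow6 N) - ball_mean \<mu> b y (pow6 M)) \<le> D * (2 + ratio_sum)" .
  have "norm (c k x - c k y) = norm ((ball_mean \<mu> b x (pow6 K) - ball_mean \<mu> b y (pow6 M))
      - (ball_mean \<mu> b y (pow6 N) - ball_mean \<mu> b y (pow6 M)))"
    by (simp add: c_def K_def N_def)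
  also have "\<dots> \<le> D * (2 + 2 * ratio_sum) + D * (2 + ratio_sum)"
    using norm_triangle_ineq4 1 2 by (meson add_mono order.trans)
  also have "\<dots> = near_const * D" by (simp add: near_const_def algebra_simps)
  finally show ?thesis .
qed

lemma c_near: "dist x y < pow6 (k + 1) \<Longrightarrow> norm (c k x - c k y) \<le> near_const * D"
  using c_near_aux[of x y k] c_near_aux[of y x k]
  by (cases "next_dbl k x \<le> next_dbl k y") (auto simp: dist_commute norm_minus_commute)

lemma c_Suc: "norm (c k x - c (k + 1) x) \<le> near_const * D"
proof (cases "dbl k x")
  case True
  let ?T = "next_dbl (k + 1) x"
  have "norm (ball_mean \<mu> b x (pow6 k) - ball_mean \<mu> b x (pow6 ?T))
           \<le> D * (1 + (\<Sum>m=k+1..?T. V m x / lam x (pow6 m)))"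
    using next_dbl_ge[of "k+1" x]
    by (intro mean_doubling_diff dbl_doubling True dbl_next_dbl V_pos_dbl subset_ball pow6_mono) auto
  also have "\<dots> \<le> D * (1 + ratio_sum)"
    using D_nonneg by (intro mult_left_mono add_left_mono sum_ratio_le) auto
  also have "\<dots> \<le> near_const * D" using near_const_ge D_nonneg by (simp add: mult.commute mult_left_mono)
  finally show ?thesis using True by (simp add: c_def next_dbl_dbl)
next
  case False
  then show ?thesis using near_const_ge D_nonneg by (simp add: c_def next_dbl_not_dbl)
qed

lemma osc_nn:
  assumes r: "0 < r"
  shows "(\<integral>\<^sup>+y\<in>ball x r. ennreal (norm (b y - ball_mean \<mu> b x (tilde_radius \<mu> \<beta> x r))) \<partial>\<mu>)
          \<le> ennreal (D * measure \<mu> (ball x (\<rho> * r)))"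
proof (cases "measure \<mu> (ball x (\<rho> * r)) = 0")
  case True
  \<comment> \<open>Here 1 / 0 = 0 empties the defining inequality, but the inner ball is then a
    null set.\<close>
  have "ball x r \<subseteq> ball x (\<rho> * r)" using rho r by (intro subset_ball) simp
  then have "measure \<mu> (ball x r) \<le> measure \<mu> (ball x (\<rho> * r))"
    by (intro measure_mono_fmeasurable) auto
  then have "measure \<mu> (ball x r) = 0" using True measure_nonneg[of \<mu> "ball x r"] by linarith
  then have "ball x r \<in> null_sets \<mu>" by (simp add: null_sets_def measure_eq_emeasure_eq_ennreal emeasure_eq_ennreal_measure)
  then show ?thesis by (simp add: nn_integral_null_set)
next
  case False
  let ?m = "ball_mean \<mu> b x (tilde_radius \<mu> \<beta> x r)"
  have pos: "0 < measure \<mu> (ball x (\<rho> * r))" using False measure_nonneg[of \<mu> "ball x (\<rho> * r)"] by linarith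
  have "1 / measure \<mu> (ball x (\<rho> * r)) * (LINT y:ball x r|\<mu>. norm (b y - ?m)) \<le> D"
    using const r unfolding RBMO_const_def by blast
  then have *: "(LINT y:ball x r|\<mu>. norm (b y - ?m)) \<le> D * measure \<mu> (ball x (\<rho> * r))"
    using pos by (simp add: field_simps)
  have "integrable \<mu> (\<lambda>y. indicator (ball x r) y *\<^sub>R norm (b y - ?m))"
    using locD[OF loc_norm[OF loc_diff[OF locb loc_const]]] unfolding set_integrable_def .
  then have "(\<integral>\<^sup>+y. ennreal (indicator (ball x r) y *\<^sub>R norm (b y - ?m)) \<partial>\<mu>) =
      ennreal (LINT y:ball x r|\<mu>. norm (b y - ?m))"
    unfolding set_lebesgue_integral_def by (intro nn_integral_eq_integral) auto
  also have "(\<integral>\<^sup>+y. ennreal (indicator (ball x r) y *\<^sub>R norm (b y - ?m)) \<partial>\<mu>) =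
      (\<integral>\<^sup>+y\<in>ball x r. ennreal (norm (b y - ?m)) \<partial>\<mu>)"
    by (intro nn_integral_cong) (auto simp: indicator_def)
  finally show ?thesis using * by (simp add: ennreal_leI)
qed

lemma nn_dev_change:
  assumes "norm (u - v) \<le> e" "0 \<le> e"
  shows "(\<integral>\<^sup>+y\<in>ball x (pow6 k). ennreal (norm (b y - u)) \<partial>\<mu>)
    \<le> (\<integral>\<^sup>+y\<in>ball x (pow6 k). ennreal (norm (b y - v)) \<partial>\<mu>) + ennreal (e * V k x)"
proof -
  have "(\<integral>\<^sup>+y\<in>ball x (pow6 k). ennreal (norm (b y - u)) \<partial>\<mu>)
    \<le> (\<integral>\<^sup>+y. ennreal (norm (b y - v)) * indicator (ball x (pow6 k)) y + ennreal e * indicator (ball x (pow6 k)) y \<partial>\<mu>)"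
  proof (rule nn_integral_mono)
    fix y
    have "norm (b y - u) \<le> norm (b y - v) + e"
      using norm_triangle_ineq[of "b y - v" "v - u"] assms by (simp add: norm_minus_commute)
    then show "ennreal (norm (b y - u)) * indicator (ball x (pow6 k)) y \<le>
      ennreal (norm (b y - v)) * indicator (ball x (pow6 k)) y + ennreal e * indicator (ball x (pow6 k)) y"
      using assms(2) by (auto simp: indicator_def ennreal_plus[symmetric] simp del: ennreal_plus intro!: ennreal_leI)
  qed
  also have "\<dots> = (\<integral>\<^sup>+y\<in>ball x (pow6 k). ennreal (norm (b y - v)) \<partial>\<mu>) + ennreal (e * V k x)"
    using assms(2) by (subst nn_integral_add) (auto simp: nn_integral_cmult emeasure_V ennreal_mult)
  finally show ?thesis .
qed

text \<open>RBMO measures deviation from the mean over the smallest (6, \<beta>)-doubling ball,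
  while \<open>c\<close> uses the next \<open>dbl\<close> ball. The latter is no smaller, and the
  coefficient between the two is bounded by \<open>1 + ratio_sum\<close>.\<close>

lemma osc_c: "(\<integral>\<^sup>+y\<in>ball x (pow6 k). ennreal (norm (b y - c k x)) \<partial>\<mu>)
          \<le> ennreal ((2 + ratio_sum) * D * V (k + int a) x)"
proof (cases "V k x = 0")
  case True
  then have "ball x (pow6 k) \<in> null_sets \<mu>" by (simp add: null_sets_def emeasure_V)
  then show ?thesis by (simp add: nn_integral_null_set)
next
  case False
  then have Vk: "0 < V k x" using V_nonneg[of k x] by linarith
  define i where "i = (LEAST i::nat. doubling_ball \<mu> \<beta> x (6 ^ i * pow6 k))"
  have pk: "6 ^ i * pow6 k = pow6 (k + int i)" for i :: nat by (simp add: pow6_add)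
  obtain j where j: "next_dbl k x = k + int j" using next_dbl_ge[of k x] by (metis zle_iff_zadd)
  have dj: "doubling_ball \<mu> \<beta> x (6 ^ j * pow6 k)"
    unfolding pk doubling_ball_pow6 j[symmetric] by (rule dbl_doubling[OF dbl_next_dbl])
  have ij: "i \<le> j" unfolding i_def using dj by (rule Least_le)
  have di: "doubling_ball \<mu> \<beta> x (6 ^ i * pow6 k)" unfolding i_def using dj by (rule LeastI)
  have tilde: "tilde_radius \<mu> \<beta> x (pow6 k) = pow6 (k + int i)"
    unfolding tilde_radius_def i_def[symmetric] by (rule pk)
  have "norm (ball_mean \<mu> b x (pow6 (k + int i)) - ball_mean \<mu> b x (pow6 (next_dbl k x)))
           \<le> D * (1 + (\<Sum>m=k + int i+1..next_dbl k x. V m x / lam x (pow6 m)))"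
  proof (rule mean_doubling_diff)
    show "V (k + int i + 1) x \<le> \<beta> * V (k + int i) x" using di unfolding pk doubling_ball_pow6 .
    show "ball x (pow6 (k + int i)) \<subseteq> ball x (pow6 (next_dbl k x))"
      using ij j by (intro subset_ball pow6_mono) simp
    show "0 < V (k + int i) x" using V_mono[of k "k + int i" x] Vk by simp
  qed (rule dbl_next_dbl)
  also have "\<dots> \<le> D * (1 + ratio_sum)"
    using D_nonneg by (intro mult_left_mono add_left_mono sum_ratio_Suc_le) auto
  finally have diff: "norm (c k x - ball_mean \<mu> b x (pow6 (k + int i))) \<le> (1 + ratio_sum) * D"
    by (simp add: c_def norm_minus_commute mult.commute)
  have nn: "0 \<le> (1 + ratio_sum) * D" using D_nonneg by simp
  have "(\<integral>\<^sup>+y\<in>ball x (pow6 k). ennreal (norm (b y - c k x)) \<partial>\<mu>)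
    \<le> (\<integral>\<^sup>+y\<in>ball x (pow6 k). ennreal (norm (b y - ball_mean \<mu> b x (pow6 (k + int i)))) \<partial>\<mu>)
        + ennreal ((1 + ratio_sum) * D * V k x)"
    by (rule nn_dev_change[OF diff nn])
  also have "\<dots> \<le> ennreal (D * measure \<mu> (ball x (\<rho> * pow6 k))) + ennreal ((1 + ratio_sum) * D * V k x)"
    using osc_nn[of "pow6 k" x] unfolding tilde by (intro add_right_mono) simp
  also have "\<dots> \<le> ennreal (D * V (k + int a) x) + ennreal ((1 + ratio_sum) * D * V (k + int a) x)"
  proof (intro add_mono ennreal_leI mult_left_mono V_mono)
    show "measure \<mu> (ball x (\<rho> * pow6 k)) \<le> V (k + int a) x"
      unfolding V_def using rho by (intro measure_mono_fmeasurable subset_ball) (auto simp: pow6_add mult.commute)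
  qed (use D_nonneg in auto)
  also have "\<dots> = ennreal ((2 + ratio_sum) * D * V (k + int a) x)"
    using D_nonneg nn by (subst ennreal_plus[symmetric]) (auto simp: algebra_simps)
  finally show ?thesis .
qed

text \<open>The induction stops at the largest scale at which \<open>c\<close> is far from its initial value.  As \<open>c\<close> changes
  only across doubling scales, the stopping balls are automatically doubling.\<close>
lemma john_nirenberg:
  "emeasure \<mu> {y \<in> ball x (pow6 k). real m * (jn_level a * D + 2 * (near_const * D)) < norm (b y - c k x)}
     \<le> ennreal ((1/2) ^ m * V (k + int a + 1) x)"
proof (induction m arbitrary: x k)
  case 0
  have "emeasure \<mu> {y \<in> ball x (pow6 k). real 0 * (jn_level a * D + 2 * (near_const * D)) < norm (b y - c k x)}
      \<le> emeasure \<mu> (ball x (pow6 k))"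
    by (intro emeasure_mono) auto
  also have "\<dots> \<le> ennreal (V (k + int a + 1) x)" unfolding emeasure_V by (intro ennreal_leI V_mono) simp
  finally show ?case by simp
next
  case (Suc m)
  \<comment> \<open>\<open>jn_level a * D\<close> is the stopping height. One
    \<open>near_const * D\<close> pays for the overshoot at the stopping scale l, the other for
    passing to scale l + 1, where the induction hypothesis is applied.\<close>
  define \<Lambda> where "\<Lambda> = jn_level a * D + 2 * (near_const * D)"
  have AD: "0 \<le> near_const * D" using near_const_ge D_nonneg by simp
  have LD: "0 < jn_level a * D" using jn_level_pos D_pos by simp
  define c0 where "c0 = c k x"
  \<comment> \<open>Scaled so that its integral over a stopping ball dominates the measure of
    \<open>T p\<close>: the mean there is farther than \<open>jn_level a * D\<close> from
    \<open>c0\<close>, \<open>(1/2) ^ m\<close> comes from the induction hypothesis, and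
    \<open>\<beta> ^ (a + 2)\<close> compares scale l + a + 2 with the doubling scale l.\<close>
  define h where "h y = ennreal ((1/2) ^ m * \<beta> ^ (a + 2) / (jn_level a * D)) * ennreal (norm (b y - c0))" for y
  have h_meas [measurable]: "h \<in> borel_measurable \<mu>" unfolding h_def[abs_def] by measurable
  \<comment> \<open>The lower bound on the distance from \<open>c0\<close> feeds the estimate of
    \<open>T p\<close>; the upper bound is needed because a bad point ends up in the enlargement of
    a stopping ball with another centre.\<close>
  define F where "F = {p. fst p \<in> ball x (pow6 k) \<and> snd p < k \<and> dbl (snd p) (fst p) \<and>
     jn_level a * D < norm (c (snd p) (fst p) - c0) \<and> norm (c (snd p) (fst p) - c0) \<le> jn_level a * D + near_const * D}"
  define T where "T p = {z \<in> ball (fst p) (pow6 (snd p + 1)). real m * \<Lambda> < norm (b z - c (snd p + 1) (fst p))}" for p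
  define W where "W = ball x (pow6 (k + 1))"
  have T_sets: "T p \<in> sets \<mu>" for p
  proof -
    have "{z \<in> space \<mu>. z \<in> ball (fst p) (pow6 (snd p + 1)) \<and> real m * \<Lambda> < norm (b z - c (snd p + 1) (fst p))} \<in> sets \<mu>"
      by measurable
    then show ?thesis by (simp add: T_def)
  qed
  have "\<exists>S\<subseteq>F. (\<forall>p\<in>F. \<exists>q\<in>S. bl p \<subseteq> ball (fst q) (pow6 (snd q + 1))) \<and>
    (\<Union>p\<in>S. T p) \<in> sets \<mu> \<and> emeasure \<mu> (\<Union>p\<in>S. T p) \<le> (\<integral>\<^sup>+y\<in>W. h y \<partial>\<mu>)"
  proof (rule cover_sum[of F k])
    fix p assume p: "p \<in> F"
    obtain y l where pl: "p = (y, l)" by force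
    have y: "y \<in> ball x (pow6 k)" "l < k" "dbl l y" "jn_level a * D < norm (c l y - c0)"
      using p by (auto simp: F_def pl)
    show "snd p \<le> k" using y by (simp add: pl)
    have "bl p \<subseteq> ball y (pow6 (k - 1))" using y(2) by (simp add: pl subset_ball pow6_mono)
    also have "\<dots> \<subseteq> W" unfolding W_def
    proof (rule ball_subset_dist)
      have "pow6 k = 6 * pow6 (k - 1)" "pow6 (k + 1) = 6 * pow6 k" using pow6_Suc[of "k - 1"] pow6_Suc[of k] by auto
      then show "dist y x + pow6 (k - 1) \<le> pow6 (k + 1)" using y(1) pow6_pos(1)[of "k-1"] dist_commute[of x y]
        unfolding mem_ball by linarith
    qed
    finally show "bl p \<subseteq> W" .
    have Vl: "0 < V l y" using y(3) by (rule V_pos_dbl)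
    have cl: "c l y = ball_mean \<mu> b y (pow6 l)" using y(3) by (simp add: c_def next_dbl_dbl)
    have "emeasure \<mu> (T p) \<le> ennreal ((1/2) ^ m * V (l + 1 + int a + 1) y)"
      using Suc.IH[of y "l + 1"] by (simp add: T_def pl \<Lambda>_def)
    also have "\<dots> \<le> ennreal ((1/2) ^ m * \<beta> ^ (a + 2) / (jn_level a * D) * (norm (c l y - c0) * V l y))"
    proof (rule ennreal_leI)
      have "V (l + 1 + int a + 1) y = V (l + int (a + 2)) y" by (simp add: algebra_simps)
      also have "\<dots> \<le> L (l + int (a + 2)) y" by (rule V_le_L)
      also have "\<dots> \<le> \<beta> ^ (a + 2) * V l y" using L_add_le[of l "a+2" y] y(3) by (simp add: dbl_def)
      finally have "V (l + 1 + int a + 1) y \<le> \<beta> ^ (a + 2) * V l y" .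
      then have "(1/2) ^ m * V (l + 1 + int a + 1) y \<le> (1/2) ^ m * (\<beta> ^ (a + 2) * V l y)"
        by (intro mult_left_mono) auto
      also have "\<dots> = (1/2) ^ m * \<beta> ^ (a + 2) / (jn_level a * D) * ((jn_level a * D) * V l y)"
        using jn_level_pos[of a] D_pos by simp
      also have "\<dots> \<le> (1/2) ^ m * \<beta> ^ (a + 2) / (jn_level a * D) * (norm (c l y - c0) * V l y)"
        using y(4) LD Vl by (intro mult_left_mono mult_right_mono) auto
      finally show "(1/2) ^ m * V (l + 1 + int a + 1) y \<le> \<dots>" .
    qed
    also have "\<dots> = ennreal ((1/2) ^ m * \<beta> ^ (a + 2) / (jn_level a * D)) * ennreal (norm (c l y - c0) * V l y)"
      using LD by (intro ennreal_mult) auto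
    also have "\<dots> \<le> ennreal ((1/2) ^ m * \<beta> ^ (a + 2) / (jn_level a * D)) *
       (\<integral>\<^sup>+z\<in>ball y (pow6 l). ennreal (norm (b z - c0)) \<partial>\<mu>)"
      unfolding cl by (intro mult_left_mono ball_mean_deviation_V locb Vl) simp
    also have "\<dots> = (\<integral>\<^sup>+z\<in>bl p. h z \<partial>\<mu>)"
      unfolding h_def by (subst nn_integral_cmult[symmetric]) (auto simp: mult.assoc pl)
    finally show "emeasure \<mu> (T p) \<le> (\<integral>\<^sup>+z\<in>bl p. h z \<partial>\<mu>)" .
  qed (rule T_sets, rule h_meas, simp add: W_def)
  then obtain S where S: "S \<subseteq> F" "\<forall>p\<in>F. \<exists>q\<in>S. bl p \<subseteq> ball (fst q) (pow6 (snd q + 1))"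
    "(\<Union>p\<in>S. T p) \<in> sets \<mu>" "emeasure \<mu> (\<Union>p\<in>S. T p) \<le> (\<integral>\<^sup>+y\<in>W. h y \<partial>\<mu>)"
    by (elim exE conjE)
  define E where "E = {y \<in> ball x (pow6 k). real (Suc m) * \<Lambda> < norm (b y - c0)}"
  have E_sets: "E \<in> sets \<mu>"
  proof -
    have "{y \<in> space \<mu>. y \<in> ball x (pow6 k) \<and> real (Suc m) * \<Lambda> < norm (b y - c0)} \<in> sets \<mu>"
      by measurable
    then show ?thesis by (simp add: E_def)
  qed
  have "AE y in \<mu>. y \<in> E \<longrightarrow> y \<in> (\<Union>p\<in>S. T p)"
    using ldt_loc[OF locb, unfolded ldt_def] AE_dbl
  proof eventually_elim
    case (elim y)
    show ?case
    proof
      assume yE: "y \<in> E"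
      then have yx: "dist x y < pow6 k" and big: "real (Suc m) * \<Lambda> < norm (b y - c0)" by (auto simp: E_def)
      have "0 < near_const * D" using near_const_ge D_pos by simp
      then obtain k1 where k1: "\<And>i. i \<le> k1 \<Longrightarrow> dbl i y \<Longrightarrow> norm (ball_mean \<mu> b y (pow6 i) - b y) \<le> near_const * D"
        using elim(1) by blast
      \<comment> \<open>Differentiation forces the stopping condition at a small doubling scale,
        while \<open>c_near\<close> excludes it at scale k; so there is a largest stopping scale,
        and it lies below k.\<close>
      obtain i where i: "i \<le> min k1 k" "dbl i y" using elim(2) by blast
      have "norm (c i y - b y) \<le> near_const * D" using k1[of i] i by (simp add: c_def next_dbl_dbl)
      moreover have "\<Lambda> < norm (b y - c0)"
      proof -
        have "1 * \<Lambda> \<le> real (Suc m) * \<Lambda>" using AD LD by (intro mult_right_mono) (auto simp: \<Lambda>_def)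
        then show ?thesis using big by simp
      qed
      ultimately have "jn_level a * D < norm (c i y - c0)"
        using norm_triangle_ineq[of "b y - c i y" "c i y - c0"] AD by (simp add: \<Lambda>_def norm_minus_commute)
      moreover have "i \<le> k" using i by simp
      ultimately obtain l where l: "l \<le> k" "jn_level a * D < norm (c l y - c0)"
        "\<And>j. l < j \<Longrightarrow> j \<le> k \<Longrightarrow> \<not> jn_level a * D < norm (c j y - c0)"
        using exists_greatest_int[of "\<lambda>l. jn_level a * D < norm (c l y - c0)" i k] by metis
      have "norm (c k y - c0) \<le> near_const * D"
        unfolding c0_def using yx pow6_strict_mono[of k "k+1"] by (intro c_near) (simp add: dist_commute)
      also have "\<dots> \<le> jn_level a * D" using jn_level_ge_near_const D_nonneg by (intro mult_right_mono)
      finally have "l \<noteq> k" using l(2) by auto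
      then have lk: "l < k" using l(1) by simp
      have up: "norm (c (l + 1) y - c0) \<le> jn_level a * D" using l(3)[of "l+1"] lk by simp
      have "dbl l y"
      proof (rule ccontr)
        assume "\<not> dbl l y"
        then have "c l y = c (l + 1) y" by (simp add: c_def next_dbl_not_dbl)
        then show False using up l(2) by simp
      qed
      moreover have "norm (c l y - c0) \<le> jn_level a * D + near_const * D"
        using norm_triangle_ineq[of "c l y - c (l+1) y" "c (l+1) y - c0"] up c_Suc[of l y] by simp
      ultimately have yF: "(y, l) \<in> F" using yx lk l(2) by (simp add: F_def)
      obtain q where q: "q \<in> S" "bl (y, l) \<subseteq> ball (fst q) (pow6 (snd q + 1))" using S(2) yF by blast
      obtain w j where wj: "q = (w, j)" by force
      have "y \<in> bl (y, l)" by simp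
      then have "y \<in> ball (fst q) (pow6 (snd q + 1))" by (rule subsetD[OF q(2)])
      then have yb: "y \<in> ball w (pow6 (j + 1))" by (simp add: wj)
      have "(w, j) \<in> F" using q S(1) wj by auto
      then have up': "norm (c j w - c0) \<le> jn_level a * D + near_const * D" by (simp add: F_def)
      have "norm (b y - c0) \<le> norm (b y - c (j+1) w) + norm (c (j+1) w - c j w) + norm (c j w - c0)"
        using norm_triangle_ineq[of "b y - c (j+1) w" "c (j+1) w - c0"]
          norm_triangle_ineq[of "c (j+1) w - c j w" "c j w - c0"] by simp
      then have "real (Suc m) * \<Lambda> - \<Lambda> < norm (b y - c (j+1) w)"
        using big up' c_Suc[of j w] by (simp add: \<Lambda>_def norm_minus_commute)
      then have "real m * \<Lambda> < norm (b y - c (j+1) w)" by (simp add: algebra_simps)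
      then have "y \<in> T q" using yb by (simp add: T_def wj)
      then show "y \<in> (\<Union>p\<in>S. T p)" using q(1) by blast
    qed
  qed
  then have "emeasure \<mu> E \<le> emeasure \<mu> (\<Union>p\<in>S. T p)"
    using S(3) by (intro emeasure_mono_AE)
  also have "\<dots> \<le> (\<integral>\<^sup>+y\<in>W. h y \<partial>\<mu>)" by (rule S(4))
  also have "\<dots> = ennreal ((1/2) ^ m * \<beta> ^ (a + 2) / (jn_level a * D)) *
       (\<integral>\<^sup>+z\<in>ball x (pow6 (k + 1)). ennreal (norm (b z - c0)) \<partial>\<mu>)"
    unfolding h_def W_def by (subst nn_integral_cmult[symmetric]) (auto simp: mult.assoc)
  also have "\<dots> \<le> ennreal ((1/2) ^ m * \<beta> ^ (a + 2) / (jn_level a * D)) *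
       (ennreal ((2 + ratio_sum) * D * V (k + 1 + int a) x) + ennreal (near_const * D * V (k + 1) x))"
  proof (intro mult_left_mono)
    have "(\<integral>\<^sup>+z\<in>ball x (pow6 (k + 1)). ennreal (norm (b z - c0)) \<partial>\<mu>) \<le>
      (\<integral>\<^sup>+z\<in>ball x (pow6 (k + 1)). ennreal (norm (b z - c (k + 1) x)) \<partial>\<mu>) + ennreal (near_const * D * V (k + 1) x)"
      unfolding c0_def by (intro nn_dev_change c_Suc AD)
    also have "\<dots> \<le> ennreal ((2 + ratio_sum) * D * V (k + 1 + int a) x) + ennreal (near_const * D * V (k + 1) x)"
      by (intro add_right_mono osc_c)
    finally show "(\<integral>\<^sup>+z\<in>ball x (pow6 (k + 1)). ennreal (norm (b z - c0)) \<partial>\<mu>) \<le> \<dots>" .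
  qed simp
  also have "\<dots> = ennreal ((1/2) ^ m * \<beta> ^ (a + 2) / (jn_level a * D) *
       ((2 + ratio_sum) * D * V (k + 1 + int a) x + near_const * D * V (k + 1) x))"
    using LD AD D_nonneg by (intro ennreal_mult_plus) auto
  also have "\<dots> \<le> ennreal ((1/2) ^ Suc m * V (k + int a + 1) x)"
  proof (rule ennreal_leI)
    have "near_const * D * V (k + 1) x \<le> near_const * D * V (k + int a + 1) x" using AD by (intro mult_left_mono V_mono) auto
    then have "(2 + ratio_sum) * D * V (k + 1 + int a) x + near_const * D * V (k + 1) x \<le> (near_const + 2 + ratio_sum) * D * V (k + int a + 1) x"
      by (simp add: algebra_simps)
    then have "(1/2) ^ m * \<beta> ^ (a + 2) / (jn_level a * D) * ((2 + ratio_sum) * D * V (k + 1 + int a) x + near_const * D * V (k + 1) x)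
      \<le> (1/2) ^ m * \<beta> ^ (a + 2) / (jn_level a * D) * ((near_const + 2 + ratio_sum) * D * V (k + int a + 1) x)"
      using LD by (intro mult_left_mono) auto
    also have "\<dots> = (1/2) ^ Suc m * V (k + int a + 1) x"
    proof -
      have "near_const + 2 + ratio_sum \<noteq> 0" using near_const_ge ratio_sum_nonneg by linarith
      then show ?thesis using D_pos by (simp add: jn_level_def)
    qed
    finally show "(1/2) ^ m * \<beta> ^ (a + 2) / (jn_level a * D) * ((2 + ratio_sum) * D * V (k + 1 + int a) x + near_const * D * V (k + 1) x)
      \<le> (1/2) ^ Suc m * V (k + int a + 1) x" .
  qed
  finally show ?case by (simp add: E_def c0_def \<Lambda>_def)
qed

end

section \<open>Oscillation over a level of the dominating function\<close>

lemma suminf_ennreal_geometric: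
  assumes "0 \<le> c" "0 \<le> r" "r < (1::real)"
  shows "(\<Sum>m. ennreal (c * r ^ m)) = ennreal (c / (1 - r))"
proof -
  have s: "summable (\<lambda>m. c * r ^ m)" using assms by (intro summable_mult summable_geometric) auto
  have "(\<Sum>m. ennreal (c * r ^ m)) = ennreal (\<Sum>m. c * r ^ m)"
    using assms s by (intro suminf_ennreal2) auto
  also have "(\<Sum>m. c * r ^ m) = c / (1 - r)"
    using assms by (subst suminf_mult) (auto simp: suminf_geometric summable_geometric)
  finally show ?thesis .
qed

lemma ennreal_le_suminf: "f m \<le> (\<Sum>i. f i)" for f :: "nat \<Rightarrow> ennreal"
proof -
  have "sum f {m} \<le> (\<Sum>i. f i)" by (rule sum_le_suminf) auto
  then show ?thesis by simp
qed

lemma powr_add_le: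
  fixes u v s :: real
  assumes "0 \<le> u" "0 \<le> v" "0 < s"
  shows "(u + v) powr s \<le> 2 powr s * (u powr s + v powr s)"
proof -
  have "(u + v) powr s \<le> (2 * max u v) powr s" using assms by (intro powr_mono2) auto
  also have "\<dots> = 2 powr s * max u v powr s" using assms by (simp add: powr_mult)
  also have "max u v powr s \<le> u powr s + v powr s" by (simp add: max_def)
  finally show ?thesis by (simp add: mult_left_mono)
qed

section \<open>Hoelder's inequality for nonnegative integrals\<close>

lemma nn_integral_eq_0_powr:
  fixes f :: "'a \<Rightarrow> real"
  assumes f: "f \<in> borel_measurable M" "\<And>x. 0 \<le> f x" and "(\<integral>\<^sup>+x. ennreal (f x powr p) \<partial>M) = 0"
  shows "AE x in M. f x = 0"
proof -
  have "AE x in M. ennreal (f x powr p) = 0"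
    using assms by (subst nn_integral_0_iff_AE[symmetric]) auto
  then show ?thesis by eventually_elim (auto simp: ennreal_eq_0_iff)
qed

lemma nn_integral_Holder:
  fixes f g :: "'a \<Rightarrow> real"
  assumes pq: "1 < p" "1 < q" "1 / p + 1 / q = 1"
    and f [measurable]: "f \<in> borel_measurable M" and f0: "\<And>x. 0 \<le> f x"
    and g [measurable]: "g \<in> borel_measurable M" and g0: "\<And>x. 0 \<le> g x"
    and A: "(\<integral>\<^sup>+x. ennreal (f x powr p) \<partial>M) \<le> ennreal A" "0 \<le> A"
    and B: "(\<integral>\<^sup>+x. ennreal (g x powr q) \<partial>M) \<le> ennreal B" "0 \<le> B"
  shows "(\<integral>\<^sup>+x. ennreal (f x * g x) \<partial>M) \<le> ennreal (A powr (1 / p) * B powr (1 / q))"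
proof (cases "A = 0 \<or> B = 0")
  case True
  have "AE x in M. f x = 0 \<or> g x = 0"
  proof (cases "A = 0")
    case True
    then have "AE x in M. f x = 0" using A by (intro nn_integral_eq_0_powr[of f M p] f f0) simp
    then show ?thesis by eventually_elim simp
  next
    case False
    then have "AE x in M. g x = 0" using \<open>A = 0 \<or> B = 0\<close> B by (intro nn_integral_eq_0_powr[of g M q] g g0) simp
    then show ?thesis by eventually_elim simp
  qed
  then have "AE x in M. ennreal (f x * g x) = 0" by eventually_elim auto
  then have "(\<integral>\<^sup>+x. ennreal (f x * g x) \<partial>M) = (\<integral>\<^sup>+x. 0 \<partial>M)" by (intro nn_integral_cong_AE)
  then show ?thesis by simp
next
  case False
  then have near_const: "0 < A" and B0: "0 < B" using A B by auto
  \<comment> \<open>Young's inequality is applied to the functions divided by these norm bounds,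
    which is why a vanishing bound was treated apart.\<close>
  define a where "a = A powr (1 / p)"
  define b where "b = B powr (1 / q)"
  have ab: "0 < a" "0 < b" using near_const B0 by (auto simp: a_def b_def)
  have ap: "a powr p = A" "b powr q = B" using near_const B0 pq by (auto simp: a_def b_def powr_powr)
  have pt: "f x * g x \<le> a * b * (f x powr p / (p * A) + g x powr q / (q * B))" for x
  proof -
    have "(f x / a) * (g x / b) \<le> (f x / a) powr p / p + (g x / b) powr q / q"
      using pq ab f0 g0 by (intro Youngs_inequality) auto
    also have "\<dots> = f x powr p / (p * A) + g x powr q / (q * B)"
      using ab f0 g0 ap by (simp add: powr_divide mult.commute)
    finally have "a * b * ((f x / a) * (g x / b)) \<le> a * b * (f x powr p / (p * A) + g x powr q / (q * B))"
      using ab by (intro mult_left_mono) auto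
    then show ?thesis using ab by simp
  qed
  have "(\<integral>\<^sup>+x. ennreal (f x * g x) \<partial>M) \<le>
     (\<integral>\<^sup>+x. ennreal (a * b / (p * A)) * ennreal (f x powr p) + ennreal (a * b / (q * B)) * ennreal (g x powr q) \<partial>M)"
  proof (rule nn_integral_mono)
    fix x
    have "ennreal (f x * g x) \<le> ennreal (a * b * (f x powr p / (p * A) + g x powr q / (q * B)))"
      by (intro ennreal_leI pt)
    also have "a * b * (f x powr p / (p * A) + g x powr q / (q * B)) =
       a * b / (p * A) * f x powr p + a * b / (q * B) * g x powr q"
      by (simp add: algebra_simps)
    also have "ennreal \<dots> = ennreal (a * b / (p * A)) * ennreal (f x powr p) + ennreal (a * b / (q * B)) * ennreal (g x powr q)"
      using ab near_const B0 pq by (subst ennreal_plus) (auto simp: ennreal_mult[symmetric])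
    finally show "ennreal (f x * g x) \<le> \<dots>" .
  qed
  also have "\<dots> = ennreal (a * b / (p * A)) * (\<integral>\<^sup>+x. ennreal (f x powr p) \<partial>M)
      + ennreal (a * b / (q * B)) * (\<integral>\<^sup>+x. ennreal (g x powr q) \<partial>M)"
    by (subst nn_integral_add) (auto simp: nn_integral_cmult)
  also have "\<dots> \<le> ennreal (a * b / (p * A)) * ennreal A + ennreal (a * b / (q * B)) * ennreal B"
    by (intro add_mono mult_left_mono A B) auto
  also have "\<dots> = ennreal (a * b / p + a * b / q)"
    using ab near_const B0 pq by (simp add: ennreal_mult[symmetric] ennreal_plus[symmetric] del: ennreal_plus)
  also have "a * b / p + a * b / q = a * b * (1 / p + 1 / q)" by (simp add: algebra_simps)
  also have "\<dots> = a * b" using pq by simp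
  finally show ?thesis by (simp add: a_def b_def)
qed

lemma nn_integral_Holder_set:
  fixes f g :: "'a \<Rightarrow> real"
  assumes pq: "1 < p" "1 < q" "1 / p + 1 / q = 1" and S [measurable]: "S \<in> sets M"
    and f [measurable]: "f \<in> borel_measurable M" and f0: "\<And>x. 0 \<le> f x"
    and g [measurable]: "g \<in> borel_measurable M" and g0: "\<And>x. 0 \<le> g x"
    and A: "(\<integral>\<^sup>+x\<in>S. ennreal (f x powr p) \<partial>M) \<le> ennreal A" "0 \<le> A"
    and B: "(\<integral>\<^sup>+x\<in>S. ennreal (g x powr q) \<partial>M) \<le> ennreal B" "0 \<le> B"
  shows "(\<integral>\<^sup>+x\<in>S. ennreal (f x * g x) \<partial>M) \<le> ennreal (A powr (1 / p) * B powr (1 / q))"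
proof -
  have "(\<integral>\<^sup>+x. ennreal ((f x * indicator S x) * (g x * indicator S x)) \<partial>M) \<le> ennreal (A powr (1 / p) * B powr (1 / q))"
  proof (rule nn_integral_Holder[OF pq])
    have "(\<integral>\<^sup>+x. ennreal ((f x * indicator S x) powr p) \<partial>M) = (\<integral>\<^sup>+x\<in>S. ennreal (f x powr p) \<partial>M)"
      using pq by (intro nn_integral_cong) (auto simp: indicator_def)
    then show "(\<integral>\<^sup>+x. ennreal ((f x * indicator S x) powr p) \<partial>M) \<le> ennreal A" using A by simp
    have "(\<integral>\<^sup>+x. ennreal ((g x * indicator S x) powr q) \<partial>M) = (\<integral>\<^sup>+x\<in>S. ennreal (g x powr q) \<partial>M)"
      using pq by (intro nn_integral_cong) (auto simp: indicator_def)
    then show "(\<integral>\<^sup>+x. ennreal ((g x * indicator S x) powr q) \<partial>M) \<le> ennreal B" using B by simp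
  qed (use A B f0 g0 in auto)
  also have "(\<integral>\<^sup>+x. ennreal ((f x * indicator S x) * (g x * indicator S x)) \<partial>M) = (\<integral>\<^sup>+x\<in>S. ennreal (f x * g x) \<partial>M)"
    by (intro nn_integral_cong) (auto simp: indicator_def)
  finally show ?thesis .
qed

text \<open>Fixed by choice, so that it depends on \<open>s\<close> alone and can enter constants
  that must not depend on \<open>b\<close>.\<close>

definition powr_geo_const :: "real \<Rightarrow> real" where
  "powr_geo_const s = (SOME K. 0 < K \<and> (\<forall>m::nat. (real m + 1) powr s * (1/2) ^ m \<le> K * (3/4) ^ m))"

lemma powr_geo_const: assumes "0 < s"
  shows "0 < powr_geo_const s" "(real m + 1) powr s * (1/2) ^ m \<le> powr_geo_const s * (3/4) ^ m"
proof -
  have "0 < powr_geo_const s \<and> (\<forall>m::nat. (real m + 1) powr s * (1/2) ^ m \<le> powr_geo_const s * (3/4) ^ m)"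
    unfolding powr_geo_const_def using powr_geometric_bound[OF assms] by (rule someI_ex)
  then show "0 < powr_geo_const s" "(real m + 1) powr s * (1/2) ^ m \<le> powr_geo_const s * (3/4) ^ m" by blast+
qed

context nhspace
begin

text \<open>This and the following constants are declared before \<open>b\<close> and
  \<open>D\<close> are fixed, which makes their independence of \<open>b\<close> visible. Here 4
  sums the series of ratio 3/4, and \<open>\<beta> ^ (a + 1)\<close> compares \<open>V\<close> at
  scale k + a + 1 with \<open>L k x\<close>.\<close>

definition jn_const :: "real \<Rightarrow> nat \<Rightarrow> real" where
  "jn_const s a = 4 * powr_geo_const s * (jn_level a + 2 * near_const) powr s * \<beta> ^ (a + 1)"

lemma jn_const_nonneg: "0 < s \<Longrightarrow> 0 \<le> jn_const s a"
  using powr_geo_const(1)[of s] by (simp add: jn_const_def)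

text \<open>2 is the width of a level of \<open>L\<close>, and \<open>\<beta> ^ a\<close> comes from
  the enlargement by \<rho> in \<open>osc_c\<close>.\<close>

definition level_gap :: "nat \<Rightarrow> real" where "level_gap a = 2 * (2 + ratio_sum) * \<beta> ^ a"

lemma level_gap_nonneg: "0 \<le> level_gap a" by (simp add: level_gap_def)

definition dev_const :: "real \<Rightarrow> nat \<Rightarrow> real" where
  "dev_const s a = 2 powr s * (jn_const s a + (near_const + (level_gap a + near_const)) powr s) * \<beta>"

lemma dev_const_nonneg: "0 < s \<Longrightarrow> 0 \<le> dev_const s a"
  using jn_const_nonneg[of s a] by (simp add: dev_const_def)

text \<open>The size of the deviation in the exponent s / (s - 1) conjugate to \<open>s\<close>, as
  it enters Hoelder's inequality; the factor 2 again comes from the width of a level.\<close>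

definition level_const :: "real \<Rightarrow> nat \<Rightarrow> real" where
  "level_const s a = (2 * dev_const (s / (s - 1)) a) powr (1 - 1 / s)"

end

context rbmo
begin

text \<open>Layer-cake summation of \<open>john_nirenberg\<close> in steps of its increment; the
  halving beats the factor \<open>(real m + 1) powr s\<close>.\<close>

lemma john_nirenberg_Lp:
  assumes s: "0 < s"
  shows "(\<integral>\<^sup>+y\<in>ball x (pow6 k). ennreal (norm (b y - c k x) powr s) \<partial>\<mu>)
          \<le> ennreal (jn_const s a * D powr s * L k x)"
proof -
  define \<Lambda> where "\<Lambda> = jn_level a * D + 2 * (near_const * D)"
  have \<Lambda>: "0 < \<Lambda>" using jn_level_pos near_const_ge D_pos by (auto simp: \<Lambda>_def intro!: add_pos_nonneg)
  define S where "S m = {y \<in> ball x (pow6 k). real m * \<Lambda> < norm (b y - c k x)}" for m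
  have S [measurable]: "S m \<in> sets \<mu>" for m
  proof -
    have "{y \<in> space \<mu>. y \<in> ball x (pow6 k) \<and> real m * \<Lambda> < norm (b y - c k x)} \<in> sets \<mu>" by measurable
    then show ?thesis by (simp add: S_def)
  qed
  define w where "w = V (k + int a + 1) x"
  have w: "0 \<le> w" by (simp add: w_def)
  have "(\<integral>\<^sup>+y\<in>ball x (pow6 k). ennreal (norm (b y - c k x) powr s) \<partial>\<mu>) \<le>
     (\<integral>\<^sup>+y. (\<Sum>m. ennreal (((real m + 1) * \<Lambda>) powr s) * indicator (S m) y) \<partial>\<mu>)"
  proof (rule nn_integral_mono)
    fix y
    let ?u = "norm (b y - c k x)"
    show "ennreal (?u powr s) * indicator (ball x (pow6 k)) y \<le>
       (\<Sum>m. ennreal (((real m + 1) * \<Lambda>) powr s) * indicator (S m) y)"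
    proof (cases "y \<in> ball x (pow6 k) \<and> 0 < ?u")
      case True
      define m where "m = nat (\<lceil>?u / \<Lambda>\<rceil> - 1)"
      have pos: "0 < ?u / \<Lambda>" using True \<Lambda> by simp
      then have ceil: "0 < \<lceil>?u / \<Lambda>\<rceil>" by simp
      have rm: "real m = of_int \<lceil>?u / \<Lambda>\<rceil> - 1" unfolding m_def using ceil by simp
      have "real m < ?u / \<Lambda>" "?u / \<Lambda> \<le> real m + 1" unfolding rm by linarith+
      then have m: "real m * \<Lambda> < ?u" "?u \<le> (real m + 1) * \<Lambda>" using \<Lambda> by (simp_all add: field_simps)
      have "ennreal (?u powr s) * indicator (ball x (pow6 k)) y = ennreal (?u powr s)" using True by simp
      also have "\<dots> \<le> ennreal (((real m + 1) * \<Lambda>) powr s)" using m s by (intro ennreal_leI powr_mono2) auto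
      also have "\<dots> = ennreal (((real m + 1) * \<Lambda>) powr s) * indicator (S m) y"
        using True m by (simp add: S_def)
      also have "\<dots> \<le> (\<Sum>m. ennreal (((real m + 1) * \<Lambda>) powr s) * indicator (S m) y)"
        by (rule ennreal_le_suminf)
      finally show ?thesis .
    next
      case False
      then have eq0: "ennreal (?u powr s) * indicator (ball x (pow6 k)) y = 0" by (auto simp: indicator_def)
      show ?thesis unfolding eq0 by (rule zero_le)
    qed
  qed
  also have "\<dots> = (\<Sum>m. \<integral>\<^sup>+y. ennreal (((real m + 1) * \<Lambda>) powr s) * indicator (S m) y \<partial>\<mu>)"
    by (rule nn_integral_suminf) measurable
  also have "\<dots> \<le> (\<Sum>m. ennreal ((\<Lambda> powr s * w * powr_geo_const s) * (3/4) ^ m))"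
  proof (intro suminf_le allI)
    fix m
    have "(\<integral>\<^sup>+y. ennreal (((real m + 1) * \<Lambda>) powr s) * indicator (S m) y \<partial>\<mu>) =
        ennreal (((real m + 1) * \<Lambda>) powr s) * emeasure \<mu> (S m)"
      by (rule nn_integral_cmult_indicator) (rule S)
    also have "\<dots> \<le> ennreal (((real m + 1) * \<Lambda>) powr s) * ennreal ((1/2) ^ m * w)"
      unfolding S_def \<Lambda>_def w_def by (intro mult_left_mono john_nirenberg) simp
    also have "\<dots> = ennreal (\<Lambda> powr s * w * ((real m + 1) powr s * (1/2) ^ m))"
      using \<Lambda> w by (simp add: ennreal_mult[symmetric] powr_mult mult_ac)
    also have "\<dots> \<le> ennreal (\<Lambda> powr s * w * (powr_geo_const s * (3/4) ^ m))"
      using w by (intro ennreal_leI mult_left_mono powr_geo_const(2) s) auto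
    finally show "(\<integral>\<^sup>+y. ennreal (((real m + 1) * \<Lambda>) powr s) * indicator (S m) y \<partial>\<mu>) \<le>
       ennreal ((\<Lambda> powr s * w * powr_geo_const s) * (3/4) ^ m)" by (simp add: mult_ac)
  qed auto
  also have "\<dots> = ennreal (\<Lambda> powr s * w * powr_geo_const s / (1 - 3/4))"
    using w powr_geo_const(1)[OF s] by (intro suminf_ennreal_geometric) auto
  also have "\<dots> \<le> ennreal (jn_const s a * D powr s * L k x)"
  proof (rule ennreal_leI)
    have "w = V (k + int (a + 1)) x" unfolding w_def by (simp add: add_ac)
    also have "\<dots> \<le> \<beta> ^ (a + 1) * L k x" using V_le_L L_add_le by (rule order.trans)
    finally have "w \<le> \<beta> ^ (a + 1) * L k x" .
    then have *: "4 * powr_geo_const s * \<Lambda> powr s * w \<le> 4 * powr_geo_const s * \<Lambda> powr s * (\<beta> ^ (a + 1) * L k x)"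
      using powr_geo_const(1)[OF s] by (intro mult_left_mono) auto
    have "\<Lambda> powr s = (jn_level a + 2 * near_const) powr s * D powr s"
    proof -
      have "\<Lambda> = (jn_level a + 2 * near_const) * D" by (simp add: \<Lambda>_def algebra_simps)
      then show ?thesis using jn_level_pos[of a] near_const_ge D_pos by (simp add: powr_mult)
    qed
    with * show "\<Lambda> powr s * w * powr_geo_const s / (1 - 3/4) \<le> jn_const s a * D powr s * L k x"
      by (simp add: jn_const_def mult_ac)
  qed
  finally show ?thesis .
qed

text \<open>The added multiple of \<open>D\<close> is the price, in \<open>level_bound\<close>, for
  using one constant \<open>c K x\<close> on a whole level.\<close>

lemma dev_Lp:
  assumes s: "0 < s"
  shows "(\<integral>\<^sup>+y\<in>ball x (pow6 (k + 1)). ennreal ((norm (b y - c k x) + (level_gap a + near_const) * D) powr s) \<partial>\<mu>)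
          \<le> ennreal (dev_const s a * D powr s * L k x)"
proof -
  define e where "e = near_const + (level_gap a + near_const)"
  have e: "0 \<le> e" "0 \<le> level_gap a + near_const" using near_const_ge level_gap_nonneg[of a] by (auto simp: e_def)
  have "(\<integral>\<^sup>+y\<in>ball x (pow6 (k + 1)). ennreal ((norm (b y - c k x) + (level_gap a + near_const) * D) powr s) \<partial>\<mu>)
    \<le> (\<integral>\<^sup>+y. ennreal (2 powr s) * (ennreal (norm (b y - c (k + 1) x) powr s) * indicator (ball x (pow6 (k + 1))) y)
        + ennreal (2 powr s * (e * D) powr s) * indicator (ball x (pow6 (k + 1))) y \<partial>\<mu>)"
  proof (rule nn_integral_mono)
    fix y
    have "norm (b y - c k x) \<le> norm (b y - c (k + 1) x) + near_const * D"
      using norm_triangle_ineq[of "b y - c (k + 1) x" "c (k + 1) x - c k x"] c_Suc[of k x]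
      by (simp add: norm_minus_commute)
    then have "norm (b y - c k x) + (level_gap a + near_const) * D \<le> norm (b y - c (k + 1) x) + e * D"
      by (simp add: e_def algebra_simps)
    then have "(norm (b y - c k x) + (level_gap a + near_const) * D) powr s \<le> (norm (b y - c (k + 1) x) + e * D) powr s"
      using e s D_nonneg by (intro powr_mono2) auto
    also have "\<dots> \<le> 2 powr s * (norm (b y - c (k + 1) x) powr s + (e * D) powr s)"
      using e s D_nonneg by (intro powr_add_le) auto
    finally have "ennreal ((norm (b y - c k x) + (level_gap a + near_const) * D) powr s) \<le>
       ennreal (2 powr s * (norm (b y - c (k + 1) x) powr s + (e * D) powr s))" by (rule ennreal_leI)
    also have "\<dots> = ennreal (2 powr s) * ennreal (norm (b y - c (k + 1) x) powr s) + ennreal (2 powr s * (e * D) powr s)"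
      by (simp add: distrib_left ennreal_mult[symmetric] ennreal_plus[symmetric] del: ennreal_plus)
    finally show "ennreal ((norm (b y - c k x) + (level_gap a + near_const) * D) powr s) * indicator (ball x (pow6 (k + 1))) y \<le>
       ennreal (2 powr s) * (ennreal (norm (b y - c (k + 1) x) powr s) * indicator (ball x (pow6 (k + 1))) y)
        + ennreal (2 powr s * (e * D) powr s) * indicator (ball x (pow6 (k + 1))) y"
      by (auto simp: indicator_def)
  qed
  also have "\<dots> = ennreal (2 powr s) * (\<integral>\<^sup>+y\<in>ball x (pow6 (k + 1)). ennreal (norm (b y - c (k + 1) x) powr s) \<partial>\<mu>)
      + ennreal (2 powr s * (e * D) powr s) * ennreal (V (k + 1) x)"
    by (subst nn_integral_add) (auto simp: nn_integral_cmult emeasure_V)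
  also have "\<dots> \<le> ennreal (2 powr s) * ennreal (jn_const s a * D powr s * L (k + 1) x)
      + ennreal (2 powr s * (e * D) powr s) * ennreal (L (k + 1) x)"
    by (intro add_mono mult_left_mono john_nirenberg_Lp s ennreal_leI V_le_L) auto
  also have "\<dots> = ennreal (2 powr s * (jn_const s a + e powr s) * D powr s * L (k + 1) x)"
    using jn_const_nonneg[OF s, of a] e D_nonneg
    by (simp add: ennreal_mult[symmetric] ennreal_plus[symmetric] powr_mult algebra_simps del: ennreal_plus)
  also have "\<dots> \<le> ennreal (2 powr s * (jn_const s a + e powr s) * D powr s * (\<beta> * L k x))"
    using jn_const_nonneg[OF s, of a] by (intro ennreal_leI mult_left_mono L_Suc_le) auto
  also have "\<dots> = ennreal (dev_const s a * D powr s * L k x)" by (simp add: dev_const_def e_def mult_ac)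
  finally show ?thesis .
qed

text \<open>On scales where \<open>L\<close> is nearly constant the measure of the ball is comparable to \<open>L\<close>, so the first
  \<open>RBMO\<close> condition alone compares the constants, with no loss in the number of scales.\<close>
lemma c_same_level:
  assumes "t \<le> L k x" "L K x < 2 * t" "k \<le> K" "0 < t"
  shows "norm (c k x - c K x) \<le> level_gap a * D"
proof (cases "k = K")
  case True
  then show ?thesis using level_gap_nonneg D_nonneg by simp
next
  case False
  \<comment> \<open>A non-doubling scale would multiply \<open>L\<close> by \<beta>, more than the
    width 2 of the level allows.\<close>
  have dk: "dbl k x"
  proof (rule ccontr)
    assume "\<not> dbl k x"
    then have "\<beta> * L k x = L (k + 1) x" by (simp add: L_not_dbl)
    also have "\<dots> \<le> L K x" using False assms by (intro L_mono) auto
    also have "\<dots> < 2 * L k x" using assms by simp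
    finally have "\<beta> < 2" by simp
    then show False using beta_gt_6 by simp
  qed
  have Vk: "t \<le> V k x" using dk assms by (simp add: dbl_def)
  have Vk0: "0 < V k x" using Vk assms by simp
  have "ennreal (norm (c k x - c K x) * V k x) \<le> (\<integral>\<^sup>+y\<in>ball x (pow6 k). ennreal (norm (b y - c K x)) \<partial>\<mu>)"
    using dk ball_mean_deviation_V[OF locb Vk0, of "c K x"] by (simp add: c_def next_dbl_dbl)
  also have "\<dots> \<le> (\<integral>\<^sup>+y\<in>ball x (pow6 K). ennreal (norm (b y - c K x)) \<partial>\<mu>)"
    using subset_ball[OF pow6_mono[OF assms(3)], of x]
    by (intro nn_integral_mono mult_left_mono) (auto simp: indicator_def)
  also have "\<dots> \<le> ennreal ((2 + ratio_sum) * D * V (K + int a) x)" by (rule osc_c)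
  finally have "norm (c k x - c K x) * V k x \<le> (2 + ratio_sum) * D * V (K + int a) x"
    using D_nonneg by (subst (asm) ennreal_le_iff) auto
  moreover have "V (K + int a) x \<le> \<beta> ^ a * (2 * t)"
  proof -
    have "V (K + int a) x \<le> \<beta> ^ a * L K x" using V_le_L L_add_le by (rule order.trans)
    also have "\<dots> \<le> \<beta> ^ a * (2 * t)" using assms by (intro mult_left_mono) auto
    finally show ?thesis .
  qed
  ultimately have "norm (c k x - c K x) * V k x \<le> (2 + ratio_sum) * D * (\<beta> ^ a * (2 * t))"
    using D_nonneg by (meson ratio_sum_nonneg add_nonneg_nonneg mult_left_mono mult_nonneg_nonneg order.trans zero_le_numeral)
  also have "\<dots> = level_gap a * D * t" by (simp add: level_gap_def)
  also have "\<dots> \<le> level_gap a * D * V k x" using Vk level_gap_nonneg D_nonneg by (intro mult_left_mono) auto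
  finally show ?thesis using Vk0 by simp
qed

lemma measurable_c_lev [measurable]: "(\<lambda>y. c (lev x y) x) \<in> borel_measurable \<mu>"
proof -
  have "(\<lambda>y. lev x y) \<in> measurable \<mu> (count_space UNIV)"
    using measurable_Pair2[OF measurable_lev, of x] by simp
  then show ?thesis by (rule measurable_compose) simp
qed

lemma measurable_lev2 [measurable]: "lev x \<in> measurable \<mu> (count_space UNIV)"
  using measurable_Pair2[OF measurable_lev, of x] by simp

lemma measurable_L_lev [measurable]: "(\<lambda>y. L (lev x y) x) \<in> borel_measurable \<mu>"
  by (rule measurable_compose[OF measurable_lev2]) simp

text \<open>The summand \<open>near_const * D\<close> absorbs the difference of \<open>c k x\<close>
  and \<open>c k y\<close> in \<open>b_diff_le\<close>. It also keeps \<open>osc\<close> bounded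
  below, so that finiteness of \<open>hop\<close> implies absolute convergence of the fractional
  integral.\<close>

definition osc :: "'a \<Rightarrow> 'a \<Rightarrow> real" where
  "osc x y = norm (b y - c (lev x y) x) + near_const * D"

lemma osc_nonneg: "0 \<le> osc x y" using near_const_ge D_nonneg by (simp add: osc_def)

lemma measurable_osc [measurable]: "osc x \<in> borel_measurable \<mu>"
  unfolding osc_def[abs_def] by measurable

text \<open>Points are grouped by the size of \<open>L\<close> at the scale of their distance from
  x, so one level may contain arbitrarily many dyadic annuli.\<close>

definition level :: "'a \<Rightarrow> real \<Rightarrow> 'a set" where
  "level x t = {y. y \<noteq> x \<and> t \<le> L (lev x y) x \<and> L (lev x y) x < 2 * t}"

lemma sets_level [measurable]: "level x t \<in> sets \<mu>"
proof -
  have "{y \<in> space \<mu>. t \<le> L (lev x y) x \<and> L (lev x y) x < 2 * t} \<in> sets \<mu>" by measurable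
  moreover have "- {x} \<in> sets \<mu>" by simp
  ultimately have "- {x} \<inter> {y \<in> space \<mu>. t \<le> L (lev x y) x \<and> L (lev x y) x < 2 * t} \<in> sets \<mu>" by blast
  also have "- {x} \<inter> {y \<in> space \<mu>. t \<le> L (lev x y) x \<and> L (lev x y) x < 2 * t} = level x t"
    by (auto simp: level_def)
  finally show ?thesis .
qed

text \<open>At the largest scale \<open>K\<close> of the level, \<open>c_same_level\<close> replaces
  all constants by \<open>c K x\<close>, and Hoelder's inequality on one ball finishes. A largest
  scale need not exist (for finite \<mu> the function \<open>L\<close> stays bounded), so scales are
  first cut off at N, uniformly in N.\<close>

lemma level_bound:
  fixes f :: "'a \<Rightarrow> real"
  assumes s: "1 < s" and t: "0 < t" and E: "0 \<le> E"
    and f [measurable]: "f \<in> borel_measurable \<mu>" and f0: "\<And>y. 0 \<le> f y"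
    and fE: "\<And>K. t \<le> L K x \<Longrightarrow> L K x < 2 * t \<Longrightarrow>
        (\<integral>\<^sup>+y\<in>ball x (pow6 (K + 1)). ennreal (f y powr s) \<partial>\<mu>) \<le> ennreal E"
  shows "(\<integral>\<^sup>+y\<in>level x t. ennreal (osc x y * f y) \<partial>\<mu>)
     \<le> ennreal (level_const s a * D * t powr (1 - 1 / s) * E powr (1 / s))" (is "_ \<le> ?R")
proof -
  define s' where "s' = s / (s - 1)"
  have s': "1 < s'" "1 / s' + 1 / s = 1" "1 / s' = 1 - 1 / s" using s by (auto simp: s'_def field_simps)
  define \<Omega> where "\<Omega> N = level x t \<inter> {y \<in> space \<mu>. lev x y \<le> int N}" for N
  have \<Omega> [measurable]: "\<Omega> N \<in> sets \<mu>" for N unfolding \<Omega>_def by measurable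
  have bound: "(\<integral>\<^sup>+y\<in>\<Omega> N. ennreal (osc x y * f y) \<partial>\<mu>) \<le> ?R" for N
  proof (cases "\<exists>k\<le>int N. t \<le> L k x \<and> L k x < 2 * t")
    case False
    then have "\<Omega> N = {}" by (auto simp: \<Omega>_def level_def)
    then show ?thesis by simp
  next
    case True
    then obtain k where k: "k \<le> int N" "t \<le> L k x \<and> L k x < 2 * t" by blast
    obtain K where K: "K \<le> int N" "t \<le> L K x \<and> L K x < 2 * t"
      "\<And>i. K < i \<Longrightarrow> i \<le> int N \<Longrightarrow> \<not> (t \<le> L i x \<and> L i x < 2 * t)"
      by (rule exists_greatest_int[of "\<lambda>k. t \<le> L k x \<and> L k x < 2 * t", OF k(2) k(1)]) blast
    let ?g = "\<lambda>y. norm (b y - c K x) + (level_gap a + near_const) * D"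
    have "(\<integral>\<^sup>+y\<in>\<Omega> N. ennreal (osc x y * f y) \<partial>\<mu>) \<le>
        (\<integral>\<^sup>+y\<in>ball x (pow6 (K + 1)). ennreal (?g y * f y) \<partial>\<mu>)"
    proof (rule nn_integral_mono)
      fix y
      show "ennreal (osc x y * f y) * indicator (\<Omega> N) y \<le> ennreal (?g y * f y) * indicator (ball x (pow6 (K + 1))) y"
      proof (cases "y \<in> \<Omega> N")
        case True
        let ?k = "lev x y"
        have y: "y \<noteq> x" "t \<le> L ?k x" "L ?k x < 2 * t" "?k \<le> int N"
          using True by (auto simp: \<Omega>_def level_def)
        have kK: "?k \<le> K" using K(3)[of ?k] y by force
        have "dist x y < pow6 (?k + 1)" using lev_iff[of x y ?k] y(1) by auto
        also have "\<dots> \<le> pow6 (K + 1)" using kK by (intro pow6_mono) simp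
        finally have yb: "y \<in> ball x (pow6 (K + 1))" by simp
        have "norm (c ?k x - c K x) \<le> level_gap a * D" using y kK K t by (intro c_same_level[of t]) auto
        then have "osc x y \<le> ?g y"
          using norm_triangle_ineq[of "b y - c K x" "c K x - c ?k x"]
          by (simp add: osc_def norm_minus_commute algebra_simps)
        then have "osc x y * f y \<le> ?g y * f y" using f0 by (rule mult_right_mono)
        then show ?thesis using True yb by (simp add: ennreal_leI)
      qed simp
    qed
    also have "\<dots> \<le> ennreal ((dev_const s' a * D powr s' * (2 * t)) powr (1 / s') * E powr (1 / s))"
    proof (rule nn_integral_Holder_set)
      show "(\<integral>\<^sup>+y\<in>ball x (pow6 (K + 1)). ennreal (f y powr s) \<partial>\<mu>) \<le> ennreal E" using K by (intro fE) auto
      have "(\<integral>\<^sup>+y\<in>ball x (pow6 (K + 1)). ennreal (?g y powr s') \<partial>\<mu>) \<le> ennreal (dev_const s' a * D powr s' * L K x)"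
        using s' by (intro dev_Lp) simp
      also have "\<dots> \<le> ennreal (dev_const s' a * D powr s' * (2 * t))"
        using K dev_const_nonneg[of s' a] s' by (intro ennreal_leI mult_left_mono) auto
      finally show "(\<integral>\<^sup>+y\<in>ball x (pow6 (K + 1)). ennreal (?g y powr s') \<partial>\<mu>) \<le> \<dots>" .
      show "0 \<le> ?g y" for y using level_gap_nonneg[of a] near_const_ge D_nonneg by simp
    qed (use s s' E f0 t dev_const_nonneg[of s' a] in auto)
    also have "(dev_const s' a * D powr s' * (2 * t)) powr (1 / s') = level_const s a * D * t powr (1 - 1 / s)"
    proof -
      have "(dev_const s' a * D powr s' * (2 * t)) powr (1 / s') = ((2 * dev_const s' a) * D powr s' * t) powr (1 / s')"
        by (simp add: mult_ac)
      also have "\<dots> = (2 * dev_const s' a) powr (1 / s') * (D powr s') powr (1 / s') * t powr (1 / s')"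
        using dev_const_nonneg[of s' a] s' t by (simp add: powr_mult)
      also have "(D powr s') powr (1 / s') = D"
      proof -
        have "(D powr s') powr (1 / s') = D powr (s' * (1 / s'))" by (rule powr_powr)
        also have "s' * (1 / s') = 1" using s'(1) by simp
        finally show ?thesis using D_pos by simp
      qed
      finally show ?thesis by (simp add: level_const_def s'_def[symmetric] s'(3))
    qed
    finally show ?thesis .
  qed
  define F where "F y = ennreal (osc x y * f y)" for y
  have F [measurable]: "F \<in> borel_measurable \<mu>" unfolding F_def[abs_def] by measurable
  have "(SUP N. emeasure (density \<mu> F) (\<Omega> N)) = emeasure (density \<mu> F) (\<Union>N. \<Omega> N)"
    by (rule SUP_emeasure_incseq) (auto simp: incseq_def \<Omega>_def)
  also have "(\<Union>N. \<Omega> N) = level x t"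
  proof -
    have "\<exists>N. lev x y \<le> int N" for y by (rule exI[of _ "nat (lev x y)"]) simp
    then show ?thesis by (auto simp: \<Omega>_def)
  qed
  finally have "emeasure (density \<mu> F) (level x t) = (SUP N. emeasure (density \<mu> F) (\<Omega> N))" by simp
  also have "\<dots> \<le> ?R"
    by (rule SUP_least) (unfold emeasure_density[OF F \<Omega>], unfold F_def, rule bound)
  finally show ?thesis unfolding emeasure_density[OF F sets_level] unfolding F_def .
qed

end

section \<open>Hedberg's pointwise estimate\<close>

lemma dyadic_cover:
  assumes "0 < (z::real)"
  shows "(\<exists>i. (1/2) ^ Suc i \<le> z \<and> z < 2 * (1/2) ^ Suc i) \<or> (\<exists>i. 2 ^ i \<le> z \<and> z < 2 * 2 ^ i)"
proof -
  define m where "m = \<lfloor>log 2 z\<rfloor>"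
  have m: "2 powr of_int m \<le> z" "z < 2 powr (of_int m + 1)"
    using assms by (simp_all add: m_def powr_le_iff less_powr_iff)
  show ?thesis
  proof (cases "0 \<le> m")
    case True
    define i where "i = nat m"
    have "real_of_int m = real i" using True by (simp add: i_def)
    then have "2 ^ i \<le> z \<and> z < 2 * 2 ^ i" using m by (simp add: powr_realpow powr_add)
    then show ?thesis by blast
  next
    case False
    define i where "i = nat (- m - 1)"
    have mi: "real_of_int m = - real (Suc i)" using False by (simp add: i_def)
    have "(2::real) powr of_int m = (1/2) ^ Suc i" unfolding mi
      by (simp only: powr_minus powr_realpow zero_less_numeral power_one_over inverse_eq_divide)
    moreover have "(2::real) powr (of_int m + 1) = 2 * 2 powr of_int m" by (simp add: powr_add)
    ultimately have "(1/2) ^ Suc i \<le> z \<and> z < 2 * (1/2) ^ Suc i" using m by simp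
    then show ?thesis by blast
  qed
qed

context nhspace
begin

text \<open>The two summands sum geometric series: ratio (1/2)^\<theta> over the levels below a
  threshold, ratio 2^(\<theta> - 1/p) over those above. They converge because 0 < \<theta> <
  1/p.\<close>

definition hop_const :: "real \<Rightarrow> real \<Rightarrow> real \<Rightarrow> nat \<Rightarrow> real" where
  "hop_const \<theta> p s a = level_const s a * (2 * \<beta>) powr (1 / s) * (1/2) powr \<theta> / (1 - (1/2) powr \<theta>)
     + level_const p a / (1 - 2 powr (\<theta> - 1 / p))"

lemma level_const_nonneg: "0 \<le> level_const s a" by (simp add: level_const_def)

lemma hop_const_nonneg: assumes "0 < \<theta>" "\<theta> < 1 / p" shows "0 \<le> hop_const \<theta> p s a"
proof -
  have "(1/2) powr \<theta> < (1/2::real) powr 0" using assms by (intro powr_less_mono') auto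
  moreover have "2 powr (\<theta> - 1 / p) < (2::real) powr 0" using assms by (intro powr_less_mono) auto
  ultimately show ?thesis using level_const_nonneg[of s a] level_const_nonneg[of p a] unfolding hop_const_def
    by (intro add_nonneg_nonneg divide_nonneg_pos mult_nonneg_nonneg) auto
qed

end

context rbmo
begin

text \<open>The half operator obtained from \<open>[b, I]\<close> by replacing \<open>b x - b y\<close> with the deviation at \<open>y\<close> from
  the constant attached to \<open>x\<close>.  The other half is its transpose.\<close>
definition hop :: "real \<Rightarrow> ('a \<Rightarrow> real) \<Rightarrow> 'a \<Rightarrow> ennreal" where
  "hop \<theta> f x = (\<integral>\<^sup>+y\<in>- {x}. ennreal (osc x y * L (lev x y) x powr (\<theta> - 1) * f y) \<partial>\<mu>)"

lemma hop_level:
  fixes f :: "'a \<Rightarrow> real"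
  assumes s: "1 < s" and t: "0 < t" and E: "0 \<le> E" and \<theta>: "\<theta> < 1"
    and f [measurable]: "f \<in> borel_measurable \<mu>" and f0: "\<And>y. 0 \<le> f y"
    and fE: "\<And>K. t \<le> L K x \<Longrightarrow> L K x < 2 * t \<Longrightarrow>
        (\<integral>\<^sup>+y\<in>ball x (pow6 (K + 1)). ennreal (f y powr s) \<partial>\<mu>) \<le> ennreal E"
  shows "(\<integral>\<^sup>+y\<in>level x t. ennreal (osc x y * L (lev x y) x powr (\<theta> - 1) * f y) \<partial>\<mu>)
     \<le> ennreal (level_const s a * D * (t powr (\<theta> - 1 / s) * E powr (1 / s)))"
proof -
  have "(\<integral>\<^sup>+y\<in>level x t. ennreal (osc x y * L (lev x y) x powr (\<theta> - 1) * f y) \<partial>\<mu>) \<le>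
     (\<integral>\<^sup>+y. ennreal (t powr (\<theta> - 1)) * (ennreal (osc x y * f y) * indicator (level x t) y) \<partial>\<mu>)"
  proof (rule nn_integral_mono)
    fix y
    have "osc x y * L (lev x y) x powr (\<theta> - 1) * f y \<le> t powr (\<theta> - 1) * (osc x y * f y)" if "y \<in> level x t"
    proof -
      have "L (lev x y) x powr (\<theta> - 1) \<le> t powr (\<theta> - 1)"
        using that t \<theta> by (intro powr_mono2') (auto simp: level_def)
      then have "L (lev x y) x powr (\<theta> - 1) * (osc x y * f y) \<le> t powr (\<theta> - 1) * (osc x y * f y)"
        using osc_nonneg[of x y] f0[of y] by (intro mult_right_mono) auto
      then show ?thesis by (simp add: mult_ac)
    qed
    then show "ennreal (osc x y * L (lev x y) x powr (\<theta> - 1) * f y) * indicator (level x t) y \<le>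
      ennreal (t powr (\<theta> - 1)) * (ennreal (osc x y * f y) * indicator (level x t) y)"
      using osc_nonneg[of x y] f0[of y] by (auto simp: indicator_def ennreal_mult[symmetric] intro!: ennreal_leI)
  qed
  also have "\<dots> = ennreal (t powr (\<theta> - 1)) * (\<integral>\<^sup>+y\<in>level x t. ennreal (osc x y * f y) \<partial>\<mu>)"
    by (rule nn_integral_cmult) measurable
  also have "\<dots> \<le> ennreal (t powr (\<theta> - 1)) * ennreal (level_const s a * D * t powr (1 - 1 / s) * E powr (1 / s))"
    by (intro mult_left_mono level_bound s t E f f0 fE) auto
  also have "\<dots> = ennreal (level_const s a * D * (t powr (\<theta> - 1 / s) * E powr (1 / s)))"
  proof -
    have "t powr (\<theta> - 1) * t powr (1 - 1 / s) = t powr (\<theta> - 1 / s)"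
      by (simp add: powr_add[symmetric])
    then show ?thesis using level_const_nonneg[of s a] D_nonneg
      by (simp add: ennreal_mult[symmetric] mult_ac)
  qed
  finally show ?thesis .
qed

text \<open>On levels t below a threshold, f is controlled by \<open>u\<close>, which dominates its
  L^s averages at x, with contribution u t^\<theta>; on levels above it, by the L^p bound
  \<open>v\<close>, with contribution v t^(\<theta> - 1/p).\<close>

lemma hop_le:
  fixes f :: "'a \<Rightarrow> real"
  assumes s: "1 < s" and p: "1 < p" and \<theta>: "0 < \<theta>" "\<theta> < 1 / p"
    and f [measurable]: "f \<in> borel_measurable \<mu>" and f0: "\<And>y. 0 \<le> f y"
    and u: "0 < u" and fu: "\<And>K. (\<integral>\<^sup>+y\<in>ball x (pow6 K). ennreal (f y powr s) \<partial>\<mu>) \<le> ennreal (u powr s * L K x)"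
    and v: "0 < v" and fv: "(\<integral>\<^sup>+y. ennreal (f y powr p) \<partial>\<mu>) \<le> ennreal (v powr p)"
  shows "hop \<theta> f x \<le> ennreal (hop_const \<theta> p s a * D * (v powr (p * \<theta>) * u powr (1 - p * \<theta>)))"
proof -
  have "1 / p < 1" using p by simp
  then have \<theta>1: "\<theta> < 1" using \<theta> by linarith
  \<comment> \<open>The level at which u T^\<theta> and v T^(\<theta> - 1/p) agree.\<close>
  define T where "T = (v / u) powr p"
  have T: "0 < T" using u v by (simp add: T_def)
  define r where "r = (1/2::real) powr \<theta>"
  define r2 where "r2 = (2::real) powr (\<theta> - 1 / p)"
  have r: "0 < r" "r < 1" using powr_less_mono'[of "1/2" 0 \<theta>] \<theta> by (auto simp: r_def)
  have r2: "0 < r2" "r2 < 1" using powr_less_mono[of "\<theta> - 1/p" 0 2] \<theta> by (auto simp: r2_def)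
  define F where "F y = ennreal (osc x y * L (lev x y) x powr (\<theta> - 1) * f y)" for y
  have F [measurable]: "F \<in> borel_measurable \<mu>" unfolding F_def[abs_def] by measurable
  have lvl: "emeasure (density \<mu> F) (level x t) = (\<integral>\<^sup>+y\<in>level x t. ennreal (osc x y * L (lev x y) x powr (\<theta> - 1) * f y) \<partial>\<mu>)" for t
    using emeasure_density[OF F sets_level] by (simp add: F_def)
  let ?A = "\<lambda>i. level x (T * (1/2) ^ Suc i)"
  let ?B = "\<lambda>i. level x (T * 2 ^ i)"
  have sets_AB: "range ?A \<subseteq> sets (density \<mu> F)" "range ?B \<subseteq> sets (density \<mu> F)"
    using sets_level by auto
  have small: "emeasure (density \<mu> F) (?A i) \<le>
     ennreal ((level_const s a * D * ((2 * \<beta>) powr (1 / s) * (u * T powr \<theta>)) * r) * r ^ i)" for i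
  proof -
    define t where "t = T * (1/2) ^ Suc i"
    have t: "0 < t" using T by (simp add: t_def)
    have "emeasure (density \<mu> F) (level x t) \<le>
      ennreal (level_const s a * D * (t powr (\<theta> - 1 / s) * (u powr s * (2 * \<beta> * t)) powr (1 / s)))"
      unfolding lvl
    proof (rule hop_level[OF s t _ \<theta>1 f f0])
      fix K assume K: "t \<le> L K x" "L K x < 2 * t"
      have "(\<integral>\<^sup>+y\<in>ball x (pow6 (K + 1)). ennreal (f y powr s) \<partial>\<mu>) \<le> ennreal (u powr s * L (K + 1) x)"
        by (rule fu)
      also have "\<dots> \<le> ennreal (u powr s * (2 * \<beta> * t))"
      proof (intro ennreal_leI mult_left_mono)
        have "L (K + 1) x \<le> \<beta> * L K x" by (rule L_Suc_le)
        also have "\<dots> \<le> \<beta> * (2 * t)" using K by (intro mult_left_mono) auto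
        finally show "L (K + 1) x \<le> 2 * \<beta> * t" by simp
      qed simp
      finally show "(\<integral>\<^sup>+y\<in>ball x (pow6 (K + 1)). ennreal (f y powr s) \<partial>\<mu>) \<le> ennreal (u powr s * (2 * \<beta> * t))" .
    qed (use t u in simp)
    also have "t powr (\<theta> - 1 / s) * (u powr s * (2 * \<beta> * t)) powr (1 / s) =
       (2 * \<beta>) powr (1 / s) * (u * t powr \<theta>)"
    proof -
      have "(u powr s * (2 * \<beta> * t)) powr (1 / s) = u powr (s * (1 / s)) * (2 * \<beta>) powr (1 / s) * t powr (1 / s)"
        using t u by (simp add: powr_mult powr_powr)
      also have "s * (1 / s) = 1" using s by simp
      finally have 1: "(u powr s * (2 * \<beta> * t)) powr (1 / s) = u * (2 * \<beta>) powr (1 / s) * t powr (1 / s)"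
        using u by simp
      have "t powr (\<theta> - 1 / s) * t powr (1 / s) = t powr \<theta>" by (simp add: powr_add[symmetric])
      then show ?thesis unfolding 1 by (simp add: mult_ac)
    qed
    also have "t powr \<theta> = T powr \<theta> * (r * r ^ i)"
      using T by (simp add: t_def r_def powr_mult powr_power powr_realpow[symmetric] powr_powr powr_add[symmetric] algebra_simps
         del: power_Suc powr_numeral)
    finally show ?thesis by (simp add: t_def mult_ac)
  qed
  have large: "emeasure (density \<mu> F) (?B i) \<le>
     ennreal ((level_const p a * D * (v * T powr (\<theta> - 1 / p))) * r2 ^ i)" for i
  proof -
    define t where "t = T * 2 ^ i"
    have t: "0 < t" using T by (simp add: t_def)
    have "emeasure (density \<mu> F) (level x t) \<le>
      ennreal (level_const p a * D * (t powr (\<theta> - 1 / p) * (v powr p) powr (1 / p)))"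
      unfolding lvl
    proof (rule hop_level[OF p t _ \<theta>1 f f0])
      fix K
      have "(\<integral>\<^sup>+y\<in>ball x (pow6 (K + 1)). ennreal (f y powr p) \<partial>\<mu>) \<le> (\<integral>\<^sup>+y. ennreal (f y powr p) \<partial>\<mu>)"
        by (intro nn_integral_mono) (auto simp: indicator_def)
      also have "\<dots> \<le> ennreal (v powr p)" by (rule fv)
      finally show "(\<integral>\<^sup>+y\<in>ball x (pow6 (K + 1)). ennreal (f y powr p) \<partial>\<mu>) \<le> ennreal (v powr p)" .
    qed simp
    also have "(v powr p) powr (1 / p) = v" using v p by (simp add: powr_powr)
    also have "t powr (\<theta> - 1 / p) = T powr (\<theta> - 1 / p) * r2 ^ i"
      using T by (simp add: t_def r2_def powr_mult powr_power powr_realpow[symmetric] powr_powr mult.commute)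
    finally show ?thesis by (simp add: t_def mult_ac)
  qed
  have cover: "- {x} \<subseteq> (\<Union>i. ?A i) \<union> (\<Union>i. ?B i)"
  proof
    fix y assume "y \<in> - {x}"
    then have y: "y \<noteq> x" by simp
    define z where "z = L (lev x y) x / T"
    have Lz: "L (lev x y) x = T * z" using T by (simp add: z_def)
    have z: "0 < z" using T by (simp add: z_def)
    from dyadic_cover[OF z] show "y \<in> (\<Union>i. ?A i) \<union> (\<Union>i. ?B i)"
    proof
      assume "\<exists>i. (1/2) ^ Suc i \<le> z \<and> z < 2 * (1/2) ^ Suc i"
      then obtain i where i: "(1/2) ^ Suc i \<le> z" "z < 2 * (1/2) ^ Suc i" by blast
      have "T * (1/2) ^ Suc i \<le> T * z" "T * z < T * (2 * (1/2) ^ Suc i)"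
        using i T by (intro mult_left_mono mult_strict_left_mono; simp)+
      then have "y \<in> ?A i" using y by (simp add: level_def Lz)
      then show ?thesis by blast
    next
      assume "\<exists>i. 2 ^ i \<le> z \<and> z < 2 * 2 ^ i"
      then obtain i where i: "2 ^ i \<le> z" "z < 2 * 2 ^ i" by blast
      have "T * 2 ^ i \<le> T * z" "T * z < T * (2 * 2 ^ i)"
        using i T by (intro mult_left_mono mult_strict_left_mono; simp)+
      then have "y \<in> ?B i" using y by (simp add: level_def Lz)
      then show ?thesis by blast
    qed
  qed
  have "hop \<theta> f x = emeasure (density \<mu> F) (- {x})"
  proof -
    have "- {x} \<in> sets \<mu>" by simp
    from emeasure_density[OF F this] show ?thesis by (simp add: hop_def F_def)
  qed
  also have "\<dots> \<le> emeasure (density \<mu> F) ((\<Union>i. ?A i) \<union> (\<Union>i. ?B i))"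
    using sets_AB by (intro emeasure_mono cover sets.Un sets.countable_UN) auto
  also have "\<dots> \<le> emeasure (density \<mu> F) (\<Union>i. ?A i) + emeasure (density \<mu> F) (\<Union>i. ?B i)"
    using sets_AB by (intro emeasure_subadditive sets.countable_UN) auto
  also have "\<dots> \<le> (\<Sum>i. emeasure (density \<mu> F) (?A i)) + (\<Sum>i. emeasure (density \<mu> F) (?B i))"
    using sets_AB by (intro add_mono emeasure_subadditive_countably)
  also have "\<dots> \<le> (\<Sum>i. ennreal ((level_const s a * D * ((2 * \<beta>) powr (1 / s) * (u * T powr \<theta>)) * r) * r ^ i))
     + (\<Sum>i. ennreal ((level_const p a * D * (v * T powr (\<theta> - 1 / p))) * r2 ^ i))"
    by (intro add_mono suminf_le small large) auto
  also have "\<dots> = ennreal ((level_const s a * D * ((2 * \<beta>) powr (1 / s) * (u * T powr \<theta>)) * r) / (1 - r))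
     + ennreal ((level_const p a * D * (v * T powr (\<theta> - 1 / p))) / (1 - r2))"
    using level_const_nonneg[of s a] level_const_nonneg[of p a] D_nonneg u v r r2
    by (subst (1 2) suminf_ennreal_geometric) auto
  also have "\<dots> = ennreal ((level_const s a * D * ((2 * \<beta>) powr (1 / s) * (u * T powr \<theta>)) * r) / (1 - r)
     + (level_const p a * D * (v * T powr (\<theta> - 1 / p))) / (1 - r2))"
    using level_const_nonneg[of s a] level_const_nonneg[of p a] D_nonneg u v r r2
    by (intro ennreal_plus[symmetric]) auto
  also have "u * T powr \<theta> = v powr (p * \<theta>) * u powr (1 - p * \<theta>)"
  proof -
    have "T powr \<theta> = v powr (p * \<theta>) / u powr (p * \<theta>)"
      using u v by (simp add: T_def powr_powr powr_divide)
    moreover have "u powr (1 - p * \<theta>) = u / u powr (p * \<theta>)" using u by (simp add: powr_diff)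
    ultimately show ?thesis by simp
  qed
  also have "v * T powr (\<theta> - 1 / p) = v powr (p * \<theta>) * u powr (1 - p * \<theta>)"
  proof -
    have e: "p * (\<theta> - 1 / p) = p * \<theta> - 1" using p by (simp add: right_diff_distrib)
    have "T powr (\<theta> - 1 / p) = (v / u) powr (p * \<theta> - 1)"
      unfolding T_def powr_powr e ..
    also have "\<dots> = v powr (p * \<theta> - 1) * u powr (1 - p * \<theta>)"
      using u v by (simp add: powr_divide powr_minus_divide[of u "p * \<theta> - 1", simplified])
    finally have "v * T powr (\<theta> - 1 / p) = (v powr 1 * v powr (p * \<theta> - 1)) * u powr (1 - p * \<theta>)" using v by simp
    also have "v powr 1 * v powr (p * \<theta> - 1) = v powr (p * \<theta>)" by (simp only: powr_add[symmetric]) simp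
    finally show ?thesis .
  qed
  also have "(level_const s a * D * ((2 * \<beta>) powr (1 / s) * (v powr (p * \<theta>) * u powr (1 - p * \<theta>))) * r) / (1 - r)
     + (level_const p a * D * (v powr (p * \<theta>) * u powr (1 - p * \<theta>))) / (1 - r2)
     = hop_const \<theta> p s a * D * (v powr (p * \<theta>) * u powr (1 - p * \<theta>))"
    unfolding hop_const_def r_def[symmetric] r2_def[symmetric] by (simp add: algebra_simps)
  finally show ?thesis .
qed

end

section \<open>The maximal function\<close>

lemma int_geometric_tail:
  fixes J :: int and \<delta> :: real
  assumes "0 < \<delta>"
  shows "(\<integral>\<^sup>+j\<in>{..J}. ennreal (2 powr (\<delta> * of_int j)) \<partial>count_space UNIV)
     = ennreal (2 powr (\<delta> * of_int J) / (1 - (1/2) powr \<delta>))"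
proof -
  have r: "(1/2::real) powr \<delta> < 1" using powr_less_mono'[of "1/2" 0 \<delta>] assms by auto
  have bij: "bij_betw (\<lambda>i. J - int i) UNIV {..J}"
    by (rule bij_betw_byWitness[where f' = "\<lambda>j. nat (J - j)"]) auto
  have "(\<integral>\<^sup>+j\<in>{..J}. ennreal (2 powr (\<delta> * of_int j)) \<partial>count_space UNIV)
     = (\<integral>\<^sup>+j. ennreal (2 powr (\<delta> * of_int j)) \<partial>count_space {..J})"
    by (rule nn_integral_count_space_indicator[symmetric]) simp
  also have "\<dots> = (\<integral>\<^sup>+i. ennreal (2 powr (\<delta> * of_int (J - int i))) \<partial>count_space UNIV)"
    by (rule nn_integral_bij_count_space[OF bij, symmetric])
  also have "\<dots> = (\<Sum>i. ennreal (2 powr (\<delta> * of_int (J - int i))))"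
    by (rule nn_integral_count_space_nat)
  also have "(\<lambda>i. ennreal (2 powr (\<delta> * of_int (J - int i)))) = (\<lambda>i. ennreal (2 powr (\<delta> * of_int J) * ((1/2) powr \<delta>) ^ i))"
  proof
    fix i
    have "((1/2) powr \<delta>) ^ i = ((1/2) powr \<delta>) powr (real i)" by (simp add: powr_realpow)
    also have "\<dots> = (1/2) powr (\<delta> * real i)" by (rule powr_powr)
    also have "\<dots> = 2 powr (- (\<delta> * real i))" by (simp add: powr_divide powr_minus_divide)
    finally have "2 powr (\<delta> * of_int J) * ((1/2) powr \<delta>) ^ i = 2 powr (\<delta> * of_int J + - (\<delta> * real i))"
      by (simp only: powr_add)
    also have "\<delta> * of_int J + - (\<delta> * real i) = \<delta> * of_int (J - int i)" by (simp add: algebra_simps)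
    finally show "ennreal (2 powr (\<delta> * of_int (J - int i))) = ennreal (2 powr (\<delta> * of_int J) * ((1/2) powr \<delta>) ^ i)"
      by simp
  qed
  also have "(\<Sum>i. ennreal (2 powr (\<delta> * of_int J) * ((1/2) powr \<delta>) ^ i)) = ennreal (2 powr (\<delta> * of_int J) / (1 - (1/2) powr \<delta>))"
    using r by (intro suminf_ennreal_geometric) auto
  finally show ?thesis .
qed

context nhspace
begin

text \<open>Dividing by \<open>L\<close> instead of the measure of the ball yields the weak type
  estimate for non-doubling \<mu>, since the six-fold ball has measure at most
  \<open>\<beta> * L k x\<close>.\<close>

definition maximal :: "('a \<Rightarrow> ennreal) \<Rightarrow> 'a \<Rightarrow> ennreal" where
  "maximal g x = (SUP k. (\<integral>\<^sup>+y\<in>ball x (pow6 k). g y \<partial>\<mu>) / ennreal (L k x))"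

lemma measurable_ball_integral [measurable]:
  assumes [measurable]: "g \<in> borel_measurable \<mu>"
  shows "(\<lambda>x. \<integral>\<^sup>+y\<in>ball x r. g y \<partial>\<mu>) \<in> borel_measurable \<mu>"
proof -
  have "(\<lambda>p. g (snd p) * indicator {p. dist (fst p) (snd p) < r} p) \<in> borel_measurable (\<mu> \<Otimes>\<^sub>M \<mu>)"
    using sets_dist_less[of r] by measurable
  then have "(\<lambda>x. \<integral>\<^sup>+y. g y * indicator {p. dist (fst p) (snd p) < r} (x, y) \<partial>\<mu>) \<in> borel_measurable \<mu>"
    using sf.borel_measurable_nn_integral_fst[of "\<lambda>p. g (snd p) * indicator {p. dist (fst p) (snd p) < r} p" \<mu>] by simp
  then show ?thesis by (simp add: indicator_def)
qed

lemma measurable_maximal [measurable]: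
  assumes [measurable]: "g \<in> borel_measurable \<mu>"
  shows "maximal g \<in> borel_measurable \<mu>"
  unfolding maximal_def[abs_def] by measurable

lemma maximal_ge: "(\<integral>\<^sup>+y\<in>ball x (pow6 k). g y \<partial>\<mu>) \<le> maximal g x * ennreal (L k x)"
proof -
  have "(\<integral>\<^sup>+y\<in>ball x (pow6 k). g y \<partial>\<mu>) / ennreal (L k x) \<le> maximal g x"
    unfolding maximal_def by (rule SUP_upper) simp
  then have "(\<integral>\<^sup>+y\<in>ball x (pow6 k). g y \<partial>\<mu>) / ennreal (L k x) * ennreal (L k x) \<le> maximal g x * ennreal (L k x)"
    by (rule mult_right_mono) simp
  then show ?thesis by (simp add: ennreal_divide_times ennreal_times_divide[symmetric])
qed

lemma maximal_weak:
  assumes g [measurable]: "g \<in> borel_measurable \<mu>" and t: "0 < t"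
  shows "emeasure \<mu> {x. ennreal t < maximal g x} \<le> ennreal (\<beta> / t) * (\<integral>\<^sup>+y. g y \<partial>\<mu>)"
proof -
  define E where "E R = {x. \<exists>k\<le>int R. ennreal t < (\<integral>\<^sup>+y\<in>ball x (pow6 k). g y \<partial>\<mu>) / ennreal (L k x)}" for R
  have E_sets: "E R \<in> sets \<mu>" for R
  proof -
    have "{x \<in> space \<mu>. \<exists>k\<le>int R. ennreal t < (\<integral>\<^sup>+y\<in>ball x (pow6 k). g y \<partial>\<mu>) / ennreal (L k x)} \<in> sets \<mu>"
      by measurable
    then show ?thesis by (simp add: E_def)
  qed
  have bound: "emeasure \<mu> (E R) \<le> ennreal (\<beta> / t) * (\<integral>\<^sup>+y. g y \<partial>\<mu>)" for R
  proof -
    define F where "F = {p. snd p \<le> int R \<and> ennreal t < (\<integral>\<^sup>+y\<in>bl p. g y \<partial>\<mu>) / ennreal (L (snd p) (fst p))}"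
    have "\<exists>U\<in>sets \<mu>. (\<Union>p\<in>F. bl p) \<subseteq> U \<and> emeasure \<mu> U \<le> (\<integral>\<^sup>+y\<in>UNIV. (ennreal (\<beta> / t) * g y) \<partial>\<mu>)"
    proof (rule weak_cover[of F "int R"])
      fix p assume p: "p \<in> F"
      show "snd p \<le> int R" using p by (simp add: F_def)
      let ?I = "\<integral>\<^sup>+y\<in>bl p. g y \<partial>\<mu>"
      have "ennreal t * ennreal (L (snd p) (fst p)) \<le> ?I / ennreal (L (snd p) (fst p)) * ennreal (L (snd p) (fst p))"
        using p by (intro mult_right_mono) (auto simp: F_def)
      also have "\<dots> = ?I" by (simp add: ennreal_divide_times ennreal_times_divide[symmetric])
      finally have tI: "ennreal (t * L (snd p) (fst p)) \<le> ?I" using t by (simp add: ennreal_mult)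
      have "V (snd p + 1) (fst p) \<le> \<beta> * L (snd p) (fst p)" using V_le_L L_Suc_le by (rule order.trans)
      also have "\<dots> = \<beta> / t * (t * L (snd p) (fst p))" using t by simp
      finally have "ennreal (V (snd p + 1) (fst p)) \<le> ennreal (\<beta> / t * (t * L (snd p) (fst p)))" by (rule ennreal_leI)
      also have "\<dots> = ennreal (\<beta> / t) * ennreal (t * L (snd p) (fst p))" using t by (intro ennreal_mult) auto
      also have "\<dots> \<le> ennreal (\<beta> / t) * ?I" by (intro mult_left_mono tI) simp
      also have "\<dots> = (\<integral>\<^sup>+y\<in>bl p. (ennreal (\<beta> / t) * g y) \<partial>\<mu>)"
        by (subst nn_integral_cmult[symmetric]) (auto simp: mult.assoc)
      finally show "ennreal (V (snd p + 1) (fst p)) \<le> (\<integral>\<^sup>+y\<in>bl p. (ennreal (\<beta> / t) * g y) \<partial>\<mu>)" .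
    qed auto
    then obtain U where U: "U \<in> sets \<mu>" "(\<Union>p\<in>F. bl p) \<subseteq> U"
      "emeasure \<mu> U \<le> (\<integral>\<^sup>+y\<in>UNIV. (ennreal (\<beta> / t) * g y) \<partial>\<mu>)" by blast
    have "E R \<subseteq> (\<Union>p\<in>F. bl p)"
    proof
      fix x assume "x \<in> E R"
      then obtain k where k: "k \<le> int R" "ennreal t < (\<integral>\<^sup>+y\<in>ball x (pow6 k). g y \<partial>\<mu>) / ennreal (L k x)"
        by (auto simp: E_def)
      have "(x, k) \<in> F" using k by (simp add: F_def)
      moreover have "x \<in> bl (x, k)" by simp
      ultimately show "x \<in> (\<Union>p\<in>F. bl p)" by (rule UN_I)
    qed
    then have "E R \<subseteq> U" using U(2) by blast
    then have "emeasure \<mu> (E R) \<le> emeasure \<mu> U" using U(1) by (rule emeasure_mono)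
    also have "\<dots> \<le> (\<integral>\<^sup>+y\<in>UNIV. (ennreal (\<beta> / t) * g y) \<partial>\<mu>)" by (rule U(3))
    also have "\<dots> = ennreal (\<beta> / t) * (\<integral>\<^sup>+y. g y \<partial>\<mu>)" by (simp add: nn_integral_cmult)
    finally show ?thesis .
  qed
  have eq: "{x. ennreal t < maximal g x} = (\<Union>R. E R)"
  proof (intro set_eqI iffI)
    fix x assume "x \<in> {x. ennreal t < maximal g x}"
    then obtain k where "ennreal t < (\<integral>\<^sup>+y\<in>ball x (pow6 k). g y \<partial>\<mu>) / ennreal (L k x)"
      by (auto simp: maximal_def less_SUP_iff)
    moreover have "k \<le> int (nat k)" by simp
    ultimately show "x \<in> (\<Union>R. E R)" unfolding E_def by blast
  next
    fix x assume "x \<in> (\<Union>R. E R)"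
    then show "x \<in> {x. ennreal t < maximal g x}" by (auto simp: E_def maximal_def less_SUP_iff)
  qed
  have "emeasure \<mu> (\<Union>R. E R) = (SUP R. emeasure \<mu> (E R))"
  proof (intro SUP_emeasure_incseq[symmetric])
    show "range E \<subseteq> sets \<mu>" using E_sets by blast
    have "E m \<subseteq> E n" if "m \<le> n" for m n
    proof
      fix x assume "x \<in> E m"
      then obtain k where "k \<le> int m" "ennreal t < (\<integral>\<^sup>+y\<in>ball x (pow6 k). g y \<partial>\<mu>) / ennreal (L k x)"
        unfolding E_def by blast
      moreover have "int m \<le> int n" using that by simp
      ultimately show "x \<in> E n" unfolding E_def by (intro CollectI exI[of _ k]) simp
    qed
    then show "incseq E" by (simp add: incseq_def)
  qed
  also have "\<dots> \<le> ennreal (\<beta> / t) * (\<integral>\<^sup>+y. g y \<partial>\<mu>)" by (intro SUP_least bound)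
  finally show ?thesis unfolding eq .
qed

lemma maximal_bounded: assumes "\<And>y. g y \<le> ennreal t" "0 \<le> t" shows "maximal g x \<le> ennreal t"
  unfolding maximal_def
proof (rule SUP_least)
  fix k
  have "(\<integral>\<^sup>+y\<in>ball x (pow6 k). g y \<partial>\<mu>) \<le> (\<integral>\<^sup>+y. ennreal t * indicator (ball x (pow6 k)) y \<partial>\<mu>)"
    by (intro nn_integral_mono mult_right_mono assms) simp
  also have "\<dots> = ennreal t * ennreal (V k x)" by (simp add: nn_integral_cmult emeasure_V)
  also have "\<dots> \<le> ennreal t * ennreal (L k x)" by (intro mult_left_mono ennreal_leI V_le_L) simp
  finally have "(\<integral>\<^sup>+y\<in>ball x (pow6 k). g y \<partial>\<mu>) / ennreal (L k x) \<le> ennreal t * ennreal (L k x) / ennreal (L k x)"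
    by (rule divide_right_mono_ennreal)
  also have "\<dots> = ennreal t" using assms(2) by (simp add: ennreal_mult[symmetric] divide_ennreal)
  finally show "(\<integral>\<^sup>+y\<in>ball x (pow6 k). g y \<partial>\<mu>) / ennreal (L k x) \<le> ennreal t" .
qed

lemma maximal_add: assumes [measurable]: "f \<in> borel_measurable \<mu>" "g \<in> borel_measurable \<mu>"
  shows "maximal (\<lambda>y. f y + g y) x \<le> maximal f x + maximal g x"
  unfolding maximal_def
proof (rule SUP_least)
  fix k
  have "(\<integral>\<^sup>+y\<in>ball x (pow6 k). (f y + g y) \<partial>\<mu>) / ennreal (L k x) =
     (\<integral>\<^sup>+y\<in>ball x (pow6 k). f y \<partial>\<mu>) / ennreal (L k x) + (\<integral>\<^sup>+y\<in>ball x (pow6 k). g y \<partial>\<mu>) / ennreal (L k x)"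
    by (simp add: distrib_right nn_integral_add divide_ennreal_def)
  also have "\<dots> \<le> (SUP k. (\<integral>\<^sup>+y\<in>ball x (pow6 k). f y \<partial>\<mu>) / ennreal (L k x)) + (SUP k. (\<integral>\<^sup>+y\<in>ball x (pow6 k). g y \<partial>\<mu>) / ennreal (L k x))"
    by (intro add_mono SUP_upper) auto
  finally show "(\<integral>\<^sup>+y\<in>ball x (pow6 k). (f y + g y) \<partial>\<mu>) / ennreal (L k x) \<le> \<dots>" .
qed

text \<open>The part of g below height t has maximal function at most t, so only the part above t
  can push the maximal function beyond 2t.\<close>

lemma maximal_weak_truncated:
  assumes g [measurable]: "g \<in> borel_measurable \<mu>" and t: "0 < t"
  shows "emeasure \<mu> {x. ennreal (2 * t) < maximal g x} \<le> ennreal (\<beta> / t) * (\<integral>\<^sup>+y\<in>{y. ennreal t < g y}. g y \<partial>\<mu>)"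
proof -
  define S where "S = {y. ennreal t < g y}"
  have S [measurable]: "S \<in> sets \<mu>"
  proof -
    have "{y \<in> space \<mu>. ennreal t < g y} \<in> sets \<mu>" by measurable
    then show ?thesis by (simp add: S_def)
  qed
  let ?f = "\<lambda>y. g y * indicator S y" and ?h = "\<lambda>y. g y * indicator (- S) y"
  have mS [measurable]: "- S \<in> sets \<mu>" using S by (metis Compl_eq_Diff_UNIV sets.compl_sets space_mu)
  have g_eq: "g = (\<lambda>y. ?f y + ?h y)" by (auto simp: indicator_def)
  have h: "?h y \<le> ennreal t" for y by (auto simp: S_def indicator_def)
  have "maximal g x \<le> maximal ?f x + ennreal t" for x
  proof -
    have "maximal g x = maximal (\<lambda>y. ?f y + ?h y) x" using g_eq by simp
    also have "\<dots> \<le> maximal ?f x + maximal ?h x" by (rule maximal_add) measurable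
    also have "maximal ?h x \<le> ennreal t" using h t by (intro maximal_bounded) auto
    finally show ?thesis by (simp add: add_left_mono)
  qed
  then have "{x. ennreal (2 * t) < maximal g x} \<subseteq> {x. ennreal t < maximal ?f x}"
  proof (intro subsetI CollectI)
    fix x assume le: "\<And>x. maximal g x \<le> maximal ?f x + ennreal t" and "x \<in> {x. ennreal (2 * t) < maximal g x}"
    have "ennreal t + ennreal t = ennreal (2 * t)" using t by (simp add: ennreal_plus[symmetric] del: ennreal_plus)
    also have "\<dots> < maximal g x" using \<open>x \<in> {x. ennreal (2 * t) < maximal g x}\<close> by simp
    also have "\<dots> \<le> maximal ?f x + ennreal t" by (rule le)
    finally have "ennreal t + ennreal t < maximal ?f x + ennreal t" .
    then show "ennreal t < maximal ?f x" by (metis add_right_mono leD leI)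
  qed
  moreover have "{x. ennreal t < maximal ?f x} \<in> sets \<mu>"
  proof -
    have "{x \<in> space \<mu>. ennreal t < maximal ?f x} \<in> sets \<mu>" by measurable
    then show ?thesis by simp
  qed
  ultimately have "emeasure \<mu> {x. ennreal (2 * t) < maximal g x} \<le> emeasure \<mu> {x. ennreal t < maximal ?f x}"
    by (rule emeasure_mono)
  also have "\<dots> \<le> ennreal (\<beta> / t) * (\<integral>\<^sup>+y\<in>S. g y \<partial>\<mu>)" using t by (intro maximal_weak) measurable
  finally show ?thesis by (simp add: S_def)
qed

definition maximal_const :: "real \<Rightarrow> real" where
  "maximal_const r = \<beta> * 16 powr r * 2 / (1 - (1/2) powr (r - 1))"

lemma maximal_const_nonneg: assumes "1 < r" shows "0 \<le> maximal_const r"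
proof -
  have "(1/2::real) powr (r - 1) < 1" using powr_less_mono'[of "1/2" 0 "r - 1"] assms by auto
  then show ?thesis by (simp add: maximal_const_def)
qed

text \<open>Marcinkiewicz interpolation, summed over the heights 2^j with j an integer. Stating it
  for a real function \<open>w\<close> below the maximal function makes it applicable before the
  latter is known to be finite almost everywhere.\<close>

lemma maximal_strong:
  fixes g w :: "'a \<Rightarrow> real"
  assumes r: "1 < r" and g [measurable]: "g \<in> borel_measurable \<mu>" and g0: "\<And>y. 0 \<le> g y"
    and w [measurable]: "w \<in> borel_measurable \<mu>" and w0: "\<And>x. 0 \<le> w x"
    and wM: "\<And>x. ennreal (w x) \<le> maximal (\<lambda>y. ennreal (g y)) x"
  shows "(\<integral>\<^sup>+x. ennreal (w x powr r) \<partial>\<mu>) \<le> ennreal (maximal_const r) * (\<integral>\<^sup>+x. ennreal (g x powr r) \<partial>\<mu>)"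
proof -
  let ?M = "maximal (\<lambda>y. ennreal (g y))"
  define P where "P j = (2::real) powr (of_int j)" for j :: int
  have P: "0 < P j" for j by (simp add: P_def)
  define A where "A j = {x. ennreal (2 * P j) < ?M x}" for j
  define S where "S j = {y. ennreal (P j) < ennreal (g y)}" for j
  have A [measurable]: "A j \<in> sets \<mu>" for j
  proof -
    have "{x \<in> space \<mu>. ennreal (2 * P j) < ?M x} \<in> sets \<mu>" by measurable
    then show ?thesis by (simp add: A_def)
  qed
  have S [measurable]: "S j \<in> sets \<mu>" for j
  proof -
    have "{y \<in> space \<mu>. ennreal (P j) < ennreal (g y)} \<in> sets \<mu>" by measurable
    then show ?thesis by (simp add: S_def)
  qed
  have point1: "ennreal (w x powr r) \<le> (\<integral>\<^sup>+j. ennreal ((8 * P j) powr r) * indicator (A j) x \<partial>count_space UNIV)" for x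
  proof (cases "w x = 0")
    case False
    then have wx: "0 < w x" using w0[of x] by simp
    define m where "m = \<lfloor>log 2 (w x)\<rfloor>"
    have m: "2 powr of_int m \<le> w x" "w x < 2 powr (of_int m + 1)"
      using wx by (simp_all add: m_def powr_le_iff less_powr_iff)
    \<comment> \<open>The shift by 2 makes \<open>2 * P (m - 2)\<close> strictly smaller than
      \<open>w x\<close>, as the strict inequality in \<open>A\<close> requires.\<close>
    have P2: "4 * P (m - 2) = 2 powr of_int m" "8 * P (m - 2) = 2 powr (of_int m + 1)"
      by (simp_all add: P_def powr_diff powr_add)
    have "2 * P (m - 2) < w x" using m P2 P[of "m-2"] by linarith
    then have "ennreal (2 * P (m - 2)) < ennreal (w x)" using P[of "m - 2"] by (simp add: ennreal_less_iff)
    then have xA: "x \<in> A (m - 2)" using wM[of x] by (simp add: A_def)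
    have "ennreal (w x powr r) \<le> ennreal ((8 * P (m - 2)) powr r) * indicator (A (m - 2)) x"
      using xA m P2 wx r by (auto intro!: ennreal_leI powr_mono2)
    also have "\<dots> \<le> (\<integral>\<^sup>+j. ennreal ((8 * P j) powr r) * indicator (A j) x \<partial>count_space UNIV)"
      by (rule nn_integral_ge_point) simp
    finally show ?thesis .
  qed simp
  have coef: "(8 * P j) powr r * (\<beta> / P j) = \<beta> * 8 powr r * 2 powr ((r - 1) * of_int j)" for j
  proof -
    have "(8 * P j) powr r = 8 powr r * 2 powr (of_int j * r)" by (simp add: P_def powr_mult powr_powr)
    moreover have "2 powr (of_int j * r) / P j = 2 powr ((r - 1) * of_int j)"
      by (simp add: P_def powr_diff[symmetric] algebra_simps)
    moreover have "(8 * P j) powr r * (\<beta> / P j) = \<beta> * 8 powr r * (2 powr (of_int j * r) / P j)"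
      using calculation(1) by simp
    ultimately show ?thesis by simp
  qed
  have point2: "(\<integral>\<^sup>+j. ennreal ((8 * P j) powr r * (\<beta> / P j)) * (ennreal (g y) * indicator (S j) y) \<partial>count_space UNIV)
      \<le> ennreal (maximal_const r) * ennreal (g y powr r)" for y
  proof (cases "g y = 0")
    case True
    then show ?thesis by simp
  next
    case False
    then have gy: "0 < g y" using g0[of y] by simp
    define J where "J = \<lfloor>log 2 (g y)\<rfloor>"
    have J: "2 powr of_int J \<le> g y" "g y < 2 powr (of_int J + 1)"
      using gy by (simp_all add: J_def powr_le_iff less_powr_iff)
    have SJ: "y \<in> S j \<Longrightarrow> j \<le> J" for j
    proof -
      assume "y \<in> S j"
      then have "P j < g y" using P[of j] by (simp add: S_def ennreal_less_iff)
      then have "2 powr of_int j < (2::real) powr (of_int J + 1)"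
        using J(2) unfolding P_def by (rule less_trans)
      then have "real_of_int j < of_int J + 1" by (rule powr_less_cancel) simp
      then show "j \<le> J" by linarith
    qed
    have "(\<integral>\<^sup>+j. ennreal ((8 * P j) powr r * (\<beta> / P j)) * (ennreal (g y) * indicator (S j) y) \<partial>count_space UNIV)
      \<le> (\<integral>\<^sup>+j. ennreal (\<beta> * 8 powr r * g y) * (ennreal (2 powr ((r - 1) * of_int j)) * indicator {..J} j) \<partial>count_space UNIV)"
    proof (rule nn_integral_mono)
      fix j
      show "ennreal ((8 * P j) powr r * (\<beta> / P j)) * (ennreal (g y) * indicator (S j) y) \<le>
         ennreal (\<beta> * 8 powr r * g y) * (ennreal (2 powr ((r - 1) * of_int j)) * indicator {..J} j)"
        unfolding coef using SJ[of j] gy by (auto simp: indicator_def ennreal_mult[symmetric] mult_ac)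
    qed
    also have "\<dots> = ennreal (\<beta> * 8 powr r * g y) * (\<integral>\<^sup>+j\<in>{..J}. ennreal (2 powr ((r - 1) * of_int j)) \<partial>count_space UNIV)"
      by (rule nn_integral_cmult) simp
    also have "\<dots> = ennreal (\<beta> * 8 powr r * g y) * ennreal (2 powr ((r - 1) * of_int J) / (1 - (1/2) powr (r - 1)))"
      using r by (subst int_geometric_tail) auto
    also have "\<dots> \<le> ennreal (maximal_const r) * ennreal (g y powr r)"
    proof -
      have r1: "0 < 1 - (1/2::real) powr (r - 1)" using powr_less_mono'[of "1/2" 0 "r - 1"] r by auto
      have "2 powr ((r - 1) * of_int J) = (2 powr of_int J) powr (r - 1)" by (simp add: powr_powr mult.commute)
      also have "\<dots> \<le> g y powr (r - 1)" using J r by (intro powr_mono2) auto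
      finally have 1: "2 powr ((r - 1) * of_int J) \<le> g y powr (r - 1)" .
      have "(8::real) powr r \<le> 16 powr r * 2"
      proof -
        have "(8::real) powr r \<le> 16 powr r" using r by (intro powr_mono2) auto
        then show ?thesis using powr_ge_zero[of 16 r] by linarith
      qed
      then have "\<beta> * 8 powr r * g y * (2 powr ((r - 1) * of_int J) / (1 - (1/2) powr (r - 1)))
         \<le> \<beta> * (16 powr r * 2) * g y * (g y powr (r - 1) / (1 - (1/2) powr (r - 1)))"
        using 1 r1 gy by (intro mult_mono divide_right_mono) auto
      also have "\<dots> = maximal_const r * (g y powr 1 * g y powr (r - 1))" using gy by (simp add: maximal_const_def)
      also have "g y powr 1 * g y powr (r - 1) = g y powr r" by (simp only: powr_add[symmetric]) simp
      finally have "ennreal (\<beta> * 8 powr r * g y * (2 powr ((r - 1) * of_int J) / (1 - (1/2) powr (r - 1)))) \<le> ennreal (maximal_const r * g y powr r)"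
        by (rule ennreal_leI)
      then show ?thesis using r1 gy maximal_const_nonneg[OF r] by (simp add: ennreal_mult[symmetric])
    qed
    finally show ?thesis .
  qed
  have "(\<integral>\<^sup>+x. ennreal (w x powr r) \<partial>\<mu>) \<le> (\<integral>\<^sup>+x. \<integral>\<^sup>+j. ennreal ((8 * P j) powr r) * indicator (A j) x \<partial>count_space UNIV \<partial>\<mu>)"
    by (intro nn_integral_mono point1)
  also have "\<dots> = (\<integral>\<^sup>+j. \<integral>\<^sup>+x. ennreal ((8 * P j) powr r) * indicator (A j) x \<partial>\<mu> \<partial>count_space UNIV)"
    by (rule nn_integral_count_space_nn_integral) auto
  also have "\<dots> = (\<integral>\<^sup>+j. ennreal ((8 * P j) powr r) * emeasure \<mu> (A j) \<partial>count_space UNIV)"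
    by (intro nn_integral_cong nn_integral_cmult_indicator A)
  also have "\<dots> \<le> (\<integral>\<^sup>+j. \<integral>\<^sup>+y. ennreal ((8 * P j) powr r * (\<beta> / P j)) * (ennreal (g y) * indicator (S j) y) \<partial>\<mu> \<partial>count_space UNIV)"
  proof (rule nn_integral_mono)
    fix j
    have "ennreal ((8 * P j) powr r) * emeasure \<mu> (A j) \<le>
       ennreal ((8 * P j) powr r) * (ennreal (\<beta> / P j) * (\<integral>\<^sup>+y\<in>S j. ennreal (g y) \<partial>\<mu>))"
      unfolding A_def S_def using P[of j] by (intro mult_left_mono maximal_weak_truncated) auto
    also have "\<dots> = ennreal ((8 * P j) powr r * (\<beta> / P j)) * (\<integral>\<^sup>+y\<in>S j. ennreal (g y) \<partial>\<mu>)"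
      using P[of j] by (subst ennreal_mult) (auto simp: mult.assoc)
    also have "\<dots> = (\<integral>\<^sup>+y. ennreal ((8 * P j) powr r * (\<beta> / P j)) * (ennreal (g y) * indicator (S j) y) \<partial>\<mu>)"
      by (rule nn_integral_cmult[symmetric]) measurable
    finally show "ennreal ((8 * P j) powr r) * emeasure \<mu> (A j) \<le> \<dots>" .
  qed
  also have "\<dots> = (\<integral>\<^sup>+y. \<integral>\<^sup>+j. ennreal ((8 * P j) powr r * (\<beta> / P j)) * (ennreal (g y) * indicator (S j) y) \<partial>count_space UNIV \<partial>\<mu>)"
    by (rule nn_integral_count_space_nn_integral[symmetric]) auto
  also have "\<dots> \<le> (\<integral>\<^sup>+y. ennreal (maximal_const r) * ennreal (g y powr r) \<partial>\<mu>)"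
    by (intro nn_integral_mono point2)
  also have "\<dots> = ennreal (maximal_const r) * (\<integral>\<^sup>+y. ennreal (g y powr r) \<partial>\<mu>)"
    by (rule nn_integral_cmult) measurable
  finally show ?thesis .
qed

text \<open>Apply the strong bound to n times the indicator of the set of infinite values and let n
  grow.\<close>

lemma maximal_finite_AE:
  fixes g :: "'a \<Rightarrow> real"
  assumes r: "1 < r" and g [measurable]: "g \<in> borel_measurable \<mu>" and g0: "\<And>y. 0 \<le> g y"
    and fin: "(\<integral>\<^sup>+x. ennreal (g x powr r) \<partial>\<mu>) \<le> ennreal G" and G: "0 \<le> G"
  shows "AE x in \<mu>. maximal (\<lambda>y. ennreal (g y)) x < \<infinity>"
proof -
  let ?M = "maximal (\<lambda>y. ennreal (g y))"
  define Z where "Z = {x. ?M x = \<infinity>}"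
  have Z [measurable]: "Z \<in> sets \<mu>"
  proof -
    have "{x \<in> space \<mu>. ?M x = \<infinity>} \<in> sets \<mu>" by measurable
    then show ?thesis by (simp add: Z_def)
  qed
  have le: "ennreal (real n powr r) * emeasure \<mu> Z \<le> ennreal (maximal_const r * G)" for n
  proof -
    have "ennreal (real n powr r) * emeasure \<mu> Z = (\<integral>\<^sup>+x. ennreal (real n powr r) * indicator Z x \<partial>\<mu>)"
      by (rule nn_integral_cmult_indicator[symmetric]) (rule Z)
    also have "\<dots> = (\<integral>\<^sup>+x. ennreal ((real n * indicator Z x) powr r) \<partial>\<mu>)"
      using r by (intro nn_integral_cong) (auto simp: indicator_def)
    also have "\<dots> \<le> ennreal (maximal_const r) * (\<integral>\<^sup>+x. ennreal (g x powr r) \<partial>\<mu>)"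
      by (rule maximal_strong[OF r g g0]) (auto simp: Z_def indicator_def)
    also have "\<dots> \<le> ennreal (maximal_const r) * ennreal G" by (intro mult_left_mono fin) simp
    finally show ?thesis using maximal_const_nonneg[OF r] G by (simp add: ennreal_mult)
  qed
  have "emeasure \<mu> Z = 0"
  proof (rule ccontr)
    assume nz: "emeasure \<mu> Z \<noteq> 0"
    have "emeasure \<mu> Z \<noteq> \<infinity>" using le[of 1] by (auto simp: top_unique)
    then obtain m where m: "emeasure \<mu> Z = ennreal m" "0 \<le> m" by (cases "emeasure \<mu> Z") auto
    then have m0: "0 < m" using nz by (cases "m = 0") auto
    obtain n where n: "maximal_const r * G / m < real n" using reals_Archimedean2 by blast
    have n1: "1 \<le> real (Suc n)" by simp
    have "maximal_const r * G / m < real (Suc n)" using n by simp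
    also have "real (Suc n) = real (Suc n) powr 1" by simp
    also have "\<dots> \<le> real (Suc n) powr r" using r n1 by (intro powr_mono) auto
    finally have "maximal_const r * G < real (Suc n) powr r * m" using m0 by (simp add: field_simps)
    moreover have "ennreal (real (Suc n) powr r * m) \<le> ennreal (maximal_const r * G)"
      using le[of "Suc n"] m by (simp add: ennreal_mult)
    ultimately show False using maximal_const_nonneg[OF r] G by (simp add: ennreal_le_iff)
  qed
  then have "Z \<in> null_sets \<mu>" using Z by (simp add: null_sets_def)
  then show ?thesis by (rule AE_I') (auto simp: Z_def less_top[symmetric])
qed

text \<open>Balls around x exhaust the space, so a nonzero integral shows in some average.
  Positivity is needed because \<open>hop_le\<close> divides by its parameter
  \<open>u\<close>.\<close>

lemma maximal_pos:
  assumes [measurable]: "g \<in> borel_measurable \<mu>" and "(\<integral>\<^sup>+y. g y \<partial>\<mu>) \<noteq> 0"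
  shows "0 < maximal g x"
proof (rule ccontr)
  assume "\<not> 0 < maximal g x"
  then have M0: "maximal g x = 0" by (simp add: not_gr_zero)
  have "(\<integral>\<^sup>+y\<in>ball x (pow6 (int n)). g y \<partial>\<mu>) = 0" for n
    using maximal_ge[of g x "int n"] M0 by simp
  then have "emeasure (density \<mu> g) (ball x (pow6 (int n))) = 0" for n
    by (simp add: emeasure_density)
  then have "emeasure (density \<mu> g) (\<Union>n. ball x (pow6 (int n))) = 0"
    by (intro emeasure_UN_eq_0) (auto simp del: power_int_of_nat)
  then have "emeasure (density \<mu> g) UNIV = 0" using UNIV_eq_UN_ball[of x] by simp
  moreover have "UNIV \<in> sets \<mu>" by simp
  ultimately have "(\<integral>\<^sup>+y\<in>UNIV. g y \<partial>\<mu>) = 0" by (simp add: emeasure_density)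
  then show False using assms(2) by simp
qed

end

section \<open>Boundedness of the commutator\<close>

lemma powr_root_cancel: "1 < q \<Longrightarrow> 0 \<le> (z::real) \<Longrightarrow> (z powr q) powr (1 / q) = z"
  by (simp add: powr_powr)

context udspace
begin

lemma sets_off_diag [measurable]: "{p. fst p \<noteq> snd p} \<in> sets (\<mu> \<Otimes>\<^sub>M \<mu>)"
proof -
  have "{p \<in> space (\<mu> \<Otimes>\<^sub>M \<mu>). dist (fst p) (snd p) \<noteq> 0} \<in> sets (\<mu> \<Otimes>\<^sub>M \<mu>)" by measurable
  then show ?thesis by (simp add: space_pair_measure)
qed

end

context nhspace
begin

text \<open>\<open>(1 + p) / 2\<close> lies strictly between 1 and p, so that it can serve as the
  Hoelder exponent s while p / s > 1 still allows the maximal inequality.\<close>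

definition hop_norm_const :: "real \<Rightarrow> real \<Rightarrow> nat \<Rightarrow> real" where
  "hop_norm_const \<theta> p a = hop_const \<theta> p ((1 + p) / 2) a * maximal_const (p / ((1 + p) / 2)) powr (1 / p - \<theta>)"

lemma hop_norm_const_nonneg: "0 < \<theta> \<Longrightarrow> \<theta> < 1 / p \<Longrightarrow> 0 \<le> hop_norm_const \<theta> p a"
  by (simp add: hop_norm_const_def hop_const_nonneg)

text \<open>The second summand belongs to the transpose, which starts from the exponent conjugate to
  q; \<open>\<beta> ^ 2\<close> is the cost of moving \<open>L\<close> to the other centre.\<close>

definition commutator_const :: "real \<Rightarrow> real \<Rightarrow> real \<Rightarrow> nat \<Rightarrow> real" where
  "commutator_const \<theta> p q a = hop_norm_const \<theta> p a + \<beta> ^ 2 * hop_norm_const \<theta> (q / (q - 1)) a"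

end

context rbmo
begin

text \<open>The bound passes through a real measurable majorant \<open>h\<close>, for nonzero f a
  multiple of a power of the maximal function of f^s; \<open>hop\<close> itself may be infinite on a
  null set.\<close>

lemma hop_norm:
  fixes f :: "'a \<Rightarrow> real"
  assumes p: "1 < p" and \<theta>: "0 < \<theta>" "\<theta> < 1 / p" and q: "1 / q = 1 / p - \<theta>"
    and f [measurable]: "f \<in> borel_measurable \<mu>" and f0: "\<And>y. 0 \<le> f y"
    and v: "0 \<le> v" and fv: "(\<integral>\<^sup>+y. ennreal (f y powr p) \<partial>\<mu>) \<le> ennreal (v powr p)"
  obtains h where "h \<in> borel_measurable \<mu>" "\<And>x. 0 \<le> h x" "AE x in \<mu>. hop \<theta> f x \<le> ennreal (h x)"
    "(\<integral>\<^sup>+x. ennreal (h x powr q) \<partial>\<mu>) \<le> ennreal ((hop_norm_const \<theta> p a * D * v) powr q)"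
proof (cases "(\<integral>\<^sup>+y. ennreal (f y powr p) \<partial>\<mu>) = 0")
  case True
  have ae: "AE y in \<mu>. f y = 0" using f f0 True by (rule nn_integral_eq_0_powr)
  have "hop \<theta> f x = 0" for x
  proof -
    have "hop \<theta> f x = (\<integral>\<^sup>+y. 0 \<partial>\<mu>)" unfolding hop_def
      using ae by (intro nn_integral_cong_AE) (auto elim!: eventually_mono)
    then show ?thesis by simp
  qed
  then show ?thesis by (intro that[of "\<lambda>_. 0"]) auto
next
  case False
  have v0: "0 < v" using False fv v p by (cases "v = 0") auto
  have q0: "0 < q" using q \<theta> by (metis diff_gt_0_iff_gt zero_less_divide_1_iff)
  define s where "s = (1 + p) / 2"
  define r where "r = p / s"
  have s: "1 < s" using p by (simp add: s_def)
  have r: "1 < r" using p by (simp add: r_def s_def)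
  define g where "g y = f y powr s" for y
  have g [measurable]: "g \<in> borel_measurable \<mu>" unfolding g_def[abs_def] by measurable
  have g0: "0 \<le> g y" for y by (simp add: g_def)
  have gr: "g y powr r = f y powr p" for y using s by (simp add: g_def r_def powr_powr)
  have G: "(\<integral>\<^sup>+y. ennreal (g y powr r) \<partial>\<mu>) \<le> ennreal (v powr p)" using fv by (simp add: gr)
  let ?M = "maximal (\<lambda>y. ennreal (g y))"
  have M_meas: "?M \<in> borel_measurable \<mu>" by (rule measurable_maximal) measurable
  have fin: "AE x in \<mu>. ?M x < \<infinity>" by (rule maximal_finite_AE[OF r g g0 G]) simp
  have g_nz: "(\<integral>\<^sup>+y. ennreal (g y) \<partial>\<mu>) \<noteq> 0"
  proof
    assume "(\<integral>\<^sup>+y. ennreal (g y) \<partial>\<mu>) = 0"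
    then have "(\<integral>\<^sup>+y. ennreal (f y powr s) \<partial>\<mu>) = 0" by (simp add: g_def)
    then have "AE y in \<mu>. f y = 0" by (rule nn_integral_eq_0_powr[OF f f0])
    then have "(\<integral>\<^sup>+y. ennreal (f y powr p) \<partial>\<mu>) = (\<integral>\<^sup>+y. 0 \<partial>\<mu>)"
      by (intro nn_integral_cong_AE) (auto elim!: eventually_mono)
    then show False using False by simp
  qed
  define w where "w x = enn2real (?M x)" for x
  have w [measurable]: "w \<in> borel_measurable \<mu>"
    unfolding w_def[abs_def] by (rule borel_measurable_enn2real[OF M_meas])
  have w0: "0 \<le> w x" for x by (simp add: w_def)
  have wM: "ennreal (w x) \<le> ?M x" for x by (cases "?M x") (auto simp: w_def)
  define h where "h x = hop_const \<theta> p s a * D * (v powr (p * \<theta>) * (w x powr (1 / s)) powr (1 - p * \<theta>))" for x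
  have hop_const: "0 \<le> hop_const \<theta> p s a" using \<theta> by (rule hop_const_nonneg)
  show ?thesis
  proof (rule that)
    show "h \<in> borel_measurable \<mu>" unfolding h_def[abs_def] by measurable
    show "0 \<le> h x" for x using hop_const D_nonneg by (simp add: h_def)
    show "AE x in \<mu>. hop \<theta> f x \<le> ennreal (h x)"
      using fin
    proof eventually_elim
      case (elim x)
      have Mw: "?M x = ennreal (w x)" using elim by (simp add: w_def less_top)
      have "0 < ?M x" using g_nz by (intro maximal_pos) measurable
      then have wx: "0 < w x" unfolding Mw by simp
      show ?case unfolding h_def
      proof (rule hop_le[OF s p \<theta> f f0 _ _ v0 fv])
        show "0 < w x powr (1 / s)" using wx by simp
        fix K
        have "(\<integral>\<^sup>+y\<in>ball x (pow6 K). ennreal (g y) \<partial>\<mu>) \<le> ennreal (w x) * ennreal (L K x)"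
          using maximal_ge[of "\<lambda>y. ennreal (g y)" x K] unfolding Mw .
        also have "\<dots> = ennreal ((w x powr (1 / s)) powr s * L K x)"
          using wx s by (simp add: powr_powr ennreal_mult)
        finally show "(\<integral>\<^sup>+y\<in>ball x (pow6 K). ennreal (f y powr s) \<partial>\<mu>) \<le> ennreal ((w x powr (1 / s)) powr s * L K x)"
          by (simp add: g_def)
      qed
    qed
    \<comment> \<open>The Sobolev relation between p and q turns the q-th power of \<open>h\<close>
      into the r-th power of the maximal function, to which the strong bound applies.\<close>
    have e: "(1 - p * \<theta>) * q = p"
    proof -
      have "(1 - p * \<theta>) * q = p * (1 / p - \<theta>) * q" using p by (simp add: right_diff_distrib)
      also have "\<dots> = p" unfolding q[symmetric] using q0 by simp
      finally show ?thesis .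
    qed
    define X where "X = hop_const \<theta> p s a * D * v powr (p * \<theta>)"
    have X: "0 \<le> X" using hop_const D_nonneg by (simp add: X_def)
    have hq: "h x powr q = X powr q * w x powr r" for x
    proof -
      have "h x powr q = X powr q * ((w x powr (1 / s)) powr (1 - p * \<theta>)) powr q"
        using hop_const D_nonneg by (simp add: h_def X_def powr_mult mult.assoc)
      also have "((w x powr (1 / s)) powr (1 - p * \<theta>)) powr q = w x powr (1 / s * ((1 - p * \<theta>) * q))"
        by (simp only: powr_powr mult.assoc)
      also have "1 / s * ((1 - p * \<theta>) * q) = r" unfolding e by (simp add: r_def)
      finally show ?thesis .
    qed
    have "(\<integral>\<^sup>+x. ennreal (h x powr q) \<partial>\<mu>) = ennreal (X powr q) * (\<integral>\<^sup>+x. ennreal (w x powr r) \<partial>\<mu>)"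
      unfolding hq by (simp add: ennreal_mult nn_integral_cmult)
    also have "\<dots> \<le> ennreal (X powr q) * (ennreal (maximal_const r) * ennreal (v powr p))"
      by (intro mult_left_mono order.trans[OF maximal_strong[OF r g g0 w w0 wM]] G) auto
    also have "\<dots> = ennreal (X powr q * (maximal_const r * v powr p))"
      using maximal_const_nonneg[OF r] by (simp add: ennreal_mult)
    also have "X powr q * (maximal_const r * v powr p) = (hop_norm_const \<theta> p a * D * v) powr q"
    proof -
      have "(hop_norm_const \<theta> p a * D * v) powr q = (hop_const \<theta> p s a * D * v * maximal_const r powr (1 / q)) powr q"
        unfolding hop_norm_const_def s_def[symmetric] r_def[symmetric] q by (simp add: mult_ac)
      also have "\<dots> = (hop_const \<theta> p s a * D) powr q * v powr q * (maximal_const r powr (1 / q)) powr q"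
        using hop_const D_nonneg v by (simp add: powr_mult)
      also have "(maximal_const r powr (1 / q)) powr q = maximal_const r" using q0 maximal_const_nonneg[OF r] by (simp add: powr_powr)
      also have "v powr q = v powr (p * \<theta> * q) * v powr p"
      proof -
        have "p * \<theta> * q + p = q" using e by (simp add: algebra_simps)
        then show ?thesis by (simp add: powr_add[symmetric])
      qed
      finally show ?thesis using hop_const D_nonneg v by (auto simp: X_def powr_mult powr_powr mult_ac)
    qed
    finally show "(\<integral>\<^sup>+x. ennreal (h x powr q) \<partial>\<mu>) \<le> ennreal ((hop_norm_const \<theta> p a * D * v) powr q)" by simp
  qed
qed

section \<open>Joint measurability and the pairing with a test function\<close>

lemma measurable_ball_mean: "(\<lambda>x. ball_mean \<mu> b x (pow6 m)) \<in> borel_measurable \<mu>"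
proof -
  have "(\<lambda>p. indicator {p. dist (fst p) (snd p) < pow6 m} p *\<^sub>R b (snd p)) \<in> borel_measurable (\<mu> \<Otimes>\<^sub>M \<mu>)"
    using sets_dist_less[of "pow6 m"] by measurable
  moreover have "indicator {p. dist (fst p) (snd p) < pow6 m} p *\<^sub>R b (snd p) =
      (\<lambda>(x, y). indicator (ball x (pow6 m)) y *\<^sub>R b y) p" for p :: "'a \<times> 'a"
    by (cases p) (auto simp: indicator_def)
  ultimately have "(\<lambda>(x, y). indicator (ball x (pow6 m)) y *\<^sub>R b y) \<in> borel_measurable (\<mu> \<Otimes>\<^sub>M \<mu>)"
    by simp
  then have "(\<lambda>x. LINT y:ball x (pow6 m)|\<mu>. b y) \<in> borel_measurable \<mu>"
    unfolding set_lebesgue_integral_def by (rule sf.borel_measurable_lebesgue_integral)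
  moreover have "(\<lambda>x. complex_of_real (V m x)) \<in> borel_measurable \<mu>" by measurable
  ultimately show ?thesis unfolding ball_mean_def V_def by (rule borel_measurable_divide)
qed

lemma measurable_c [measurable]: "c k \<in> borel_measurable \<mu>"
  unfolding c_def[abs_def]
  by (rule measurable_compose_countable[OF measurable_ball_mean measurable_next_dbl])

lemma measurable_osc_pair [measurable]: "(\<lambda>p. osc (fst p) (snd p)) \<in> borel_measurable (\<mu> \<Otimes>\<^sub>M \<mu>)"
proof -
  have "(\<lambda>p. c k (fst p)) \<in> borel_measurable (\<mu> \<Otimes>\<^sub>M \<mu>)" for k by measurable
  then have "(\<lambda>p. c (lev (fst p) (snd p)) (fst p)) \<in> borel_measurable (\<mu> \<Otimes>\<^sub>M \<mu>)"
    by (rule measurable_compose_countable[OF _ measurable_lev])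
  then show ?thesis unfolding osc_def[abs_def] by measurable
qed

lemma measurable_L_pair [measurable]: "(\<lambda>p. L (lev (fst p) (snd p)) (fst p)) \<in> borel_measurable (\<mu> \<Otimes>\<^sub>M \<mu>)"
proof -
  have "(\<lambda>p. L k (fst p)) \<in> borel_measurable (\<mu> \<Otimes>\<^sub>M \<mu>)" for k by measurable
  then show ?thesis by (rule measurable_compose_countable[OF _ measurable_lev])
qed

definition Tb :: "real \<Rightarrow> ('a \<Rightarrow> real) \<Rightarrow> 'a \<Rightarrow> ennreal" where
  "Tb \<theta> f x = (\<integral>\<^sup>+y\<in>- {x}. ennreal (norm (b x - b y) * L (lev x y) x powr (\<theta> - 1) * f y) \<partial>\<mu>)"

lemma measurable_Tb:
  fixes f :: "'a \<Rightarrow> real"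
  assumes [measurable]: "f \<in> borel_measurable \<mu>"
  shows "Tb \<theta> f \<in> borel_measurable \<mu>"
proof -
  have "(\<lambda>p. ennreal (norm (b (fst p) - b (snd p)) * L (lev (fst p) (snd p)) (fst p) powr (\<theta> - 1) * f (snd p))
       * indicator {p. fst p \<noteq> snd p} p) \<in> borel_measurable (\<mu> \<Otimes>\<^sub>M \<mu>)"
    by measurable
  from sf.borel_measurable_nn_integral_fst[OF this] show ?thesis
    unfolding Tb_def[abs_def] by (simp add: indicator_def eq_commute)
qed

lemma b_diff_le: assumes "x \<noteq> y" shows "norm (b x - b y) \<le> osc x y + osc y x"
proof -
  let ?k = "lev x y"
  have "dist x y < pow6 (?k + 1)" using lev_iff[OF assms] by blast
  then have "norm (c ?k x - c ?k y) \<le> near_const * D" by (rule c_near)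
  moreover have "b x - b y = (b x - c ?k y) - (c ?k x - c ?k y) - (b y - c ?k x)" by simp
  then have "norm (b x - b y) \<le> norm (b x - c ?k y) + norm (c ?k x - c ?k y) + norm (b y - c ?k x)"
    by (metis add_right_mono norm_triangle_ineq4 order.trans)
  moreover have "0 \<le> near_const * D" using near_const_ge D_nonneg by simp
  ultimately show ?thesis unfolding osc_def lev_commute[of y x] by linarith
qed

text \<open>The exponent \<theta> - 1 is negative, so \<open>L_shift\<close> is used in the
  direction from y to x.\<close>

lemma L_powr_swap:
  assumes "x \<noteq> y" "0 < \<theta>" "\<theta> < 1"
  shows "L (lev x y) x powr (\<theta> - 1) \<le> \<beta> ^ 2 * L (lev y x) y powr (\<theta> - 1)"
proof -
  let ?k = "lev x y"
  have "dist x y < pow6 (?k + 1)" using lev_iff[OF assms(1)] by blast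
  then have "L ?k y \<le> \<beta> ^ 2 * L ?k x" by (intro L_shift) (simp add: dist_commute)
  then have "L ?k y / \<beta> ^ 2 \<le> L ?k x" by (simp add: field_simps)
  then have "L ?k x powr (\<theta> - 1) \<le> (L ?k y / \<beta> ^ 2) powr (\<theta> - 1)"
    using assms by (intro powr_mono2') auto
  also have "\<dots> = (\<beta> ^ 2) powr (1 - \<theta>) * L ?k y powr (\<theta> - 1)"
    using powr_minus_divide[of "\<beta> ^ 2" "\<theta> - 1"] by (simp add: powr_divide)
  also have "(\<beta> ^ 2) powr (1 - \<theta>) \<le> (\<beta> ^ 2) powr 1"
    using assms by (intro powr_mono) auto
  finally show ?thesis by (simp add: lev_commute mult_right_mono)
qed

text \<open>After the splitting of b x - b y, Fubini turns the second half into \<open>hop\<close>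
  applied to g. That half acts from L^q' to L^p' with 1/p' = 1/q' - \<theta>, so
  \<open>hop_norm\<close> serves both.\<close>

lemma Tb_pairing:
  fixes f g :: "'a \<Rightarrow> real"
  assumes p: "1 < p" and \<theta>: "0 < \<theta>" "\<theta> < 1 / p" and q: "1 / q = 1 / p - \<theta>"
    and f [measurable]: "f \<in> borel_measurable \<mu>" and f0: "\<And>y. 0 \<le> f y"
    and v: "0 \<le> v" and fv: "(\<integral>\<^sup>+y. ennreal (f y powr p) \<partial>\<mu>) \<le> ennreal (v powr p)"
    and g [measurable]: "g \<in> borel_measurable \<mu>" and g0: "\<And>y. 0 \<le> g y"
    and z: "0 \<le> z" and gz: "(\<integral>\<^sup>+y. ennreal (g y powr (q / (q - 1))) \<partial>\<mu>) \<le> ennreal (z powr (q / (q - 1)))"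
  shows "(\<integral>\<^sup>+x. ennreal (g x) * Tb \<theta> f x \<partial>\<mu>) \<le> ennreal (commutator_const \<theta> p q a * D * v * z)"
proof -
  define q' where "q' = q / (q - 1)"
  define p' where "p' = p / (p - 1)"
  have p1: "0 < 1 / p" "1 / p < 1" using p by auto
  have q1: "0 < 1 / q" "1 / q < 1" using q \<theta> p1 by linarith+
  then have qg: "1 < q" by (simp add: divide_less_eq_1_pos zero_less_divide_1_iff)
  have \<theta>1: "\<theta> < 1" using \<theta> p1 by linarith
  have q': "1 < q'" "1 / q' = 1 - 1 / q" using qg by (auto simp: q'_def field_simps)
  have p': "1 < p'" "1 / p' = 1 - 1 / p" using p by (auto simp: p'_def field_simps)
  have \<theta>q: "\<theta> < 1 / q'" "1 / p' = 1 / q' - \<theta>" using q p1 unfolding q'(2) p'(2) by linarith+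
  obtain hf where hf: "hf \<in> borel_measurable \<mu>" "\<And>x. 0 \<le> hf x" "AE x in \<mu>. hop \<theta> f x \<le> ennreal (hf x)"
    "(\<integral>\<^sup>+x. ennreal (hf x powr q) \<partial>\<mu>) \<le> ennreal ((hop_norm_const \<theta> p a * D * v) powr q)"
    using hop_norm[OF p \<theta> q f f0 v fv] by blast
  obtain hg where hg: "hg \<in> borel_measurable \<mu>" "\<And>x. 0 \<le> hg x" "AE x in \<mu>. hop \<theta> g x \<le> ennreal (hg x)"
    "(\<integral>\<^sup>+x. ennreal (hg x powr p') \<partial>\<mu>) \<le> ennreal ((hop_norm_const \<theta> q' a * D * z) powr p')"
    using hop_norm[OF q'(1) \<theta>(1) \<theta>q g g0 z gz[folded q'_def]] by blast
  define F where "F x y = ennreal (osc x y * L (lev x y) x powr (\<theta> - 1) * f y) * indicator (- {x}) y" for x y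
  define G where "G x y = ennreal (osc y x * L (lev y x) y powr (\<theta> - 1) * g x) * indicator (- {y}) x" for x y
  have ind: "indicator (- {x}) y = indicator {p. fst p \<noteq> snd p} (x, y)" for x y :: 'a
    by (auto simp: indicator_def)
  have Fm [measurable]: "(\<lambda>p. F (fst p) (snd p)) \<in> borel_measurable (\<mu> \<Otimes>\<^sub>M \<mu>)"
    unfolding F_def ind prod.collapse by measurable
  have Gm [measurable]: "(\<lambda>p. G (fst p) (snd p)) \<in> borel_measurable (\<mu> \<Otimes>\<^sub>M \<mu>)"
  proof -
    have "(\<lambda>p. ennreal (osc (fst p) (snd p) * L (lev (fst p) (snd p)) (fst p) powr (\<theta> - 1) * g (snd p))
       * indicator {p. fst p \<noteq> snd p} p) \<in> borel_measurable (\<mu> \<Otimes>\<^sub>M \<mu>)" by measurable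
    from measurable_pair_swap[OF this] show ?thesis
      unfolding G_def ind by (simp add: case_prod_beta')
  qed
  have Fx [measurable]: "F x \<in> borel_measurable \<mu>" for x
    using measurable_Pair2[OF Fm, of x] by simp
  have Gx [measurable]: "G x \<in> borel_measurable \<mu>" for x
    using measurable_Pair2[OF Gm, of x] by simp
  have Tle: "ennreal (g x) * Tb \<theta> f x \<le> ennreal (g x) * (\<integral>\<^sup>+y. F x y \<partial>\<mu>) + ennreal (\<beta> ^ 2) * (\<integral>\<^sup>+y. ennreal (f y) * G x y \<partial>\<mu>)" for x
  proof -
    have "ennreal (g x) * Tb \<theta> f x = (\<integral>\<^sup>+y. ennreal (g x) * (ennreal (norm (b x - b y) * L (lev x y) x powr (\<theta> - 1) * f y) * indicator (- {x}) y) \<partial>\<mu>)"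
      unfolding Tb_def by (rule nn_integral_cmult[symmetric]) measurable
    also have "\<dots> \<le> (\<integral>\<^sup>+y. ennreal (g x) * F x y + ennreal (\<beta> ^ 2) * (ennreal (f y) * G x y) \<partial>\<mu>)"
    proof (rule nn_integral_mono)
      fix y
      show "ennreal (g x) * (ennreal (norm (b x - b y) * L (lev x y) x powr (\<theta> - 1) * f y) * indicator (- {x}) y)
         \<le> ennreal (g x) * F x y + ennreal (\<beta> ^ 2) * (ennreal (f y) * G x y)"
      proof (cases "y = x")
        case False
        let ?l = "L (lev x y) x powr (\<theta> - 1)" and ?m = "L (lev y x) y powr (\<theta> - 1)"
        have nn: "0 \<le> osc x y" "0 \<le> osc y x" "0 \<le> f y" "0 \<le> g x" using osc_nonneg f0 g0 by auto
        have "g x * (norm (b x - b y) * ?l * f y) \<le> g x * ((osc x y + osc y x) * ?l * f y)"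
          using b_diff_le[of x y] False nn by (intro mult_left_mono mult_right_mono) auto
        also have "\<dots> = g x * (osc x y * ?l * f y) + f y * (osc y x * ?l * g x)" by (simp add: algebra_simps)
        also have "f y * (osc y x * ?l * g x) \<le> f y * (osc y x * (\<beta> ^ 2 * ?m) * g x)"
          using L_powr_swap[of x y \<theta>] False nn \<theta> \<theta>1 by (intro mult_left_mono mult_right_mono) auto
        also have "\<dots> = \<beta> ^ 2 * (f y * (osc y x * ?m * g x))" by (simp add: mult_ac)
        finally have "ennreal (g x * (norm (b x - b y) * ?l * f y)) \<le>
            ennreal (g x * (osc x y * ?l * f y) + \<beta> ^ 2 * (f y * (osc y x * ?m * g x)))"
          by (intro ennreal_leI) simp
        also have "\<dots> = ennreal (g x) * ennreal (osc x y * ?l * f y) + ennreal (\<beta> ^ 2) * (ennreal (f y) * ennreal (osc y x * ?m * g x))"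
          using nn by (subst ennreal_plus) (auto simp only: ennreal_mult mult_nonneg_nonneg powr_ge_zero zero_le_power beta_pos)
        finally show ?thesis using False nn by (simp add: F_def G_def ennreal_mult)
      qed simp
    qed
    also have "\<dots> = (\<integral>\<^sup>+y. ennreal (g x) * F x y \<partial>\<mu>) + (\<integral>\<^sup>+y. ennreal (\<beta> ^ 2) * (ennreal (f y) * G x y) \<partial>\<mu>)"
      by (rule nn_integral_add) measurable
    also have "\<dots> = ennreal (g x) * (\<integral>\<^sup>+y. F x y \<partial>\<mu>) + ennreal (\<beta> ^ 2) * (\<integral>\<^sup>+y. ennreal (f y) * G x y \<partial>\<mu>)"
      by (intro arg_cong2[where f = "(+)"] nn_integral_cmult) measurable
    finally show ?thesis .
  qed
  have FI [measurable]: "(\<lambda>x. \<integral>\<^sup>+y. F x y \<partial>\<mu>) \<in> borel_measurable \<mu>"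
    using sf.borel_measurable_nn_integral_fst[OF Fm] by simp
  have GI [measurable]: "(\<lambda>x. \<integral>\<^sup>+y. ennreal (f y) * G x y \<partial>\<mu>) \<in> borel_measurable \<mu>"
  proof -
    have "(\<lambda>p. ennreal (f (snd p)) * G (fst p) (snd p)) \<in> borel_measurable (\<mu> \<Otimes>\<^sub>M \<mu>)" by measurable
    from sf.borel_measurable_nn_integral_fst[OF this] show ?thesis by simp
  qed
  have "(\<integral>\<^sup>+x. ennreal (g x) * Tb \<theta> f x \<partial>\<mu>) \<le>
     (\<integral>\<^sup>+x. ennreal (g x) * (\<integral>\<^sup>+y. F x y \<partial>\<mu>) + ennreal (\<beta> ^ 2) * (\<integral>\<^sup>+y. ennreal (f y) * G x y \<partial>\<mu>) \<partial>\<mu>)"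
    by (intro nn_integral_mono Tle)
  also have "\<dots> = (\<integral>\<^sup>+x. ennreal (g x) * (\<integral>\<^sup>+y. F x y \<partial>\<mu>) \<partial>\<mu>) + ennreal (\<beta> ^ 2) * (\<integral>\<^sup>+x. \<integral>\<^sup>+y. ennreal (f y) * G x y \<partial>\<mu> \<partial>\<mu>)"
    by (subst nn_integral_add, measurable) (subst nn_integral_cmult, measurable)
  also have "(\<integral>\<^sup>+x. ennreal (g x) * (\<integral>\<^sup>+y. F x y \<partial>\<mu>) \<partial>\<mu>) = (\<integral>\<^sup>+x. ennreal (g x) * hop \<theta> f x \<partial>\<mu>)"
    by (simp add: hop_def F_def)
  also have "(\<integral>\<^sup>+x. \<integral>\<^sup>+y. ennreal (f y) * G x y \<partial>\<mu> \<partial>\<mu>) = (\<integral>\<^sup>+y. ennreal (f y) * hop \<theta> g y \<partial>\<mu>)"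
  proof -
    have m: "(\<lambda>(x, y). ennreal (f y) * G x y) \<in> borel_measurable (\<mu> \<Otimes>\<^sub>M \<mu>)"
      unfolding case_prod_beta' by measurable
    have "(\<integral>\<^sup>+x. \<integral>\<^sup>+y. ennreal (f y) * G x y \<partial>\<mu> \<partial>\<mu>) = (\<integral>\<^sup>+y. \<integral>\<^sup>+x. ennreal (f y) * G x y \<partial>\<mu> \<partial>\<mu>)"
      using pf.Fubini'[OF m] by simp
    also have "\<dots> = (\<integral>\<^sup>+y. ennreal (f y) * hop \<theta> g y \<partial>\<mu>)"
    proof (rule nn_integral_cong)
      fix y
      show "(\<integral>\<^sup>+x. ennreal (f y) * G x y \<partial>\<mu>) = ennreal (f y) * hop \<theta> g y"
        unfolding hop_def G_def by (rule nn_integral_cmult) measurable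
    qed
    finally show ?thesis .
  qed
  also have "(\<integral>\<^sup>+x. ennreal (g x) * hop \<theta> f x \<partial>\<mu>) \<le> ennreal (z * (hop_norm_const \<theta> p a * D * v))"
  proof -
    have "(\<integral>\<^sup>+x. ennreal (g x) * hop \<theta> f x \<partial>\<mu>) \<le> (\<integral>\<^sup>+x. ennreal (g x * hf x) \<partial>\<mu>)"
      using hf(3) g0 hf(2) by (intro nn_integral_mono_AE) (auto elim!: eventually_mono simp: ennreal_mult intro: mult_left_mono)
    also have "\<dots> \<le> ennreal ((z powr q') powr (1 / q') * ((hop_norm_const \<theta> p a * D * v) powr q) powr (1 / q))"
      by (rule nn_integral_Holder[OF q'(1) qg _ g g0 hf(1,2) gz[folded q'_def] _ hf(4)]) (auto simp: q'(2))
    also have "(z powr q') powr (1 / q') = z" using q'(1) z by (rule powr_root_cancel)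
    also have "((hop_norm_const \<theta> p a * D * v) powr q) powr (1 / q) = hop_norm_const \<theta> p a * D * v"
      using hop_norm_const_nonneg[OF \<theta>, of a] D_nonneg v qg by (simp add: powr_powr)
    finally show ?thesis .
  qed
  also have "(\<integral>\<^sup>+y. ennreal (f y) * hop \<theta> g y \<partial>\<mu>) \<le> ennreal (v * (hop_norm_const \<theta> q' a * D * z))"
  proof -
    have "(\<integral>\<^sup>+x. ennreal (f x) * hop \<theta> g x \<partial>\<mu>) \<le> (\<integral>\<^sup>+x. ennreal (f x * hg x) \<partial>\<mu>)"
      using hg(3) f0 hg(2) by (intro nn_integral_mono_AE) (auto elim!: eventually_mono simp: ennreal_mult intro: mult_left_mono)
    also have "\<dots> \<le> ennreal ((v powr p) powr (1 / p) * ((hop_norm_const \<theta> q' a * D * z) powr p') powr (1 / p'))"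
      by (rule nn_integral_Holder[OF p p'(1) _ f f0 hg(1,2) fv _ hg(4)]) (auto simp: p'(2))
    also have "(v powr p) powr (1 / p) = v" using v p by (simp add: powr_powr)
    also have "((hop_norm_const \<theta> q' a * D * z) powr p') powr (1 / p') = hop_norm_const \<theta> q' a * D * z"
      using hop_norm_const_nonneg[OF \<theta>(1) \<theta>q(1), of a] D_nonneg z by (intro powr_root_cancel p'(1)) auto
    finally show ?thesis .
  qed
  also have "ennreal (z * (hop_norm_const \<theta> p a * D * v)) + ennreal (\<beta> ^ 2) * ennreal (v * (hop_norm_const \<theta> q' a * D * z))
      = ennreal (commutator_const \<theta> p q a * D * v * z)"
  proof -
    have nn: "0 \<le> z * (hop_norm_const \<theta> p a * D * v)" "0 \<le> v * (hop_norm_const \<theta> q' a * D * z)" "0 \<le> \<beta> ^ 2"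
      using hop_norm_const_nonneg[OF \<theta>, of a] hop_norm_const_nonneg[OF \<theta>(1) \<theta>q(1), of a] D_nonneg v z by auto
    have "ennreal (z * (hop_norm_const \<theta> p a * D * v)) + ennreal (\<beta> ^ 2) * ennreal (v * (hop_norm_const \<theta> q' a * D * z))
      = ennreal (z * (hop_norm_const \<theta> p a * D * v) + \<beta> ^ 2 * (v * (hop_norm_const \<theta> q' a * D * z)))"
      using nn by (simp only: ennreal_mult ennreal_plus mult_nonneg_nonneg)
    also have "z * (hop_norm_const \<theta> p a * D * v) + \<beta> ^ 2 * (v * (hop_norm_const \<theta> q' a * D * z)) = commutator_const \<theta> p q a * D * v * z"
      by (simp add: commutator_const_def q'_def algebra_simps)
    finally show ?thesis .
  qed
  finally show ?thesis by (simp add: mult_left_mono add_mono)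
qed

end

section \<open>Measurability of the commutator\<close>

context udspace
begin

text \<open>The values of \<open>K\<close> on the diagonal are arbitrary; replacing them by 0 turns
  measurability off the diagonal into joint measurability.\<close>

lemma measurable_kernel:
  assumes "(\<lambda>(x, y). K x y :: complex) \<in> borel_measurable (restrict_space (\<mu> \<Otimes>\<^sub>M \<mu>) {(x, y). x \<noteq> y})"
  shows "(\<lambda>p. indicator {p. fst p \<noteq> snd p} p *\<^sub>R K (fst p) (snd p)) \<in> borel_measurable (\<mu> \<Otimes>\<^sub>M \<mu>)"
proof -
  have eq: "{(x :: 'a, y). x \<noteq> y} = {p. fst p \<noteq> snd p}" by auto
  have "{p. fst p \<noteq> snd p} \<inter> space (\<mu> \<Otimes>\<^sub>M \<mu>) \<in> sets (\<mu> \<Otimes>\<^sub>M \<mu>)"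
    using sets_off_diag by (simp add: space_pair_measure)
  from borel_measurable_restrict_space_iff[OF this, of "\<lambda>(x, y). K x y"] assms
  show ?thesis unfolding eq by (simp add: case_prod_beta')
qed

lemma measurable_kernel_section:
  assumes K: "(\<lambda>(x, y). K x y :: complex) \<in> borel_measurable (restrict_space (\<mu> \<Otimes>\<^sub>M \<mu>) {(x, y). x \<noteq> y})"
  shows "(\<lambda>y. indicator (- {x}) y *\<^sub>R K x y) \<in> borel_measurable \<mu>"
proof -
  have "(\<lambda>y. indicator {p. fst p \<noteq> snd p} (x, y) *\<^sub>R K x y) \<in> borel_measurable \<mu>"
    using measurable_Pair2[OF measurable_kernel[OF K], of x] by simp
  moreover have "indicator {p. fst p \<noteq> snd p} (x, y) = (indicator (- {x}) y :: real)" for y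
    by (auto simp: indicator_def)
  ultimately show ?thesis by simp
qed

lemma measurable_frac_integral:
  assumes K: "(\<lambda>(x, y). K x y :: complex) \<in> borel_measurable (restrict_space (\<mu> \<Otimes>\<^sub>M \<mu>) {(x, y). x \<noteq> y})"
    and f: "f \<in> borel_measurable \<mu>"
  shows "frac_integral \<mu> K f \<in> borel_measurable \<mu>"
proof -
  have "(\<lambda>p. (indicator {p. fst p \<noteq> snd p} p *\<^sub>R K (fst p) (snd p)) * f (snd p)) \<in> borel_measurable (\<mu> \<Otimes>\<^sub>M \<mu>)"
    by (intro borel_measurable_times measurable_kernel K measurable_compose[OF measurable_snd f])
  moreover have "(indicator {p. fst p \<noteq> snd p} p *\<^sub>R K (fst p) (snd p)) * f (snd p) =
      (\<lambda>(x, y). indicator (- {x}) y *\<^sub>R (K x y * f y)) p" for p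
    by (cases p) (auto simp: indicator_def)
  ultimately have "(\<lambda>(x, y). indicator (- {x}) y *\<^sub>R (K x y * f y)) \<in> borel_measurable (\<mu> \<Otimes>\<^sub>M \<mu>)"
    by simp
  then show ?thesis unfolding frac_integral_def[abs_def] set_lebesgue_integral_def
    by (rule sf.borel_measurable_lebesgue_integral)
qed

lemma measurable_commutator:
  assumes K: "(\<lambda>(x, y). K x y :: complex) \<in> borel_measurable (restrict_space (\<mu> \<Otimes>\<^sub>M \<mu>) {(x, y). x \<noteq> y})"
    and f: "f \<in> borel_measurable \<mu>" and b: "b \<in> borel_measurable \<mu>"
  shows "commutator \<mu> b K f \<in> borel_measurable \<mu>"
  unfolding commutator_def[abs_def]
  by (intro borel_measurable_diff borel_measurable_times b measurable_frac_integral[OF K] f)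

end

section \<open>Lebesgue norms as nonnegative integrals\<close>

lemma in_Lp_nn:
  assumes "in_Lp p M f" "0 < p"
  shows "(\<integral>\<^sup>+y. ennreal (norm (f y) powr p) \<partial>M) = ennreal (Lp_norm p M f powr p)"
proof -
  have "(\<integral>\<^sup>+y. ennreal (norm (f y) powr p) \<partial>M) = ennreal (\<integral>y. norm (f y) powr p \<partial>M)"
    using assms by (intro nn_integral_eq_integral) (auto simp: in_Lp_def)
  also have "(\<integral>y. norm (f y) powr p \<partial>M) = Lp_norm p M f powr p"
    using assms by (simp add: Lp_norm_def powr_powr)
  finally show ?thesis .
qed

lemma in_LpI_nn:
  assumes "f \<in> borel_measurable M" "(\<integral>\<^sup>+y. ennreal (norm (f y) powr p) \<partial>M) \<le> ennreal (v powr p)" "0 < p" "0 \<le> v"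
  shows "in_Lp p M f" "Lp_norm p M f \<le> v"
proof -
  have int: "integrable M (\<lambda>y. norm (f y) powr p)"
  proof (rule integrableI_bounded)
    show "(\<lambda>y. norm (f y) powr p) \<in> borel_measurable M" using assms(1) by measurable
    show "(\<integral>\<^sup>+y. ennreal (norm (norm (f y) powr p)) \<partial>M) < \<infinity>"
      using le_less_trans[OF assms(2) ennreal_less_top] by simp
  qed
  then show "in_Lp p M f" using assms(1) by (simp add: in_Lp_def)
  have "ennreal (\<integral>y. norm (f y) powr p \<partial>M) \<le> ennreal (v powr p)"
    using assms(2) nn_integral_eq_integral[OF int] by simp
  then have "(\<integral>y. norm (f y) powr p \<partial>M) \<le> v powr p" by simp
  then have "Lp_norm p M f \<le> (v powr p) powr (1 / p)"
    unfolding Lp_norm_def using assms(3) by (intro powr_mono2) auto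
  also have "\<dots> = v" using assms by (simp add: powr_powr)
  finally show "Lp_norm p M f \<le> v" .
qed

context nhspace
begin

lemma commutator_const_nonneg:
  assumes "1 < p" "0 < \<theta>" "\<theta> < 1 / p" "1 / q = 1 / p - \<theta>"
  shows "0 \<le> commutator_const \<theta> p q a"
proof -
  have p1: "1 / p < 1" using assms by simp
  have q1: "0 < 1 / q" "1 / q < 1" using assms p1 by linarith+
  then have qg: "1 < q" by (simp add: divide_less_eq_1_pos zero_less_divide_1_iff)
  have "1 / (q / (q - 1)) = 1 - 1 / q" using qg by (simp add: field_simps)
  then have "\<theta> < 1 / (q / (q - 1))" using assms p1 by linarith
  then show ?thesis using hop_norm_const_nonneg assms by (simp add: commutator_const_def)
qed

end

section \<open>Norm estimates for the positive operator and the commutator\<close>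

context rbmo
begin

text \<open>Duality: the pairing is tested against \<open>(min (Tb \<theta> f) N)\<^sup>q\<^sup>-\<^sup>1\<close> on bounded sets.\<close>
lemma Tb_norm:
  fixes f :: "'a \<Rightarrow> real"
  assumes p: "1 < p" and \<theta>: "0 < \<theta>" "\<theta> < 1 / p" and q: "1 / q = 1 / p - \<theta>"
    and f: "f \<in> borel_measurable \<mu>" and f0: "\<And>y. 0 \<le> f y"
    and v: "0 \<le> v" and fv: "(\<integral>\<^sup>+y. ennreal (f y powr p) \<partial>\<mu>) \<le> ennreal (v powr p)"
  shows "AE x in \<mu>. Tb \<theta> f x < \<infinity>"
    "(\<integral>\<^sup>+x. ennreal (enn2real (Tb \<theta> f x) powr q) \<partial>\<mu>) \<le> ennreal ((commutator_const \<theta> p q a * D * v) powr q)"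
proof -
  fix o' :: 'a
  define X where "X = commutator_const \<theta> p q a * D * v"
  have X: "0 \<le> X" using commutator_const_nonneg[OF p \<theta> q] D_nonneg v by (simp add: X_def)
  have p1: "1 / p < 1" using p by simp
  have q1: "0 < 1 / q" "1 / q < 1" using q \<theta> p1 by linarith+
  then have qg: "1 < q" by (simp add: divide_less_eq_1_pos zero_less_divide_1_iff)
  have T [measurable]: "Tb \<theta> f \<in> borel_measurable \<mu>" using f by (rule measurable_Tb)
  \<comment> \<open>Truncation in height and in space makes the integral of
    \<open>u N x powr q\<close> finite beforehand, so that a power of it can be cancelled
    below.\<close>
  define u where "u N x = enn2real (min (Tb \<theta> f x) (ennreal (real N))) * indicator (ball o' (real N)) x" for N :: nat and x
  have u [measurable]: "u N \<in> borel_measurable \<mu>" for N unfolding u_def[abs_def] by measurable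
  have u0: "0 \<le> u N x" for N x by (simp add: u_def)
  have min_fin: "min (Tb \<theta> f x) (ennreal (real N)) < top" for x N by (simp add: min_less_iff_disj)
  have uT: "ennreal (u N x) \<le> Tb \<theta> f x" for N x
    using min_fin[of x N] by (auto simp: u_def indicator_def)
  have uN: "u N x \<le> real N * indicator (ball o' (real N)) x" for N x
  proof -
    have "enn2real (min (Tb \<theta> f x) (ennreal (real N))) \<le> enn2real (ennreal (real N))"
      by (intro enn2real_mono) auto
    then show ?thesis by (simp add: u_def indicator_def)
  qed
  have bound: "(\<integral>\<^sup>+x. ennreal (u N x powr q) \<partial>\<mu>) \<le> ennreal (X powr q)" for N
  proof -
    have "(\<integral>\<^sup>+x. ennreal (u N x powr q) \<partial>\<mu>) \<le> (\<integral>\<^sup>+x. ennreal (real N powr q) * indicator (ball o' (real N)) x \<partial>\<mu>)"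
    proof (rule nn_integral_mono)
      fix x
      have "u N x powr q \<le> (real N * indicator (ball o' (real N)) x) powr q"
        using uN u0 qg by (intro powr_mono2) auto
      then show "ennreal (u N x powr q) \<le> ennreal (real N powr q) * indicator (ball o' (real N)) x"
        using qg by (auto simp: indicator_def ennreal_leI split: if_splits)
    qed
    also have "\<dots> = ennreal (real N powr q) * emeasure \<mu> (ball o' (real N))"
      by (rule nn_integral_cmult_indicator) simp
    also have "\<dots> < top" by (simp add: ennreal_mult_less_top)
    finally obtain i where i: "(\<integral>\<^sup>+x. ennreal (u N x powr q) \<partial>\<mu>) = ennreal i" "0 \<le> i"
      by (cases "\<integral>\<^sup>+x. ennreal (u N x powr q) \<partial>\<mu>") auto
    define q' where "q' = q / (q - 1)"
    have q': "1 < q'" "1 / q' = 1 - 1 / q" using qg by (auto simp: q'_def field_simps)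
    \<comment> \<open>The extremal function for Hoelder's inequality: its conjugate power and its
      product with \<open>u N\<close> both equal \<open>u N x powr q\<close>.\<close>
    define g where "g x = u N x powr (q - 1)" for x
    have g: "g \<in> borel_measurable \<mu>" "0 \<le> g x" for x unfolding g_def[abs_def] by measurable
    have gq: "g x powr q' = u N x powr q" for x using qg by (simp add: g_def q'_def powr_powr)
    define z where "z = i powr (1 / q')"
    have zq: "z powr q' = i" using q'(1) i(2) by (simp add: z_def powr_powr)
    have "ennreal i = (\<integral>\<^sup>+x. ennreal (g x * u N x) \<partial>\<mu>)"
    proof -
      have "u N x powr q = g x * u N x" for x
      proof (cases "u N x = 0")
        case False
        then have "0 < u N x" using u0[of N x] by simp
        then have "u N x powr (q - 1) * u N x powr 1 = u N x powr q" "u N x powr 1 = u N x"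
          by (simp_all only: powr_add[symmetric]) simp_all
        then show ?thesis by (simp add: g_def)
      qed simp
      then show ?thesis using i(1) by simp
    qed
    also have "\<dots> \<le> (\<integral>\<^sup>+x. ennreal (g x) * Tb \<theta> f x \<partial>\<mu>)"
      using g(2) u0 by (intro nn_integral_mono) (simp add: ennreal_mult mult_left_mono uT)
    also have "\<dots> \<le> ennreal (X * z)" unfolding X_def
    proof (rule Tb_pairing[OF p \<theta> q f f0 v fv g])
      show "(\<integral>\<^sup>+y. ennreal (g y powr (q / (q - 1))) \<partial>\<mu>) \<le> ennreal (z powr (q / (q - 1)))"
        unfolding q'_def[symmetric] gq zq using i by simp
      show "0 \<le> z" by (simp add: z_def)
    qed
    finally have iX: "i \<le> X * z" using X by (subst (asm) ennreal_le_iff) (auto simp: z_def)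
    have "i \<le> X powr q"
    proof (cases "i = 0")
      case False
      then have i0: "0 < i" using i by simp
      have "i = i powr (1 / q) * z"
        unfolding z_def q'(2) using i0 by (simp add: powr_add[symmetric])
      then have "i powr (1 / q) * z \<le> X * z" using iX by simp
      then have "i powr (1 / q) \<le> X" using i0 by (simp add: z_def)
      then have "(i powr (1 / q)) powr q \<le> X powr q" using qg by (intro powr_mono2) auto
      then show ?thesis using i0 qg by (simp add: powr_powr)
    qed simp
    then show ?thesis unfolding i(1) by (rule ennreal_leI)
  qed
  define \<Phi> where "\<Phi> x = (SUP N. ennreal (u N x powr q))" for x
  have \<Phi> [measurable]: "\<Phi> \<in> borel_measurable \<mu>" unfolding \<Phi>_def[abs_def] by measurable
  have "(\<integral>\<^sup>+x. \<Phi> x \<partial>\<mu>) = (SUP N. \<integral>\<^sup>+x. ennreal (u N x powr q) \<partial>\<mu>)"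
    unfolding \<Phi>_def
  proof (rule nn_integral_monotone_convergence_SUP)
    have "u M x \<le> u N x" if "M \<le> N" for M N x
    proof -
      have "enn2real (min (Tb \<theta> f x) (ennreal (real M))) \<le> enn2real (min (Tb \<theta> f x) (ennreal (real N)))"
        using that min_fin by (intro enn2real_mono min.mono ennreal_leI) auto
      moreover have "(indicator (ball o' (real M)) x :: real) \<le> indicator (ball o' (real N)) x"
        using that by (auto simp: indicator_def)
      ultimately show ?thesis unfolding u_def by (intro mult_mono) auto
    qed
    then show "incseq (\<lambda>N x. ennreal (u N x powr q))"
      using u0 qg by (auto simp: incseq_def le_fun_def intro!: ennreal_leI powr_mono2)
  qed measurable
  also have "\<dots> \<le> ennreal (X powr q)" by (rule SUP_least) (rule bound)
  finally have \<Phi>X: "(\<integral>\<^sup>+x. \<Phi> x \<partial>\<mu>) \<le> ennreal (X powr q)" .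
  have large: "\<exists>N0. \<forall>N\<ge>N0. u N x = enn2real (min (Tb \<theta> f x) (ennreal (real N)))" for x
  proof -
    obtain n where n: "dist o' x < real n" using reals_Archimedean2 by blast
    show ?thesis by (rule exI[of _ n]) (use n in \<open>auto simp: u_def\<close>)
  qed
  have "(\<integral>\<^sup>+x. \<Phi> x \<partial>\<mu>) \<noteq> \<infinity>" using \<Phi>X by (auto simp: top_unique)
  then have "AE x in \<mu>. \<Phi> x \<noteq> \<infinity>" by (intro nn_integral_PInf_AE \<Phi>)
  then show "AE x in \<mu>. Tb \<theta> f x < \<infinity>"
  proof eventually_elim
    case (elim x)
    show ?case
    proof (rule ccontr)
      assume "\<not> ?case"
      then have inf: "Tb \<theta> f x = top" by (simp add: less_top[symmetric])
      obtain N0 where N0: "\<And>N. N \<ge> N0 \<Longrightarrow> u N x = enn2real (min (Tb \<theta> f x) (ennreal (real N)))"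
        using large by blast
      obtain m where m: "\<Phi> x = ennreal m" "0 \<le> m" using elim by (cases "\<Phi> x") auto
      obtain n where n: "m < real n" using reals_Archimedean2 by blast
      define N where "N = Suc (max n N0)"
      have "u N x = real N" using N0[of N] by (simp add: inf N_def)
      then have "ennreal (real N powr q) \<le> \<Phi> x" unfolding \<Phi>_def by (metis SUP_upper UNIV_I)
      then have "real N powr q \<le> m" using m by simp
      moreover have "real N powr 1 \<le> real N powr q" using qg by (intro powr_mono) (auto simp: N_def)
      moreover have "real n < real N" by (simp add: N_def)
      ultimately show False using n by simp
    qed
  qed
  \<comment> \<open>Where \<open>Tb\<close> is infinite, \<open>enn2real\<close> returns 0; by the
    first conclusion this concerns only a null set.\<close>
  have "(\<integral>\<^sup>+x. ennreal (enn2real (Tb \<theta> f x) powr q) \<partial>\<mu>) \<le> (\<integral>\<^sup>+x. \<Phi> x \<partial>\<mu>)"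
  proof (rule nn_integral_mono)
    fix x
    show "ennreal (enn2real (Tb \<theta> f x) powr q) \<le> \<Phi> x"
    proof (cases "Tb \<theta> f x")
      case (real t)
      obtain N0 where N0: "\<And>N. N \<ge> N0 \<Longrightarrow> u N x = enn2real (min (Tb \<theta> f x) (ennreal (real N)))"
        using large by blast
      obtain n where n: "t < real n" using reals_Archimedean2 by blast
      define N where "N = max n N0"
      have "t \<le> real N" using n by (simp add: N_def)
      then have "min (Tb \<theta> f x) (ennreal (real N)) = ennreal t" using real by (simp add: min_def ennreal_leI)
      then have "u N x = t" using N0[of N] real by (simp add: N_def)
      then have "ennreal (t powr q) \<le> \<Phi> x" unfolding \<Phi>_def by (metis SUP_upper UNIV_I)
      then show ?thesis using real by simp
    qed simp
  qed
  also have "\<dots> \<le> ennreal (X powr q)" by (rule \<Phi>X)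
  finally show "(\<integral>\<^sup>+x. ennreal (enn2real (Tb \<theta> f x) powr q) \<partial>\<mu>) \<le> ennreal ((commutator_const \<theta> p q a * D * v) powr q)"
    by (simp add: X_def)
qed

text \<open>\<open>L \<le> lam\<close> and the exponent \<theta> - 1 is negative, so the kernel is
  dominated by that of \<open>Tb\<close>. Absolute convergence of both integrals is established
  pointwise first, since only then may the commutator be written as one integral with the factor b x
  - b y.\<close>

lemma commutator_bound:
  fixes f :: "'a \<Rightarrow> complex"
  assumes p: "1 < p" and \<theta>: "0 < \<theta>" "\<theta> < 1 / p" and q: "1 / q = 1 / p - \<theta>"
    and K: "(\<lambda>(x, y). K x y :: complex) \<in> borel_measurable (restrict_space (\<mu> \<Otimes>\<^sub>M \<mu>) {(x, y). x \<noteq> y})"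
    and Ck: "0 < Ck" "\<And>x y. x \<noteq> y \<Longrightarrow> norm (K x y) \<le> Ck / lam x (dist x y) powr (1 - \<theta>)"
    and f: "in_Lp p \<mu> f"
  shows "AE x in \<mu>. frac_integral_converges \<mu> K f x \<and> frac_integral_converges \<mu> K (\<lambda>y. b y * f y) x"
    and "in_Lp q \<mu> (commutator \<mu> b K f)"
    and "Lp_norm q \<mu> (commutator \<mu> b K f) \<le> Ck * commutator_const \<theta> p q a * D * Lp_norm p \<mu> f"
proof -
  define v where "v = Lp_norm p \<mu> f"
  have v: "0 \<le> v" by (simp add: v_def Lp_norm_def)
  have f_meas [measurable]: "f \<in> borel_measurable \<mu>" using f by (simp add: in_Lp_def)
  define F where "F y = norm (f y)" for y
  have F [measurable]: "F \<in> borel_measurable \<mu>" unfolding F_def[abs_def] by measurable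
  have F0: "0 \<le> F y" for y by (simp add: F_def)
  have Fv: "(\<integral>\<^sup>+y. ennreal (F y powr p) \<partial>\<mu>) \<le> ennreal (v powr p)"
    using in_Lp_nn[OF f] p by (simp add: F_def v_def)
  have p1: "1 / p < 1" using p by simp
  have \<theta>1: "\<theta> < 1" using \<theta> p1 by linarith
  have q1: "0 < 1 / q" using q \<theta> by linarith
  then have q0: "0 < q" by (simp add: zero_less_divide_1_iff)
  define \<kappa> where "\<kappa> x y = L (lev x y) x powr (\<theta> - 1)" for x y
  have \<kappa>0: "0 \<le> \<kappa> x y" for x y by (simp add: \<kappa>_def)
  have K_le: "norm (K x y) \<le> Ck * \<kappa> x y" if "x \<noteq> y" for x y
  proof -
    have "L (lev x y) x \<le> lam x (pow6 (lev x y))" by (rule L_le_lam)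
    also have "\<dots> \<le> lam x (dist x y)" using lev_iff[OF that] by (intro lam_mono) auto
    finally have "L (lev x y) x \<le> lam x (dist x y)" .
    then have "lam x (dist x y) powr (\<theta> - 1) \<le> \<kappa> x y"
      unfolding \<kappa>_def using \<theta>1 by (intro powr_mono2') auto
    moreover have "1 / lam x (dist x y) powr (1 - \<theta>) = lam x (dist x y) powr (\<theta> - 1)"
      using powr_minus_divide[of "lam x (dist x y)" "1 - \<theta>"] by simp
    ultimately have "Ck * (1 / lam x (dist x y) powr (1 - \<theta>)) \<le> Ck * \<kappa> x y"
      using Ck(1) by (intro mult_left_mono) auto
    then show ?thesis using Ck(2)[OF that] by simp
  qed
  have Kx [measurable]: "(\<lambda>y. indicator (- {x}) y *\<^sub>R K x y) \<in> borel_measurable \<mu>" for x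
    using K by (rule measurable_kernel_section)
  obtain h where h: "AE x in \<mu>. hop \<theta> F x \<le> ennreal (h x)"
    using hop_norm[OF p \<theta> q F F0 v Fv] by blast
  have AD: "0 < near_const * D" using near_const_ge D_pos by simp
  define J where "J x = (\<integral>\<^sup>+y\<in>- {x}. ennreal (\<kappa> x y * F y) \<partial>\<mu>)" for x
  have Kf_nn: "(\<integral>\<^sup>+y. ennreal (norm (indicator (- {x}) y *\<^sub>R (K x y * f y))) \<partial>\<mu>) \<le> ennreal Ck * J x" for x
  proof -
    have "(\<integral>\<^sup>+y. ennreal (norm (indicator (- {x}) y *\<^sub>R (K x y * f y))) \<partial>\<mu>) \<le>
       (\<integral>\<^sup>+y. ennreal Ck * (ennreal (\<kappa> x y * F y) * indicator (- {x}) y) \<partial>\<mu>)"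
    proof (rule nn_integral_mono)
      fix y
      show "ennreal (norm (indicator (- {x}) y *\<^sub>R (K x y * f y))) \<le> ennreal Ck * (ennreal (\<kappa> x y * F y) * indicator (- {x}) y)"
      proof (cases "y = x")
        case False
        then have "norm (K x y * f y) \<le> Ck * \<kappa> x y * F y"
          unfolding norm_mult F_def by (intro mult_right_mono K_le) auto
        then show ?thesis using False Ck(1) \<kappa>0[of x y] F0[of y]
          by (simp add: ennreal_mult[symmetric] mult.assoc ennreal_leI)
      qed simp
    qed
    also have "\<dots> = ennreal Ck * J x"
      unfolding J_def \<kappa>_def by (rule nn_integral_cmult) measurable
    finally show ?thesis .
  qed
  \<comment> \<open>\<open>osc\<close> is at least \<open>near_const * D > 0\<close>, so the
    integral without \<open>osc\<close> is dominated by a multiple of \<open>hop\<close>.\<close>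
  have J_fin: "J x < \<infinity>" if "hop \<theta> F x \<le> ennreal t" for x t
  proof -
    have "J x \<le> (\<integral>\<^sup>+y. ennreal (1 / (near_const * D)) * (ennreal (osc x y * \<kappa> x y * F y) * indicator (- {x}) y) \<partial>\<mu>)"
      unfolding J_def
    proof (rule nn_integral_mono)
      fix y
      have "near_const * D \<le> osc x y" by (simp add: osc_def)
      then have "near_const * D * (\<kappa> x y * F y) \<le> osc x y * (\<kappa> x y * F y)"
        using \<kappa>0[of x y] F0[of y] by (intro mult_right_mono) auto
      then have "\<kappa> x y * F y \<le> 1 / (near_const * D) * (osc x y * \<kappa> x y * F y)"
        using AD by (simp add: pos_le_divide_eq mult_ac)
      then show "ennreal (\<kappa> x y * F y) * indicator (- {x}) y \<le>
          ennreal (1 / (near_const * D)) * (ennreal (osc x y * \<kappa> x y * F y) * indicator (- {x}) y)"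
        using AD osc_nonneg[of x y] \<kappa>0[of x y] F0[of y]
        by (auto simp: indicator_def ennreal_mult[symmetric] intro!: ennreal_leI)
    qed
    also have "\<dots> = ennreal (1 / (near_const * D)) * hop \<theta> F x"
      unfolding hop_def \<kappa>_def by (rule nn_integral_cmult) measurable
    also have "\<dots> \<le> ennreal (1 / (near_const * D)) * ennreal t" using that by (intro mult_left_mono) auto
    also have "\<dots> < \<infinity>" by (simp add: ennreal_mult_less_top)
    finally show ?thesis .
  qed
  have bK_nn: "(\<integral>\<^sup>+y. ennreal (norm (indicator (- {x}) y *\<^sub>R ((b x - b y) * (K x y * f y)))) \<partial>\<mu>) \<le> ennreal Ck * Tb \<theta> F x" for x
  proof -
    have "(\<integral>\<^sup>+y. ennreal (norm (indicator (- {x}) y *\<^sub>R ((b x - b y) * (K x y * f y)))) \<partial>\<mu>) \<le>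
       (\<integral>\<^sup>+y. ennreal Ck * (ennreal (norm (b x - b y) * \<kappa> x y * F y) * indicator (- {x}) y) \<partial>\<mu>)"
    proof (rule nn_integral_mono)
      fix y
      show "ennreal (norm (indicator (- {x}) y *\<^sub>R ((b x - b y) * (K x y * f y)))) \<le>
         ennreal Ck * (ennreal (norm (b x - b y) * \<kappa> x y * F y) * indicator (- {x}) y)"
      proof (cases "y = x")
        case False
        then have "norm (K x y * f y) \<le> Ck * \<kappa> x y * F y"
          unfolding norm_mult F_def by (intro mult_right_mono K_le) auto
        then have "norm (b x - b y) * norm (K x y * f y) \<le> norm (b x - b y) * (Ck * \<kappa> x y * F y)"
          by (rule mult_left_mono) simp
        also have "\<dots> = Ck * (norm (b x - b y) * \<kappa> x y * F y)" by (simp add: mult_ac)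
        finally have "norm ((b x - b y) * (K x y * f y)) \<le> Ck * (norm (b x - b y) * \<kappa> x y * F y)"
          by (simp only: norm_mult)
        then show ?thesis using False Ck(1) \<kappa>0[of x y] F0[of y]
          by (simp add: ennreal_mult[symmetric] ennreal_leI del: norm_mult_ineq)
      qed simp
    qed
    also have "\<dots> = ennreal Ck * Tb \<theta> F x"
      unfolding Tb_def \<kappa>_def by (rule nn_integral_cmult) measurable
    finally show ?thesis .
  qed
  have good: "frac_integral_converges \<mu> K f x \<and> frac_integral_converges \<mu> K (\<lambda>y. b y * f y) x \<and>
      norm (commutator \<mu> b K f x) \<le> Ck * enn2real (Tb \<theta> F x)"
    if hx: "hop \<theta> F x \<le> ennreal (h x)" and Tx: "Tb \<theta> F x < \<infinity>" for x
  proof -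
    have m: "(\<lambda>y. indicator (- {x}) y *\<^sub>R (K x y * f y)) \<in> borel_measurable \<mu>"
    proof -
      have "(\<lambda>y. (indicator (- {x}) y *\<^sub>R K x y) * f y) \<in> borel_measurable \<mu>"
        by (intro borel_measurable_times Kx f_meas)
      then show ?thesis by simp
    qed
    have i1: "integrable \<mu> (\<lambda>y. indicator (- {x}) y *\<^sub>R (K x y * f y))"
    proof (rule integrableI_bounded[OF m])
      have "ennreal Ck * J x < \<infinity>" using J_fin[OF hx] by (simp add: ennreal_mult_less_top)
      then show "(\<integral>\<^sup>+y. ennreal (norm (indicator (- {x}) y *\<^sub>R (K x y * f y))) \<partial>\<mu>) < \<infinity>"
        using Kf_nn[of x] by (rule le_less_trans[rotated])
    qed
    have m2: "(\<lambda>y. indicator (- {x}) y *\<^sub>R ((b x - b y) * (K x y * f y))) \<in> borel_measurable \<mu>"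
    proof -
      have "(\<lambda>y. (b x - b y) * (indicator (- {x}) y *\<^sub>R (K x y * f y))) \<in> borel_measurable \<mu>"
        using m by measurable
      then show ?thesis by simp
    qed
    have i2: "integrable \<mu> (\<lambda>y. indicator (- {x}) y *\<^sub>R ((b x - b y) * (K x y * f y)))"
    proof (rule integrableI_bounded[OF m2])
      have "ennreal Ck * Tb \<theta> F x < \<infinity>" using Tx by (simp add: ennreal_mult_less_top)
      then show "(\<integral>\<^sup>+y. ennreal (norm (indicator (- {x}) y *\<^sub>R ((b x - b y) * (K x y * f y)))) \<partial>\<mu>) < \<infinity>"
        using bK_nn[of x] by (rule le_less_trans[rotated])
    qed
    \<comment> \<open>Writing b y = b x - (b x - b y) reduces this to the two integrable functions
      above.\<close>
    have i3: "integrable \<mu> (\<lambda>y. indicator (- {x}) y *\<^sub>R (K x y * (b y * f y)))"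
    proof -
      have "integrable \<mu> (\<lambda>y. b x * (indicator (- {x}) y *\<^sub>R (K x y * f y)) - indicator (- {x}) y *\<^sub>R ((b x - b y) * (K x y * f y)))"
        using i1 i2 by (intro Bochner_Integration.integrable_diff integrable_mult_right)
      also have "(\<lambda>y. b x * (indicator (- {x}) y *\<^sub>R (K x y * f y)) - indicator (- {x}) y *\<^sub>R ((b x - b y) * (K x y * f y))) =
         (\<lambda>y. indicator (- {x}) y *\<^sub>R (K x y * (b y * f y)))"
        by (auto simp: indicator_def algebra_simps)
      finally show ?thesis .
    qed
    have "commutator \<mu> b K f x = b x * (\<integral>y. indicator (- {x}) y *\<^sub>R (K x y * f y) \<partial>\<mu>) - (\<integral>y. indicator (- {x}) y *\<^sub>R (K x y * (b y * f y)) \<partial>\<mu>)"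
      unfolding commutator_def frac_integral_def set_lebesgue_integral_def ..
    also have "b x * (\<integral>y. indicator (- {x}) y *\<^sub>R (K x y * f y) \<partial>\<mu>) = (\<integral>y. b x * (indicator (- {x}) y *\<^sub>R (K x y * f y)) \<partial>\<mu>)"
      by (rule integral_mult_right_zero[symmetric])
    also have "\<dots> - (\<integral>y. indicator (- {x}) y *\<^sub>R (K x y * (b y * f y)) \<partial>\<mu>) =
      (\<integral>y. b x * (indicator (- {x}) y *\<^sub>R (K x y * f y)) - indicator (- {x}) y *\<^sub>R (K x y * (b y * f y)) \<partial>\<mu>)"
      by (rule Bochner_Integration.integral_diff[symmetric, OF integrable_mult_right[OF i1] i3])
    also have "(\<lambda>y. b x * (indicator (- {x}) y *\<^sub>R (K x y * f y)) - indicator (- {x}) y *\<^sub>R (K x y * (b y * f y))) =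
         (\<lambda>y. indicator (- {x}) y *\<^sub>R ((b x - b y) * (K x y * f y)))"
      by (auto simp: indicator_def algebra_simps)
    finally have "ennreal (norm (commutator \<mu> b K f x)) \<le>
       (\<integral>\<^sup>+y. ennreal (norm (indicator (- {x}) y *\<^sub>R ((b x - b y) * (K x y * f y)))) \<partial>\<mu>)"
      using integral_norm_bound_ennreal[OF i2] by simp
    also have "\<dots> \<le> ennreal Ck * Tb \<theta> F x" by (rule bK_nn)
    also have "\<dots> = ennreal (Ck * enn2real (Tb \<theta> F x))"
      using Tx Ck(1) by (simp add: ennreal_mult)
    finally have "norm (commutator \<mu> b K f x) \<le> Ck * enn2real (Tb \<theta> F x)"
      using Ck(1) by (subst (asm) ennreal_le_iff) auto
    then show ?thesis using i1 i3 by (simp add: frac_integral_converges_def set_integrable_def)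
  qed
  note T = Tb_norm[OF p \<theta> q F F0 v Fv]
  have ae: "AE x in \<mu>. frac_integral_converges \<mu> K f x \<and> frac_integral_converges \<mu> K (\<lambda>y. b y * f y) x \<and>
      norm (commutator \<mu> b K f x) \<le> Ck * enn2real (Tb \<theta> F x)"
    using h T(1) by eventually_elim (rule good)
  then show "AE x in \<mu>. frac_integral_converges \<mu> K f x \<and> frac_integral_converges \<mu> K (\<lambda>y. b y * f y) x"
    by eventually_elim blast
  have Tm [measurable]: "Tb \<theta> F \<in> borel_measurable \<mu>" by (rule measurable_Tb[OF F])
  have X: "0 \<le> Ck * (commutator_const \<theta> p q a * D * v)" using Ck(1) commutator_const_nonneg[OF p \<theta> q] D_nonneg v by simp
  have "(\<integral>\<^sup>+x. ennreal (norm (commutator \<mu> b K f x) powr q) \<partial>\<mu>) \<le>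
     (\<integral>\<^sup>+x. ennreal (Ck powr q) * ennreal (enn2real (Tb \<theta> F x) powr q) \<partial>\<mu>)"
    using ae
  proof (intro nn_integral_mono_AE, eventually_elim)
    case (elim x)
    then have "norm (commutator \<mu> b K f x) powr q \<le> (Ck * enn2real (Tb \<theta> F x)) powr q"
      using q0 by (intro powr_mono2) auto
    then show ?case using Ck(1) by (simp add: ennreal_mult[symmetric] powr_mult ennreal_leI)
  qed
  also have "\<dots> = ennreal (Ck powr q) * (\<integral>\<^sup>+x. ennreal (enn2real (Tb \<theta> F x) powr q) \<partial>\<mu>)"
    by (rule nn_integral_cmult) measurable
  also have "\<dots> \<le> ennreal (Ck powr q) * ennreal ((commutator_const \<theta> p q a * D * v) powr q)"
    by (intro mult_left_mono T(2)) simp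
  also have "\<dots> = ennreal ((Ck * (commutator_const \<theta> p q a * D * v)) powr q)"
    using Ck(1) commutator_const_nonneg[OF p \<theta> q, of a] D_nonneg v by (simp add: ennreal_mult[symmetric] powr_mult)
  finally have fin: "(\<integral>\<^sup>+x. ennreal (norm (commutator \<mu> b K f x) powr q) \<partial>\<mu>) \<le> ennreal ((Ck * (commutator_const \<theta> p q a * D * v)) powr q)" .
  note res = in_LpI_nn[OF measurable_commutator[OF K f_meas b_measurable] fin q0 X]
  show "in_Lp q \<mu> (commutator \<mu> b K f)" by (rule res(1))
  show "Lp_norm q \<mu> (commutator \<mu> b K f) \<le> Ck * commutator_const \<theta> p q a * D * Lp_norm p \<mu> f"
    using res(2) by (simp add: v_def mult.assoc)
qed

end

lemma Lp_norm_null_measure: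
  assumes "emeasure M (space M) = 0" "0 < p"
  shows "Lp_norm p M f = 0" "f \<in> borel_measurable M \<Longrightarrow> in_Lp p M f" "AE x in M. P x"
proof -
  have ae: "AE x in M. Q x" for Q
    using assms(1) by (intro AE_I'[of "space M"]) (auto simp: null_sets_def)
  show "AE x in M. P x" by (rule ae)
  have "(\<integral>x. norm (f x) powr p \<partial>M) = 0" by (rule integral_eq_zero_AE) (rule ae)
  then show "Lp_norm p M f = 0" using assms(2) by (simp add: Lp_norm_def)
  assume f: "f \<in> borel_measurable M"
  have "(\<integral>\<^sup>+x. ennreal (norm (f x) powr p) \<partial>M) = (\<integral>\<^sup>+x. 0 \<partial>M)" by (rule nn_integral_cong_AE) (rule ae)
  then show "in_Lp p M f" using f assms(2) by (intro in_LpI_nn[of f M p 0]) auto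
qed

theorem theorem1p2:
  fixes \<mu> :: "'a::metric_space measure"
    and lam :: "'a \<Rightarrow> real \<Rightarrow> real"
    and C_lam \<beta>\<^sub>0 \<rho> n \<alpha> \<epsilon> p q :: real
    and N0 :: nat
    and K :: "'a \<Rightarrow> 'a \<Rightarrow> complex"
  assumes "geometrically_doubling TYPE('a) N0"
    and "n = geometric_dim N0"
    and "upper_doubling \<mu> lam C_lam"
    and "\<exists>C. \<forall>x y r. 0 < r \<longrightarrow> dist x y \<le> r \<longrightarrow> lam x r \<le> C * lam y r"
    and "max (C_lam powr (3 * log 2 6)) (6 powr n) < \<beta>\<^sub>0"
    and "1 < \<rho>"
    and "0 < \<alpha>" "\<alpha> < n"
    and "1 < p" "p < n / \<alpha>"
    and "1 / q = 1 / p - \<alpha> / n"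
    and "0 < \<epsilon>" "\<epsilon> \<le> 1"
    and "fractional_kernel \<mu> lam n \<alpha> \<epsilon> K"
  shows "\<exists>C>0. \<forall>b \<in> RBMO \<mu> lam \<beta>\<^sub>0 \<rho>. \<forall>f. in_Lp p \<mu> f \<longrightarrow>
           (AE x in \<mu>. frac_integral_converges \<mu> K f x \<and>
                        frac_integral_converges \<mu> K (\<lambda>y. b y * f y) x) \<and>
           in_Lp q \<mu> (commutator \<mu> b K f) \<and>
           Lp_norm q \<mu> (commutator \<mu> b K f)
             \<le> C * RBMO_norm \<mu> lam \<beta>\<^sub>0 \<rho> b * Lp_norm p \<mu> f"
proof -
  define \<theta> where "\<theta> = \<alpha> / n"
  have n: "0 < n" using assms(7,8) by simp
  \<comment> \<open>N0 = 0 would leave a ball uncovered, and N0 = 1 would give dimension 0, contrary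
    to 0 < \<alpha> < n.\<close>
  have N0: "2 \<le> N0"
  proof (rule ccontr)
    assume "\<not> 2 \<le> N0"
    moreover have "N0 \<noteq> 0"
    proof
      assume "N0 = 0"
      moreover obtain S :: "'a set" where S: "finite S" "card S \<le> N0"
        "ball undefined 1 \<subseteq> (\<Union>y\<in>S. ball y (1 / 2))"
        using assms(1)[unfolded geometrically_doubling_def, rule_format, of 1 undefined] by auto
      ultimately have "S = {}" by simp
      then show False using S(3) centre_in_ball[of "undefined :: 'a" 1] by auto
    qed
    ultimately have "N0 = 1" by simp
    then show False using n assms(2) by (simp add: geometric_dim_def)
  qed
  have \<theta>: "0 < \<theta>" "\<theta> < 1 / p" using assms(7,9,10) n by (simp_all add: \<theta>_def field_simps)
  have q: "1 / q = 1 / p - \<theta>" using assms(11) by (simp add: \<theta>_def)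
  have q0: "0 < q" using q \<theta> by (metis diff_gt_0_iff_gt zero_less_divide_1_iff)
  have K: "(\<lambda>(x, y). K x y) \<in> borel_measurable (restrict_space (\<mu> \<Otimes>\<^sub>M \<mu>) {(x, y). x \<noteq> y})"
    using assms(14) by (simp add: fractional_kernel_def L1_loc_on_def)
  from assms(14)[unfolded fractional_kernel_def, folded \<theta>_def]
  obtain Ck where Ck1: "\<forall>x y. x \<noteq> y \<longrightarrow> norm (K x y) \<le> Ck / lam x (dist x y) powr (1 - \<theta>)"
    and Ck0: "0 < Ck"
    by (elim conjE exE) (rule that)
  note Ck = Ck0 Ck1[rule_format]
  interpret ud: udspace \<mu> lam C_lam \<beta>\<^sub>0 N0
    using assms N0 by unfold_locales auto
  have loc: "ud.loc b" if "b \<in> RBMO \<mu> lam \<beta>\<^sub>0 \<rho>" for b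
    using that by (simp add: RBMO_def ud.loc_def)
  show ?thesis
  proof (cases "emeasure \<mu> UNIV = 0")
    case True
    \<comment> \<open>Over the zero measure only the measurability of the commutator needs an
      argument.\<close>
    then have null: "emeasure \<mu> (space \<mu>) = 0" by simp
    have "in_Lp q \<mu> (commutator \<mu> b K f)" if "b \<in> RBMO \<mu> lam \<beta>\<^sub>0 \<rho>" "in_Lp p \<mu> f" for b f
      using that(2) ud.loc_measurable[OF loc[OF that(1)]]
      by (intro Lp_norm_null_measure(2)[OF null q0] ud.measurable_commutator K) (simp_all add: in_Lp_def)
    then show ?thesis
      using Lp_norm_null_measure(1)[OF null q0] Lp_norm_null_measure(1)[OF null, of p] assms(9)
      by (intro exI[of _ 1] conjI ballI allI impI Lp_norm_null_measure(3)[OF null q0]) auto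
  next
    case False
    interpret nh: nhspace \<mu> lam C_lam \<beta>\<^sub>0 N0 by unfold_locales (rule False)
    obtain a where a: "\<rho> < 6 ^ a" using real_arch_pow[of 6 \<rho>] by auto
    \<comment> \<open>The added 1 makes \<open>C\<close> positive even if the other constants
      vanish.\<close>
    define C where "C = Ck * nh.commutator_const \<theta> p q a + 1"
    have commutator_const: "0 \<le> nh.commutator_const \<theta> p q a" using assms(9) \<theta> q by (rule nh.commutator_const_nonneg)
    have C: "0 < C" using Ck commutator_const by (simp add: C_def add_nonneg_pos)
    have main: "(AE x in \<mu>. frac_integral_converges \<mu> K f x \<and> frac_integral_converges \<mu> K (\<lambda>y. b y * f y) x) \<and>
           in_Lp q \<mu> (commutator \<mu> b K f) \<and>
           Lp_norm q \<mu> (commutator \<mu> b K f) \<le> C * D * Lp_norm p \<mu> f"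
      if b: "b \<in> RBMO \<mu> lam \<beta>\<^sub>0 \<rho>" and D: "0 < D" "RBMO_const \<mu> lam \<beta>\<^sub>0 \<rho> b D" and f: "in_Lp p \<mu> f" for b D f
    proof -
      interpret rb: rbmo \<mu> lam C_lam \<beta>\<^sub>0 N0 b \<rho> D a
        using assms(6) a D loc[OF b] by unfold_locales auto
      note bound = rb.commutator_bound[OF assms(9) \<theta> q K Ck f]
      have "Ck * nh.commutator_const \<theta> p q a * D * Lp_norm p \<mu> f \<le> C * D * Lp_norm p \<mu> f"
        using D(1) by (intro mult_right_mono) (auto simp: C_def Lp_norm_def)
      then show ?thesis using bound by (intro conjI) auto
    qed
    show ?thesis
    proof (intro exI[of _ C] conjI C ballI allI impI)
      fix b f assume b: "b \<in> RBMO \<mu> lam \<beta>\<^sub>0 \<rho>" and f: "in_Lp p \<mu> f"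
      let ?S = "{D. 0 < D \<and> RBMO_const \<mu> lam \<beta>\<^sub>0 \<rho> b D}"
      obtain D where D: "D \<in> ?S" using b by (auto simp: RBMO_def)
      show "AE x in \<mu>. frac_integral_converges \<mu> K f x \<and> frac_integral_converges \<mu> K (\<lambda>y. b y * f y) x"
        and "in_Lp q \<mu> (commutator \<mu> b K f)"
        using main[OF b _ _ f] D by blast+
      let ?N = "Lp_norm q \<mu> (commutator \<mu> b K f)" and ?v = "Lp_norm p \<mu> f"
      have all: "?N \<le> C * D * ?v" if "D \<in> ?S" for D using main[OF b _ _ f] that by blast
      show "?N \<le> C * RBMO_norm \<mu> lam \<beta>\<^sub>0 \<rho> b * ?v"
      \<comment> \<open>The bound holds for every admissible \<open>D\<close>. Passing to the
        infimum divides by the norm of f, so norm 0 is treated apart.\<close>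
      proof (cases "?v = 0")
        case True
        then show ?thesis using all[OF D] by simp
      next
        case False
        then have v: "0 < ?v" by (simp add: Lp_norm_def less_le)
        have "?N / (C * ?v) \<le> Inf ?S"
        proof (rule cInf_greatest)
          show "?S \<noteq> {}" using D by blast
          fix D assume "D \<in> ?S"
          then show "?N / (C * ?v) \<le> D" using all[of D] C v by (simp add: field_simps)
        qed
        then show ?thesis using C v by (simp add: RBMO_norm_def field_simps)
      qed
    qed
  qed
qed

end
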